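(* Let $\mu\in\mathcal{P}_1(\mathbb{R}^{dT})$. Then $\lim_{\sigma\to0}\mathcal{AW}_1(\mu,\mu\ast\mathcal{N}_\sigma)=0$.
   Context: $d\ge1$ and $T\ge1$ are integers. Points of $\mathbb{R}^{dT}$ are paths $x=x_{1:T}=(x_1,\dots,x_T)$ with $x_t\in\mathbb{R}^d$; $x_{1:t}=(x_1,\dots,x_t)\in\mathbb{R}^{dt}$, and $\mathbb{R}^{dt}$ carries the norm $\|x_{1:t}\|=\sum_{s=1}^t\|x_s\|_{\mathbb{R}^d}$ (Euclidean norm on $\mathbb{R}^d$). $\mathcal{P}_1(\mathbb{R}^{dT})$ is the set of Borel probability measures with finite first moment. $\mu_{x_{1:t}}\in\mathcal{P}(\mathbb{R}^d)$ is the disintegration kernel of $\mu$ (conditional law of $x_{t+1}$ given $x_{1:t}$); analogously $\pi_{x_{1:t},y_{1:t}}$ is the conditional law of $(x_{t+1},y_{t+1})$ given $(x_{1:t},y_{1:t})$ under $\pi\in\mathcal{P}(\mathbb{R}^{dT}\times\mathbb{R}^{dT})$. $\mathrm{Cpl}(\mu,\nu)$ is the set of couplings of $\mu,\nu$. $\mathrm{Cpl}_{\mathrm{bc}}(\mu,\nu)$, the set of bi-causal couplings, consists of those $\pi\in\mathrm{Cpl}(\mu,\nu)$ with $\pi_{x_{1:t},y_{1:t}}\in\mathrm{Cpl}(\mu_{x_{1:t}},\nu_{y_{1:t}})$ for $\pi$-a.e. $(x,y)$ and all $t=1,\dots,T-1$. The adapted Wasserstein distance is $\mathcal{AW}_1(\mu,\nu)=\inf_{\pi\in\mathrm{Cpl}_{\mathrm{bc}}(\mu,\nu)}\int\|x-y\|\,\pi(dx,dy)$.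 For $\sigma>0$, $\mathcal{N}_\sigma=\mathcal{N}(\mathbf{0},\sigma^2\mathbf{I}_{dT})$ and $\ast$ is convolution of measures. *)

theory Defs
  imports "HOL-Probability.Probability"
begin

text \<open>
  A path \<open>x = (x_1, \<dots>, x_T)\<close> with \<open>x_t\<close> in \<open>\<real>^d\<close> is a function in the extensional product
  over \<open>{1..T}\<close>, and \<open>d = CARD('d)\<close>. Since \<open>\<real>^d\<close> is second countable, the product
  sigma-algebra used here is the Borel sigma-algebra of \<open>\<real>^(dT)\<close>.
\<close>

definition path_space :: "nat \<Rightarrow> (nat \<Rightarrow> real ^ 'd) measure" where
  "path_space T = PiM {1..T} (\<lambda>_. borel)"

definition path_norm :: "nat \<Rightarrow> (nat \<Rightarrow> real ^ 'd) \<Rightarrow> real" where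
  "path_norm T x = (\<Sum>t\<in>{1..T}. norm (x t))"

definition P1 :: "nat \<Rightarrow> (nat \<Rightarrow> real ^ 'd) measure set" where
  "P1 T = {\<mu> \<in> space (prob_algebra (path_space T)). (\<integral>\<^sup>+ x. ennreal (path_norm T x) \<partial>\<mu>) < \<infinity>}"

definition Cpl :: "'a measure \<Rightarrow> 'b measure \<Rightarrow> ('a \<times> 'b) measure set" where
  "Cpl \<mu> \<nu> = {\<pi> \<in> space (prob_algebra (\<mu> \<Otimes>\<^sub>M \<nu>)). distr \<pi> \<mu> fst = \<mu> \<and> distr \<pi> \<nu> snd = \<nu>}"

text \<open>
  \<open>is_cond_law P M X N Y K\<close>: the probability kernel \<open>K\<close> from \<open>M\<close> to \<open>N\<close> is a version of the
  (regular) conditional law under \<open>P\<close> of the \<open>N\<close>-valued \<open>Y\<close> given the \<open>M\<close>-valued \<open>X\<close>.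
\<close>

definition is_cond_law ::
  "'w measure \<Rightarrow> 'a measure \<Rightarrow> ('w \<Rightarrow> 'a) \<Rightarrow> 'b measure \<Rightarrow> ('w \<Rightarrow> 'b) \<Rightarrow> ('a \<Rightarrow> 'b measure) \<Rightarrow> bool"
where
  "is_cond_law P M X N Y K \<longleftrightarrow>
     K \<in> M \<rightarrow>\<^sub>M prob_algebra N \<and>
     (\<forall>A\<in>sets M. \<forall>B\<in>sets N.
        emeasure P {w \<in> space P. X w \<in> A \<and> Y w \<in> B} =
        (\<integral>\<^sup>+ x\<in>A. emeasure (K x) B \<partial>distr P M X))"

definition is_disintegration ::
  "nat \<Rightarrow> (nat \<Rightarrow> real ^ 'd) measure \<Rightarrow> ((nat \<Rightarrow> real ^ 'd) \<Rightarrow> (real ^ 'd) measure) \<Rightarrow> bool"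
where
  "is_disintegration t \<mu> K \<longleftrightarrow>
     is_cond_law \<mu> (path_space t) (\<lambda>x. restrict x {1..t}) borel (\<lambda>x. x (Suc t)) K"

definition is_disintegration2 ::
  "nat \<Rightarrow> ((nat \<Rightarrow> real ^ 'd) \<times> (nat \<Rightarrow> real ^ 'd)) measure \<Rightarrow>
   ((nat \<Rightarrow> real ^ 'd) \<times> (nat \<Rightarrow> real ^ 'd) \<Rightarrow> ((real ^ 'd) \<times> (real ^ 'd)) measure) \<Rightarrow> bool"
where
  "is_disintegration2 t \<pi> K \<longleftrightarrow>
     is_cond_law \<pi>
       (path_space t \<Otimes>\<^sub>M path_space t) (\<lambda>(x, y). (restrict x {1..t}, restrict y {1..t}))
       (borel \<Otimes>\<^sub>M borel) (\<lambda>(x, y). (x (Suc t), y (Suc t))) K"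

text \<open>
  Disintegration kernels on these spaces exist and are unique up to null sets of the law of the
  conditioning variable. As \<open>\<pi>\<close> has marginals \<open>\<mu>\<close> and \<open>\<nu>\<close>, the almost-everywhere condition
  below does not depend on the chosen versions.
\<close>

definition Cpl_bc ::
  "nat \<Rightarrow> (nat \<Rightarrow> real ^ 'd) measure \<Rightarrow> (nat \<Rightarrow> real ^ 'd) measure \<Rightarrow>
   ((nat \<Rightarrow> real ^ 'd) \<times> (nat \<Rightarrow> real ^ 'd)) measure set"
where
  "Cpl_bc T \<mu> \<nu> = {\<pi> \<in> Cpl \<mu> \<nu>. \<forall>t\<in>{1..<T}. \<exists>K\<^sub>\<mu> K\<^sub>\<nu> K\<^sub>\<pi>.
     is_disintegration t \<mu> K\<^sub>\<mu> \<and> is_disintegration t \<nu> K\<^sub>\<nu> \<and> is_disintegration2 t \<pi> K\<^sub>\<pi> \<and>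
     (AE (x, y) in \<pi>. K\<^sub>\<pi> (restrict x {1..t}, restrict y {1..t}) \<in>
        Cpl (K\<^sub>\<mu> (restrict x {1..t})) (K\<^sub>\<nu> (restrict y {1..t})))}"

text \<open>The infimum is taken in the extended nonnegative reals, hence over the empty set it is \<open>\<infinity>\<close>.\<close>

definition AW1 ::
  "nat \<Rightarrow> (nat \<Rightarrow> real ^ 'd) measure \<Rightarrow> (nat \<Rightarrow> real ^ 'd) measure \<Rightarrow> ennreal"
where
  "AW1 T \<mu> \<nu> = (\<Sqinter>\<pi>\<in>Cpl_bc T \<mu> \<nu>. \<integral>\<^sup>+ (x, y). ennreal (path_norm T (\<lambda>t. x t - y t)) \<partial>\<pi>)"

text \<open>
  The Gaussian measure with mean \<open>0\<close> and covariance \<open>\<sigma>\<^sup>2 I\<close> on \<open>\<real>^(dT)\<close>, given by its density with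
  respect to Lebesgue measure; \<open>\<sigma>\<close> is the standard deviation and has to be positive.
\<close>

definition gaussian :: "nat \<Rightarrow> real \<Rightarrow> (nat \<Rightarrow> real ^ 'd) measure" where
  "gaussian T \<sigma> = density (PiM {1..T} (\<lambda>_. lborel))
     (\<lambda>x. ennreal (\<Prod>t\<in>{1..T}. \<Prod>i\<in>UNIV. normal_density 0 \<sigma> (x t $ i)))"

text \<open>
  The library's \<^const>\<open>convolution\<close> needs addition on the underlying type to be that of the space,
  whereas paths are added on \<open>{1..T}\<close> only.
\<close>

definition path_conv ::
  "nat \<Rightarrow> (nat \<Rightarrow> real ^ 'd) measure \<Rightarrow> (nat \<Rightarrow> real ^ 'd) measure \<Rightarrow> (nat \<Rightarrow> real ^ 'd) measure"
where
  "path_conv T \<mu> \<nu> = distr (\<mu> \<Otimes>\<^sub>M \<nu>) (path_space T) (\<lambda>(x, y). \<lambda>t\<in>{1..T}. x t + y t)"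

end

theory Submission
  imports Defs
begin

text \<open>
  The bound on the adapted distance comes from the Knothe-Rosenblatt coupling. Split every
  \<open>x_t\<close> into its \<open>d\<close> real coordinates, so that a path becomes a sequence of \<open>N = d T\<close> reals that
  are revealed one at a time. A law \<open>\<mu>\<close> of such sequences is generated by independent uniform
  variables \<open>u_0, u_1, \<dots>\<close> through \<open>X_n = Q_n (X_0, \<dots>, X_{n-1}, u_n)\<close>, where \<open>Q_n (x, \<cdot>)\<close> is the
  quantile function of the conditional law of the \<open>n\<close>-th coordinate
  (\<open>exists_conditional_quantile\<close>, \<open>distr_run\<close>). Generate \<open>X \<sim> \<mu>\<close> and \<open>Y \<sim> \<nu> = \<mu> * \<gamma>\<close>, each by its own
  quantile functions, from the same uniforms. At every time the next values of \<open>X\<close> and \<open>Y\<close> are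
  functions of their own pasts and of a block of uniforms that is independent of both pasts, so
  the coupling is bi-causal (\<open>run_path_coupling_bicausal\<close>).

  It remains to see that \<open>E |X_n - Y_n| \<rightarrow> 0\<close> for every \<open>n\<close> as the first absolute moments of the
  coordinates \<open>Z_k\<close> of the noise \<open>Z \<sim> \<gamma>\<close> vanish; this goes by strong induction on \<open>n\<close>
  (\<open>run_tendsto\<close>). Let \<open>F (x, q)\<close> and \<open>G (y, q)\<close> be the conditional probabilities, under \<open>\<mu>\<close> and \<open>\<nu>\<close>,
  that the \<open>n\<close>-th coordinate is below \<open>q\<close>. Integrating out \<open>u_n\<close>, the quantile coupling gives
  \<open>E |X_n - Y_n| = E \<integral> |F (X, q) - G (Y, q)| dq\<close>, with \<open>X\<close> and \<open>Y\<close> standing for the first \<open>n\<close>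
  coordinates (\<open>nn_integral_run_step\<close>).
  The function \<open>F\<close> need not be continuous in \<open>x\<close>. However, \<open>F - 1_{q > 0}\<close> has finite norm \<open>E |X_n|\<close>
  in \<open>L^1 (\<mu> \<otimes> dq)\<close>, so \<open>F\<close> is within \<open>\<epsilon>\<close> in that norm of some \<open>g\<close> for which
  \<open>x \<mapsto> g (x, \<cdot>)\<close> is Lipschitz into \<open>L^1 (dq)\<close> (\<open>exists_L1_lipschitz_approx\<close>). Insert \<open>g (X, q)\<close>
  and \<open>g (Y, q)\<close> between \<open>F (X, q)\<close> and \<open>G (Y, q)\<close>. The first of the three resulting terms is at
  most \<open>\<epsilon>\<close>, and the second is at most \<open>L\<close> times the sum of \<open>E |X_k - Y_k|\<close> over \<open>k < n\<close>. For the third,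
  which only depends on the law of \<open>Y\<close>, write \<open>Y = X' + Z\<close> with \<open>X' \<sim> \<mu>\<close> independent of \<open>Z \<sim> \<gamma>\<close>:
  then \<open>G (Y, q)\<close> is the conditional expectation of \<open>F (X', q - Z_n)\<close> given \<open>Y\<close>, and conditional
  expectations contract \<open>L^1\<close> (\<open>qcdf_contraction\<close>), so the third term is at most
  \<open>E \<integral> |F (X', q - Z_n) - g (X' + Z, q)| dq \<le> \<epsilon> + E |Z_n| + L \<Sum>_{k < n} E |Z_k|\<close>. In total, \<open>E |X_n - Y_n|\<close>
  is at most \<open>2 \<epsilon>\<close> plus terms that tend to \<open>0\<close>.

  Of the Gaussian noise only \<open>E |Z_k| = \<sigma> sqrt (2 / \<pi>)\<close> enters.
\<close>

section \<open>Quantile coupling of laws on the real line\<close>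

text \<open>The uniform distribution on the open unit interval.\<close>

definition unif :: "real measure" where
  "unif = uniform_measure lborel {0<..<1}"

lemma sets_unif [simp, measurable_cong]: "sets unif = sets borel"
  by (simp add: unif_def)

lemma space_unif [simp]: "space unif = UNIV"
  by (simp add: unif_def)

lemma prob_space_unif: "prob_space unif"
  unfolding unif_def by (rule prob_space_uniform_measure) auto

interpretation unif: prob_space unif
  by (rule prob_space_unif)

lemma AE_unif: "AE u in unif. 0 < u \<and> u < 1"
  unfolding unif_def by (rule AE_uniform_measureI) auto

lemma emeasure_unif_less: "emeasure unif {u. ennreal u < c} = min 1 c"
proof -
  have "emeasure unif {u. ennreal u < c} = emeasure lborel ({0<..<1} \<inter> {u. ennreal u < c})"
    unfolding unif_def by (subst emeasure_uniform_measure) (auto simp: divide_ennreal_def)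
  also have "\<dots> = min 1 c"
  proof (cases "1 \<le> c")
    case True
    then have "{0<..<1} \<inter> {u. ennreal u < c} = {0<..<1::real}"
      by (auto intro: less_le_trans[where y="1"] simp: ennreal_less_one_iff)
    with True show ?thesis by (simp add: min_def)
  next
    case False
    then obtain r where r: "c = ennreal r" "0 \<le> r" "r < 1"
      by (cases c) (auto simp: not_le)
    then have "{0<..<1} \<inter> {u. ennreal u < c} = {0<..<r::real}"
      by (auto simp: ennreal_less_iff)
    with r show ?thesis by (simp add: min_def)
  qed
  finally show ?thesis .
qed

lemma ennreal_abs_diff_eq_nn_integral:
  fixes a b :: real
  shows "ennreal \<bar>a - b\<bar> = (\<integral>\<^sup>+q. indicator {q. (a < q) \<noteq> (b < q)} q \<partial>lborel)"
proof -
  have "{q. (a < q) \<noteq> (b < q)} = {min a b <.. max a b}" by auto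
  then show ?thesis
    by (simp add: min_def max_def)
qed

text \<open>
  Up to null sets both \<open>A\<close> and \<open>B\<close> are initial segments of the unit interval, so one contains
  the other and the symmetric difference has the measure of the difference.
\<close>

lemma emeasure_unif_sym_diff:
  assumes [measurable]: "A \<in> sets borel" "B \<in> sets borel"
    and A: "\<And>u v. 0 < u \<Longrightarrow> u \<le> v \<Longrightarrow> v < 1 \<Longrightarrow> v \<in> A \<Longrightarrow> u \<in> A"
    and B: "\<And>u v. 0 < u \<Longrightarrow> u \<le> v \<Longrightarrow> v < 1 \<Longrightarrow> v \<in> B \<Longrightarrow> u \<in> B"
  shows "emeasure unif {u. (u \<in> A) \<noteq> (u \<in> B)} = ennreal \<bar>measure unif A - measure unif B\<bar>"
proof -
  have *: "emeasure unif {u. (u \<in> A) \<noteq> (u \<in> B)} = ennreal \<bar>measure unif A - measure unif B\<bar>"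
    if [measurable]: "A \<in> sets borel" "B \<in> sets borel" and sub: "A \<inter> {0<..<1} \<subseteq> B \<inter> {0<..<1}" for A B
  proof -
    have e: "emeasure unif {u. (u \<in> A) \<noteq> (u \<in> B)} = emeasure unif (B - A)"
    proof (intro emeasure_eq_AE)
      show "AE u in unif. u \<in> {u. (u \<in> A) \<noteq> (u \<in> B)} \<longleftrightarrow> u \<in> B - A"
        using AE_unif by eventually_elim (use sub in auto)
    qed auto
    have "measure unif (B - A) = measure unif (B \<inter> {0<..<1} - A \<inter> {0<..<1})"
      using AE_unif sub by (intro unif.finite_measure_eq_AE) auto
    also have "\<dots> = measure unif (B \<inter> {0<..<1}) - measure unif (A \<inter> {0<..<1})"
      using sub by (intro unif.finite_measure_Diff) auto
    also have "measure unif (B \<inter> {0<..<1}) = measure unif B"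
      using AE_unif by (intro unif.finite_measure_eq_AE) auto
    also have "measure unif (A \<inter> {0<..<1}) = measure unif A"
      using AE_unif by (intro unif.finite_measure_eq_AE) auto
    finally have m: "measure unif (B - A) = measure unif B - measure unif A" .
    have "0 \<le> measure unif B - measure unif A"
      unfolding m[symmetric] by simp
    with m e show ?thesis
      by (simp add: unif.emeasure_eq_measure abs_minus_commute)
  qed
  show ?thesis
  proof (cases "A \<inter> {0<..<1} \<subseteq> B \<inter> {0<..<1}")
    case True
    then show ?thesis by (intro *) auto
  next
    case False
    then obtain a where "a \<in> A \<inter> {0<..<1}" "a \<notin> B \<inter> {0<..<1}" by blast
    then have a: "a \<in> A" "a \<notin> B" "0 < a" "a < 1" by auto
    have "B \<inter> {0<..<1} \<subseteq> A \<inter> {0<..<1}"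
    proof
      fix b assume b: "b \<in> B \<inter> {0<..<1}"
      then have "b \<le> a" using B[of a b] a by (cases "b \<le> a") auto
      then show "b \<in> A \<inter> {0<..<1}" using A[of b a] a b by auto
    qed
    from *[OF _ _ this] show ?thesis
      by (simp add: abs_minus_commute eq_commute)
  qed
qed

text \<open>
  The cost of coupling two laws through their quantile functions is the \<open>L^1\<close> distance of their
  distribution functions. Only monotonicity on the open unit interval is used, so \<open>f\<close> and \<open>g\<close> may
  take any values elsewhere.
\<close>

lemma nn_integral_unif_abs_diff:
  fixes f g :: "real \<Rightarrow> real"
  assumes [measurable]: "f \<in> borel_measurable borel" "g \<in> borel_measurable borel"
    and f: "mono_on {0<..<1} f" and g: "mono_on {0<..<1} g"
  shows "(\<integral>\<^sup>+u. ennreal \<bar>f u - g u\<bar> \<partial>unif) =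
    (\<integral>\<^sup>+q. ennreal \<bar>measure unif {u. f u < q} - measure unif {u. g u < q}\<bar> \<partial>lborel)"
proof -
  let ?S = "{x \<in> space (unif \<Otimes>\<^sub>M lborel). (f (fst x) < snd x) \<noteq> (g (fst x) < snd x)}"
  interpret pair_sigma_finite unif lborel ..
  have "(\<integral>\<^sup>+u. ennreal \<bar>f u - g u\<bar> \<partial>unif) =
      (\<integral>\<^sup>+u. \<integral>\<^sup>+q. indicator {q. (f u < q) \<noteq> (g u < q)} q \<partial>lborel \<partial>unif)"
    by (simp only: ennreal_abs_diff_eq_nn_integral)
  also have "\<dots> = (\<integral>\<^sup>+u. \<integral>\<^sup>+q. indicator ?S (u, q) \<partial>lborel \<partial>unif)"
    by (intro nn_integral_cong) (auto simp: indicator_def space_pair_measure)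
  also have "\<dots> = (\<integral>\<^sup>+q. \<integral>\<^sup>+u. indicator ?S (u, q) \<partial>unif \<partial>lborel)"
    by (subst Fubini') simp_all
  also have "\<dots> = (\<integral>\<^sup>+q. emeasure unif {u. (u \<in> {u. f u < q}) \<noteq> (u \<in> {u. g u < q})} \<partial>lborel)"
    by (intro nn_integral_cong)
       (auto simp: indicator_def space_pair_measure nn_integral_indicator[symmetric]
         simp del: nn_integral_indicator intro!: nn_integral_cong)
  also have "\<dots> = (\<integral>\<^sup>+q. ennreal \<bar>measure unif {u. f u < q} - measure unif {u. g u < q}\<bar> \<partial>lborel)"
  proof (intro nn_integral_cong emeasure_unif_sym_diff)
    fix q u v :: real assume uv: "0 < u" "u \<le> v" "v < 1"
    show "u \<in> {u. f u < q}" if "v \<in> {u. f u < q}"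
      using mono_onD[OF f, of u v] uv that by simp
    show "u \<in> {u. g u < q}" if "v \<in> {u. g u < q}"
      using mono_onD[OF g, of u v] uv that by simp
  qed auto
  finally show ?thesis .
qed

section \<open>Conditional quantile functions\<close>

lemma pair_measure_eqI_Times:
  assumes "finite_measure P" and P: "sets P = sets (M \<Otimes>\<^sub>M N)" and Q: "sets Q = sets (M \<Otimes>\<^sub>M N)"
    and eq: "\<And>A B. A \<in> sets M \<Longrightarrow> B \<in> sets N \<Longrightarrow> emeasure P (A \<times> B) = emeasure Q (A \<times> B)"
  shows "P = Q"
proof -
  interpret finite_measure P by fact
  show ?thesis
  proof (rule measure_eqI_generator_eq[OF Int_stable_pair_measure_generator[of M N]])
    show "{a \<times> b |a b. a \<in> sets M \<and> b \<in> sets N} \<subseteq> Pow (space M \<times> space N)"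
      by (auto dest: sets.sets_into_space)
    show "range (\<lambda>_::nat. space M \<times> space N) \<subseteq> {a \<times> b |a b. a \<in> sets M \<and> b \<in> sets N}"
      by auto
  qed (auto simp: P Q sets_pair_measure eq emeasure_eq_measure simp flip: eq)
qed

lemma measure_eqI_Iio:
  fixes M N :: "real measure"
  assumes sets: "sets M = sets borel" "sets N = sets borel"
  assumes fin: "\<And>x. emeasure M {..<x} < \<infinity>"
  assumes eq: "\<And>x. emeasure M {..<x} = emeasure N {..<x}"
  shows "M = N"
proof (rule measure_eqI_generator_eq[where E="range lessThan" and A="\<lambda>n. {..<real n}" and \<Omega>=UNIV])
  show "Int_stable (range (lessThan::real \<Rightarrow> _))"
  proof (safe intro!: Int_stableI)
    fix a b :: real
    have "{..<a} \<inter> {..<b} = {..<min a b}" by auto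
    then show "{..<a} \<inter> {..<b} \<in> range lessThan" by simp
  qed
  show "sets M = sigma_sets UNIV (range lessThan)" "sets N = sigma_sets UNIV (range lessThan)"
    unfolding sets borel_Iio by auto
  show "(\<Union>i. {..<real i}) = UNIV"
    using reals_Archimedean2 by auto
  show "emeasure M {..<real i} \<noteq> \<infinity>" for i
    using fin[of "real i"] by simp
qed (auto simp: eq)

lemma AE_le_of_set_nn_integral_le:
  fixes f g :: "'a \<Rightarrow> ennreal"
  assumes [measurable]: "f \<in> borel_measurable D" "g \<in> borel_measurable D"
    and fin: "(\<integral>\<^sup>+x. g x \<partial>D) < \<infinity>"
    and le: "\<And>A. A \<in> sets D \<Longrightarrow> (\<integral>\<^sup>+x\<in>A. f x \<partial>D) \<le> (\<integral>\<^sup>+x\<in>A. g x \<partial>D)"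
  shows "AE x in D. f x \<le> g x"
proof -
  define N where "N = {x \<in> space D. g x < f x}"
  have [measurable]: "N \<in> sets D" unfolding N_def by measurable
  have fin_N: "(\<integral>\<^sup>+x\<in>N. g x \<partial>D) < \<infinity>"
    by (rule le_less_trans[OF nn_integral_mono fin]) (auto simp: indicator_def)
  have "(\<integral>\<^sup>+x. (f x * indicator N x - g x * indicator N x) \<partial>D) = (\<integral>\<^sup>+x\<in>N. f x \<partial>D) - (\<integral>\<^sup>+x\<in>N. g x \<partial>D)"
    using fin_N by (intro nn_integral_diff) (auto simp: N_def indicator_def)
  also have "\<dots> = 0"
    using le[of N] fin_N by (intro diff_eq_0_ennreal) auto
  finally have "AE x in D. f x * indicator N x - g x * indicator N x = 0"
    by (subst (asm) nn_integral_0_iff_AE) auto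
  then show ?thesis
    using AE_space
  proof eventually_elim
    case (elim x)
    show ?case
    proof (rule ccontr)
      assume "\<not> f x \<le> g x"
      with elim show False by (simp add: N_def diff_eq_0_iff_ennreal not_le)
    qed
  qed
qed

lemma AE_eq_1_of_nn_integral_eq_1:
  fixes f :: "'a \<Rightarrow> ennreal"
  assumes "prob_space D" and [measurable]: "f \<in> borel_measurable D"
    and "\<And>x. f x \<le> 1" "1 \<le> (\<integral>\<^sup>+x. f x \<partial>D)"
  shows "AE x in D. f x = 1"
proof -
  interpret prob_space D by fact
  have le: "(\<integral>\<^sup>+x. f x \<partial>D) \<le> (\<integral>\<^sup>+x. 1 \<partial>D)"
    using assms by (intro nn_integral_mono) auto
  have "(\<integral>\<^sup>+x. (1 - f x) \<partial>D) = (\<integral>\<^sup>+x. 1 \<partial>D) - (\<integral>\<^sup>+x. f x \<partial>D)"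
    using assms(2,3) le by (intro nn_integral_diff) (auto simp: emeasure_space_1 top_unique)
  also have "\<dots> = 0"
    using antisym[OF le] assms(4) by (simp add: emeasure_space_1)
  finally have "AE x in D. 1 - f x = 0"
    by (subst (asm) nn_integral_0_iff_AE) auto
  then show ?thesis
  proof eventually_elim
    case (elim x)
    then show ?case using assms(3)[of x] by (auto simp: diff_eq_0_iff_ennreal intro: antisym)
  qed
qed

text \<open>
  Every law on \<open>M \<times> \<real>\<close> is obtained from its first marginal and an independent uniform variable by
  a map that is nondecreasing in the uniform variable. No assumption on \<open>M\<close> is needed, since only
  the real component is disintegrated: the quantile function is the generalized inverse of
  conditional distribution functions, which are Radon-Nikodym derivatives.
\<close>

lemma exists_conditional_quantile:
  fixes P :: "('a \<times> real) measure"
  assumes "prob_space P" and P[measurable_cong]: "sets P = sets (M \<Otimes>\<^sub>M borel)"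
  shows "\<exists>Q. Q \<in> borel_measurable (M \<Otimes>\<^sub>M borel) \<and> (\<forall>x. mono_on {0<..<1} (\<lambda>u. Q (x, u))) \<and>
     P = distr (distr P M fst \<Otimes>\<^sub>M unif) (M \<Otimes>\<^sub>M borel) (\<lambda>(x, u). (x, Q (x, u)))"
proof -
  interpret P: prob_space P by fact
  define D where "D = distr P M fst"
  have sets_D[measurable_cong, simp]: "sets D = sets M" and space_D[simp]: "space D = space M"
    by (auto simp: D_def)
  interpret D: prob_space D
    unfolding D_def by (rule P.prob_space_distr) measurable
  interpret DU: pair_prob_space D unif ..
  have space_P: "space P = space M \<times> UNIV"
    using sets_eq_imp_space_eq[OF P] by (simp add: space_pair_measure)
  have emeasure_D: "emeasure D A = emeasure P (A \<times> UNIV)" if "A \<in> sets M" for A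
    unfolding D_def using that sets.sets_into_space[OF that]
    by (subst emeasure_distr) (auto simp: space_P intro!: arg_cong[where f="emeasure P"])
  define \<rho> where "\<rho> r = distr (density P (indicator (space M \<times> {..<r}))) M fst" for r :: real
  have [measurable]: "space M \<times> {..<r} \<in> sets P" for r :: real
    unfolding P by measurable
  have sets_\<rho>[measurable_cong, simp]: "sets (\<rho> r) = sets M" for r by (simp add: \<rho>_def)
  have emeasure_\<rho>: "emeasure (\<rho> r) A = emeasure P (A \<times> {..<r})" if A[measurable]: "A \<in> sets M" for A r
  proof -
    have "emeasure (\<rho> r) A = (\<integral>\<^sup>+p. indicator (space M \<times> {..<r}) p * indicator (fst -` A \<inter> space P) p \<partial>P)"
      unfolding \<rho>_def by (subst emeasure_distr) (auto simp: emeasure_density)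
    also have "\<dots> = (\<integral>\<^sup>+p. indicator (A \<times> {..<r}) p \<partial>P)"
      using sets.sets_into_space[OF A] by (intro nn_integral_cong) (auto simp: indicator_def space_P)
    also have "\<dots> = emeasure P (A \<times> {..<r})" by (rule nn_integral_indicator) (simp add: P)
    finally show ?thesis .
  qed
  have ac: "absolutely_continuous D (\<rho> r)" for r
  proof (unfold absolutely_continuous_def, safe)
    fix A assume A: "A \<in> null_sets D"
    then have [measurable]: "A \<in> sets M" by auto
    have "emeasure (\<rho> r) A \<le> emeasure D A"
      by (subst emeasure_\<rho>; (subst emeasure_D)?) (auto simp: P intro!: emeasure_mono)
    with A show "A \<in> null_sets (\<rho> r)" by (auto simp: null_sets_def)
  qed
  define F where "F r = RN_deriv D (\<rho> r)" for r
  have [measurable]: "F r \<in> borel_measurable M" for r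
    using borel_measurable_RN_deriv[of D "\<rho> r"] by (simp add: F_def cong: measurable_cong_sets)
  have F: "(\<integral>\<^sup>+x\<in>A. F r x \<partial>D) = emeasure P (A \<times> {..<r})" if [measurable]: "A \<in> sets M" for r A
    using D.density_RN_deriv[OF ac, of r] emeasure_\<rho>[of A r] emeasure_density[of "F r" D A] that
    by (simp add: F_def)
  have P_mono: "emeasure P (A \<times> {..<q}) \<le> emeasure P (A \<times> {..<r})"
    if [measurable]: "A \<in> sets M" and "q \<le> r" for A q r
    using that by (intro emeasure_mono) (auto simp: P)
  have F_fin: "(\<integral>\<^sup>+x. F r x \<partial>D) < \<infinity>" for r
  proof -
    have "(\<integral>\<^sup>+x. F r x \<partial>D) = (\<integral>\<^sup>+x\<in>space M. F r x \<partial>D)"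
      by (intro nn_integral_cong) (auto simp: indicator_def)
    then show ?thesis by (simp only: F[OF sets.top]) (simp add: P.emeasure_eq_measure)
  qed
  have F_mono: "AE x in D. F q x \<le> F r x" if "q \<le> r" for q r
    using F_fin that by (intro AE_le_of_set_nn_integral_le) (auto simp: F P_mono)
  have F_le1: "AE x in D. F r x \<le> 1" for r
  proof (rule AE_le_of_set_nn_integral_le)
    fix A assume "A \<in> sets D"
    then have [measurable]: "A \<in> sets M" by simp
    have "emeasure P (A \<times> {..<r}) \<le> emeasure P (A \<times> UNIV)"
      by (intro emeasure_mono) (auto simp: P)
    then show "(\<integral>\<^sup>+x\<in>A. F r x \<partial>D) \<le> (\<integral>\<^sup>+x\<in>A. 1 \<partial>D)"
      by (simp add: F emeasure_D)
  qed (simp_all add: D.emeasure_eq_measure)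
  \<comment> \<open>The values \<open>F r x\<close> for different \<open>r\<close> are unrelated on null sets of \<open>x\<close>; the supremum over rationals below \<open>r\<close> is monotone in \<open>r\<close> for every \<open>x\<close>.\<close>
  define G where "G r x = (SUP q\<in>{q\<in>\<rat>. q < r}. F q x)" for r x
  have cnt: "countable {q\<in>\<rat>. q < r}" for r :: real
    by (rule countable_subset[OF _ countable_rat]) auto
  have [measurable]: "G r \<in> borel_measurable M" for r
    unfolding G_def by (rule borel_measurable_SUP[OF cnt]) measurable
  have P_SUP: "(SUP k. emeasure P (A \<times> {..<r - 1 / Suc k})) = emeasure P (A \<times> {..<r})"
    if [measurable]: "A \<in> sets M" for A r
  proof (subst SUP_emeasure_incseq)
    have "(\<Union>k. {..<r - 1 / Suc k}) = {..<r}"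
    proof safe
      fix x assume "x < r"
      then obtain k where "1 / Suc k < r - x"
        using nat_approx_posE[of "r - x"] by auto
      then show "x \<in> (\<Union>k. {..<r - 1 / Suc k})" by (auto intro!: exI[of _ k])
    qed (auto intro: less_trans)
    then have "(\<Union>k. A \<times> {..<r - 1 / real (Suc k)}) = A \<times> {..<r}" by blast
    then show "emeasure P (\<Union>i. A \<times> {..<r - 1 / real (Suc i)}) = emeasure P (A \<times> {..<r})"
      by simp
    show "incseq (\<lambda>i. A \<times> {..<r - 1 / real (Suc i)})"
    proof (rule incseq_SucI)
      fix i
      have "1 / real (Suc (Suc i)) \<le> 1 / real (Suc i)" by (intro frac_le) auto
      then have "{..<r - 1 / real (Suc i)} \<subseteq> {..<r - 1 / real (Suc (Suc i))}" by auto
      then show "A \<times> {..<r - 1 / real (Suc i)} \<subseteq> A \<times> {..<r - 1 / real (Suc (Suc i))}"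
        by (intro Sigma_mono) simp_all
    qed
  qed (auto simp: P)
  \<comment> \<open>Left-continuity of \<open>r \<mapsto> P (A \<times> {..<r})\<close> shows that nothing is lost by passing to the supremum.\<close>
  have G: "(\<integral>\<^sup>+x\<in>A. min 1 (G r x) \<partial>D) = emeasure P (A \<times> {..<r})" if A[measurable]: "A \<in> sets M" for A r
  proof (rule antisym)
    have "AE x in D. \<forall>q\<in>{q\<in>\<rat>. q < r}. F q x \<le> F r x"
      using cnt by (intro AE_ball_countable[THEN iffD2] ballI F_mono) auto
    then have "(\<integral>\<^sup>+x\<in>A. min 1 (G r x) \<partial>D) \<le> (\<integral>\<^sup>+x\<in>A. F r x \<partial>D)"
      by (intro nn_integral_mono_AE)
         (auto simp: G_def indicator_def elim!: eventually_mono intro!: min.coboundedI2 SUP_least)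
    then show "(\<integral>\<^sup>+x\<in>A. min 1 (G r x) \<partial>D) \<le> emeasure P (A \<times> {..<r})"
      by (simp add: F)
    have "emeasure P (A \<times> {..<r - 1 / Suc k}) \<le> (\<integral>\<^sup>+x\<in>A. min 1 (G r x) \<partial>D)" for k
    proof -
      obtain q where q: "q \<in> \<rat>" "r - 1 / Suc k < q" "q < r"
        using Rats_dense_in_real[of "r - 1 / Suc k" r] by auto
      have "emeasure P (A \<times> {..<r - 1 / Suc k}) \<le> emeasure P (A \<times> {..<q})"
        using q by (intro P_mono) auto
      also have "\<dots> = (\<integral>\<^sup>+x\<in>A. F q x \<partial>D)" by (simp add: F)
      also have "\<dots> \<le> (\<integral>\<^sup>+x\<in>A. min 1 (G r x) \<partial>D)"
        using F_le1[of q] q by (intro nn_integral_mono_AE, elim eventually_mono)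
          (auto simp: G_def indicator_def intro!: SUP_upper)
      finally show ?thesis .
    qed
    then show "emeasure P (A \<times> {..<r}) \<le> (\<integral>\<^sup>+x\<in>A. min 1 (G r x) \<partial>D)"
      by (subst P_SUP[OF A, symmetric]) (intro SUP_least)
  qed
  have G': "(\<integral>\<^sup>+x. min 1 (G r x) \<partial>D) = emeasure P (space M \<times> {..<r})" for r
    unfolding G[OF sets.top, symmetric] by (intro nn_integral_cong) (auto simp: indicator_def)
  have G_mono: "G q x \<le> G r x" if "q \<le> r" for q r x
    unfolding G_def using that by (intro SUP_subset_mono) auto
  \<comment> \<open>On this set of full measure \<open>min 1 (G r x)\<close> has the limits \<open>1\<close> and \<open>0\<close> as \<open>r\<close> tends to the two infinities, so the generalized inverse is finite.\<close>
  define good where "good = {x \<in> space M. (SUP k. min 1 (G (real k) x)) = 1 \<and> (INF k. min 1 (G (- real k) x)) = 0}"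
  have [measurable]: "good \<in> sets M" unfolding good_def by measurable
  have AE_good: "AE x in D. x \<in> good"
  proof -
    have "AE x in D. (SUP k. min 1 (G (real k) x)) = 1"
    proof (rule AE_eq_1_of_nn_integral_eq_1)
      have "(\<integral>\<^sup>+x. (SUP k. min 1 (G (real k) x)) \<partial>D) = (SUP k. \<integral>\<^sup>+x. min 1 (G (real k) x) \<partial>D)"
        by (intro nn_integral_monotone_convergence_SUP)
           (auto simp: incseq_def le_fun_def intro!: min.coboundedI2 G_mono)
      also have "\<dots> = (SUP k. emeasure P (space M \<times> {..<real k}))" by (simp add: G')
      also have "\<dots> = emeasure P (\<Union>k. space M \<times> {..<real k})"
        by (intro SUP_emeasure_incseq) (auto simp: P incseq_def)
      also have "(\<Union>k. space M \<times> {..<real k}) = space P"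
      proof -
        have "(\<Union>k. {..<real k}) = UNIV" using reals_Archimedean2 by auto
        then show ?thesis unfolding space_P by blast
      qed
      finally show "1 \<le> (\<integral>\<^sup>+x. (SUP k. min 1 (G (real k) x)) \<partial>D)"
        by (simp add: P.emeasure_space_1)
    qed (auto intro!: D.prob_space_axioms SUP_least)
    moreover have "AE x in D. (INF k. min 1 (G (- real k) x)) = 0"
    proof (subst nn_integral_0_iff_AE[symmetric])
      have "(\<integral>\<^sup>+x. (INF k. min 1 (G (- real k) x)) \<partial>D) \<le> (INF k. \<integral>\<^sup>+x. min 1 (G (- real k) x) \<partial>D)"
        by (intro INF_greatest nn_integral_mono INF_lower) auto
      also have "\<dots> = (INF k. emeasure P (space M \<times> {..<- real k}))" by (simp add: G')
      also have "\<dots> = emeasure P (\<Inter>k. space M \<times> {..<- real k})"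
        by (intro INF_emeasure_decseq) (auto simp: P decseq_def)
      also have "(\<Inter>k. space M \<times> {..<- real k}) = {}"
      proof -
        have "\<exists>k. \<not> b < - real k" for b
        proof -
          obtain k where "- b < real k" using reals_Archimedean2 by blast
          then show ?thesis by (intro exI[of _ k]) simp
        qed
        then show ?thesis by blast
      qed
      finally show "(\<integral>\<^sup>+x. (INF k. min 1 (G (- real k) x)) \<partial>D) = 0"
        by simp
    qed measurable
    ultimately show ?thesis
      using AE_space by eventually_elim (auto simp: good_def)
  qed
  \<comment> \<open>The generalized inverse of \<open>G\<close> in the extended reals; \<open>Q\<close> is set to \<open>0\<close> where it might be infinite.\<close>
  define I where "I x u = (INF q\<in>\<rat>. if ennreal u < F q x then ereal q else \<infinity>)" for x and u :: real
  define Q where "Q = (\<lambda>(x, u). if x \<in> good \<and> 0 < u \<and> u < 1 then real_of_ereal (I x u) else 0)"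
  have I_less: "I x u < ereal r \<longleftrightarrow> ennreal u < G r x" for x u r
    unfolding I_def G_def INF_less_iff less_SUP_iff by (auto split: if_splits)
  have [measurable]: "(\<lambda>(x, u). I x u) \<in> borel_measurable (M \<Otimes>\<^sub>M borel)"
    unfolding I_def split_beta' by (rule borel_measurable_INF[OF countable_rat]) measurable
  have Q_meas[measurable]: "Q \<in> borel_measurable (M \<Otimes>\<^sub>M borel)"
    unfolding Q_def by measurable
  have Q_I: "ereal (Q (x, u)) = I x u" if "x \<in> good" "0 < u" "u < 1" for x u
  proof -
    have "ennreal u < (SUP k. min 1 (G (real k) x))"
      using that by (simp add: good_def ennreal_less_one_iff)
    then obtain k where "ennreal u < G (real k) x" by (auto simp: less_SUP_iff)
    then have 1: "I x u < \<infinity>" using I_less[of x u "real k"] by auto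
    have "(INF k. min 1 (G (- real k) x)) < ennreal u"
      using that by (simp add: good_def)
    then obtain k where "min 1 (G (- real k) x) < ennreal u" by (auto simp: INF_less_iff)
    then have "\<not> ennreal u < G (- real k) x" using that 
      by (auto simp: min_def not_less ennreal_less_one_iff split: if_splits)
    then have 2: "I x u \<noteq> - \<infinity>" using I_less[of x u "- real k"] by auto
    show ?thesis using that 1 2 by (auto simp: Q_def ereal_real)
  qed
  have Q_mono: "mono_on {0<..<1} (\<lambda>u. Q (x, u))" for x
  proof (rule mono_onI)
    fix u v :: real assume uv: "u \<in> {0<..<1}" "v \<in> {0<..<1}" "u \<le> v"
    show "Q (x, u) \<le> Q (x, v)"
    proof (cases "x \<in> good")
      case True
      have "I x u \<le> I x v"
        unfolding I_def using uv by (intro INF_mono') (auto intro: le_less_trans ennreal_leI)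
      then show ?thesis using True uv Q_I[of x u] Q_I[of x v] by (metis ereal_less_eq(3) greaterThanLessThan_iff)
    qed (simp add: Q_def)
  qed
  have Q_less: "emeasure unif {u. Q (x, u) < r} = min 1 (G r x)" if "x \<in> good" for x r
  proof -
    have [measurable]: "x \<in> space M" using that by (auto simp: good_def)
    have "emeasure unif {u. Q (x, u) < r} = emeasure unif {u. ennreal u < G r x}"
    proof (rule emeasure_eq_AE)
      show "AE u in unif. u \<in> {u. Q (x, u) < r} \<longleftrightarrow> u \<in> {u. ennreal u < G r x}"
        using AE_unif
      proof eventually_elim
        case (elim u)
        then show ?case using Q_I[OF that, of u] I_less[of x u r] by (metis ereal_less(2) less_ereal.simps(1) mem_Collect_eq)
      qed
    qed measurable
    then show ?thesis by (simp add: emeasure_unif_less)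
  qed
  have "P = distr (D \<Otimes>\<^sub>M unif) (M \<Otimes>\<^sub>M borel) (\<lambda>(x, u). (x, Q (x, u)))" (is "_ = ?R")
  proof (rule pair_measure_eqI_Times[of _ M borel])
    interpret R: prob_space ?R
      by (intro DU.prob_space_distr) measurable
    have lt: "emeasure P (A \<times> {..<r}) = emeasure ?R (A \<times> {..<r})" if A[measurable]: "A \<in> sets M" for A r
    proof -
      let ?S = "{p \<in> space (D \<Otimes>\<^sub>M unif). fst p \<in> A \<and> Q p < r}"
      have "emeasure ?R (A \<times> {..<r}) = emeasure (D \<Otimes>\<^sub>M unif) ?S"
        by (subst emeasure_distr) (auto simp: space_pair_measure intro!: arg_cong[where f="emeasure _"])
      also have "\<dots> = (\<integral>\<^sup>+x. emeasure unif (Pair x -` ?S) \<partial>D)"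
        by (intro unif.emeasure_pair_measure_alt) measurable
      also have "\<dots> = (\<integral>\<^sup>+x\<in>A. min 1 (G r x) \<partial>D)"
      proof (rule nn_integral_cong_AE)
        show "AE x in D. emeasure unif (Pair x -` ?S) = min 1 (G r x) * indicator A x"
          using AE_good
        proof eventually_elim
          case (elim x)
          then have "x \<in> space M" by (auto simp: good_def)
          then have "Pair x -` ?S = (if x \<in> A then {u. Q (x, u) < r} else {})"
            by (auto simp: space_pair_measure)
          with Q_less[OF elim, of r] show ?case by (cases "x \<in> A") simp_all
        qed
      qed
      finally show ?thesis by (simp add: G)
    qed
    show "emeasure P (A \<times> B) = emeasure ?R (A \<times> B)" if A[measurable]: "A \<in> sets M" and B[measurable]: "B \<in> sets borel" for A B
    proof -
      define m where "m R = distr (density R (indicator (A \<times> UNIV))) borel snd" for R :: "('a \<times> real) measure"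
      have m: "emeasure (m R) B = emeasure R (A \<times> B)"
        if R[measurable_cong]: "sets R = sets (M \<Otimes>\<^sub>M borel)" and [measurable]: "B \<in> sets borel" for R B
      proof -
        have sp: "space R = space M \<times> UNIV"
          using sets_eq_imp_space_eq[OF R] by (simp add: space_pair_measure)
        have "emeasure (m R) B = (\<integral>\<^sup>+p. indicator (A \<times> UNIV) p * indicator (snd -` B \<inter> space R) p \<partial>R)"
          unfolding m_def by (subst emeasure_distr) (auto simp: emeasure_density)
        also have "\<dots> = (\<integral>\<^sup>+p. indicator (A \<times> B) p \<partial>R)"
          by (intro nn_integral_cong) (auto simp: indicator_def)
        also have "\<dots> = emeasure R (A \<times> B)" by (rule nn_integral_indicator) (simp add: R)
        finally show ?thesis .
      qed
      have "m P = m ?R"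
        by (rule measure_eqI_Iio) (auto simp: m P lt[symmetric] P.emeasure_eq_measure, auto simp: m_def)
      then show ?thesis using m[of P B] m[of ?R B] by (simp add: P)
    qed
  qed (auto simp: P intro: P.finite_measure_axioms)
  with Q_meas Q_mono show ?thesis unfolding D_def by blast
qed

section \<open>Approximation by Lipschitz maps into integrable functions\<close>

text \<open>
  Real sequences of length \<open>n\<close>, indexed from \<open>0\<close> and equal to \<open>undefined\<close> beyond.
\<close>

abbreviation coord_space :: "nat \<Rightarrow> (nat \<Rightarrow> real) measure" where
  "coord_space n \<equiv> PiM {..<n} (\<lambda>_. borel)"

text \<open>
  Lower orthants with corner \<open>a\<close>. They generate the sigma-algebra, are stable under intersection, and
  their indicators are limits of Lipschitz functions.
\<close>

definition orthant :: "nat \<Rightarrow> (nat \<Rightarrow> real) \<Rightarrow> (nat \<Rightarrow> real) set" where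
  "orthant n a = {x \<in> space (coord_space n). \<forall>i<n. x i \<le> a i}"

lemma sets_coord_space: "sets (coord_space n) = sigma_sets (space (coord_space n)) (range (orthant n))"
proof -
  let ?P = "{{f\<in>(\<Pi>\<^sub>E i\<in>{..<n}. UNIV::real set). \<forall>i\<in>j. f i \<in> A i} | A j. j \<in> {{..<n}} \<and> A \<in> (\<Pi> i\<in>j. range atMost)}"
  have "sets (\<Pi>\<^sub>M i\<in>{..<n}. sigma (UNIV::real set) (range atMost)) = sets (sigma (\<Pi>\<^sub>E i\<in>{..<n}. UNIV) ?P)"
  proof (rule sets_PiM_sigma)
    show "\<exists>S\<subseteq>range atMost. countable S \<and> (UNIV::real set) = \<Union>S" for i
      by (intro exI[of _ "range (\<lambda>k::nat. {..real k})"]) (auto intro: real_arch_simple)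
  qed auto
  also have "?P = range (orthant n)"
  proof (intro equalityI subsetI)
    fix X assume "X \<in> ?P"
    then obtain A where A: "A \<in> (\<Pi> i\<in>{..<n}. range atMost)"
      and X: "X = {f\<in>(\<Pi>\<^sub>E i\<in>{..<n}. UNIV::real set). \<forall>i\<in>{..<n}. f i \<in> A i}" by auto
    from A have "\<forall>i\<in>{..<n}. \<exists>a. A i = {..a}" by auto
    then obtain a where "\<forall>i\<in>{..<n}. A i = {..a i}" by metis
    then have "X = orthant n a" by (auto simp: X orthant_def space_PiM)
    then show "X \<in> range (orthant n)" by auto
  next
    fix X assume "X \<in> range (orthant n)"
    then obtain a where "X = orthant n a" by auto
    then show "X \<in> ?P"
      by (auto simp: orthant_def space_PiM intro!: exI[of _ "\<lambda>i. {..a i}"])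
  qed
  also have "sets (sigma (\<Pi>\<^sub>E i\<in>{..<n}. UNIV) (range (orthant n))) = sigma_sets (space (coord_space n)) (range (orthant n))"
    by (subst sets_measure_of) (auto simp: orthant_def space_PiM)
  finally show ?thesis
    by (simp add: borel_eq_atMost)
qed

lemma sets_coord_space_pair:
  "sets (coord_space n \<Otimes>\<^sub>M borel) =
    sigma_sets (space (coord_space n) \<times> UNIV) {orthant n a \<times> B |a B. B \<in> sets (borel :: real measure)}"
proof -
  have "sets (coord_space n \<Otimes>\<^sub>M (borel :: real measure)) =
      sets (sigma (space (coord_space n) \<times> space borel) {a \<times> b |a b. a \<in> range (orthant n) \<and> b \<in> sets borel})"
  proof (rule sets_pair_eq[where Ca="range (\<lambda>k::nat. orthant n (\<lambda>_. real k))" and Cb="{UNIV}"])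
    show "\<Union> (range (\<lambda>k::nat. orthant n (\<lambda>_. real k))) = space (coord_space n)"
    proof (intro equalityI subsetI)
      fix x :: "nat \<Rightarrow> real" assume x: "x \<in> space (coord_space n)"
      obtain k :: nat where k: "(\<Sum>i<n. \<bar>x i\<bar>) \<le> real k" using real_arch_simple by blast
      have "x i \<le> real k" if "i < n" for i
        using member_le_sum[of i "{..<n}" "\<lambda>i. \<bar>x i\<bar>"] that k by auto
      with x show "x \<in> \<Union> (range (\<lambda>k::nat. orthant n (\<lambda>_. real k)))"
        by (auto simp: orthant_def)
    qed (auto simp: orthant_def)
    show "sets (borel :: real measure) = sigma_sets (space borel) (sets borel)"
      by (metis sets.sigma_sets_eq)
  qed (auto simp: sets_coord_space orthant_def)
  also have "\<dots> = sigma_sets (space (coord_space n) \<times> UNIV) {orthant n a \<times> B |a B. B \<in> sets (borel :: real measure)}"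
    by (subst sets_measure_of)
       (auto simp: orthant_def dest: sets.sets_into_space intro!: arg_cong2[where f=sigma_sets])
  finally show ?thesis .
qed

text \<open>
  Bounded functions \<open>g\<close> for which \<open>x \<mapsto> g (x, \<cdot>)\<close> is Lipschitz from \<open>\<real>^n\<close>, with the sum norm, to
  \<open>L^1 (dq)\<close>. The functions \<open>g (x, \<cdot>)\<close> need not be integrable, only their differences, so that
  distribution functions are not excluded.
\<close>

definition L1_lipschitz :: "nat \<Rightarrow> ((nat \<Rightarrow> real) \<times> real \<Rightarrow> real) \<Rightarrow> bool" where
  "L1_lipschitz n g \<longleftrightarrow> g \<in> borel_measurable (coord_space n \<Otimes>\<^sub>M borel) \<and>
    (\<exists>B. \<forall>p. \<bar>g p\<bar> \<le> B) \<and>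
    (\<exists>L\<ge>0. \<forall>x\<in>space (coord_space n). \<forall>y\<in>space (coord_space n).
      (\<integral>\<^sup>+q. ennreal \<bar>g (x, q) - g (y, q)\<bar> \<partial>lborel) \<le> ennreal (L * (\<Sum>i<n. \<bar>x i - y i\<bar>)))"

lemma L1_lipschitz_measurable: "L1_lipschitz n g \<Longrightarrow> g \<in> borel_measurable (coord_space n \<Otimes>\<^sub>M borel)"
  by (simp add: L1_lipschitz_def)

lemma L1_lipschitz_snd:
  assumes "f \<in> borel_measurable borel" "\<And>q. \<bar>f q\<bar> \<le> B"
  shows "L1_lipschitz n (\<lambda>p. f (snd p))"
  unfolding L1_lipschitz_def using assms by (intro conjI exI[of _ B] exI[of _ 0]) auto

lemma L1_lipschitz_add:
  assumes f: "L1_lipschitz n f" and g: "L1_lipschitz n g"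
  shows "L1_lipschitz n (\<lambda>p. f p + g p)"
proof -
  note [measurable] = f[THEN L1_lipschitz_measurable] g[THEN L1_lipschitz_measurable]
  obtain B C where B: "\<And>p. \<bar>f p\<bar> \<le> B" and C: "\<And>p. \<bar>g p\<bar> \<le> C"
    using f g by (auto simp: L1_lipschitz_def)
  obtain K L where KL: "0 \<le> K" "0 \<le> L" and
    K: "\<And>x y. x \<in> space (coord_space n) \<Longrightarrow> y \<in> space (coord_space n) \<Longrightarrow>
      (\<integral>\<^sup>+q. ennreal \<bar>f (x, q) - f (y, q)\<bar> \<partial>lborel) \<le> ennreal (K * (\<Sum>i<n. \<bar>x i - y i\<bar>))" and
    L: "\<And>x y. x \<in> space (coord_space n) \<Longrightarrow> y \<in> space (coord_space n) \<Longrightarrow>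
      (\<integral>\<^sup>+q. ennreal \<bar>g (x, q) - g (y, q)\<bar> \<partial>lborel) \<le> ennreal (L * (\<Sum>i<n. \<bar>x i - y i\<bar>))"
    using f g by (auto simp: L1_lipschitz_def)
  have "(\<integral>\<^sup>+q. ennreal \<bar>(f (x, q) + g (x, q)) - (f (y, q) + g (y, q))\<bar> \<partial>lborel)
      \<le> ennreal ((K + L) * (\<Sum>i<n. \<bar>x i - y i\<bar>))"
    if [measurable]: "x \<in> space (coord_space n)" "y \<in> space (coord_space n)" for x y
  proof -
    have "(\<integral>\<^sup>+q. ennreal \<bar>(f (x, q) + g (x, q)) - (f (y, q) + g (y, q))\<bar> \<partial>lborel)
      \<le> (\<integral>\<^sup>+q. ennreal \<bar>f (x, q) - f (y, q)\<bar> + ennreal \<bar>g (x, q) - g (y, q)\<bar> \<partial>lborel)"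
      by (intro nn_integral_mono) (simp flip: ennreal_plus)
    also have "\<dots> = (\<integral>\<^sup>+q. ennreal \<bar>f (x, q) - f (y, q)\<bar> \<partial>lborel) + (\<integral>\<^sup>+q. ennreal \<bar>g (x, q) - g (y, q)\<bar> \<partial>lborel)"
      by (intro nn_integral_add) measurable
    also have "\<dots> \<le> ennreal (K * (\<Sum>i<n. \<bar>x i - y i\<bar>)) + ennreal (L * (\<Sum>i<n. \<bar>x i - y i\<bar>))"
      by (intro add_mono K L that)
    also have "\<dots> = ennreal ((K + L) * (\<Sum>i<n. \<bar>x i - y i\<bar>))"
      using KL by (simp add: distrib_right sum_nonneg flip: ennreal_plus)
    finally show ?thesis .
  qed
  moreover have "\<bar>f p + g p\<bar> \<le> B + C" for p
    using B[of p] C[of p] by linarith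
  ultimately show ?thesis
    unfolding L1_lipschitz_def using KL by (intro conjI exI[of _ "B + C"] exI[of _ "K + L"] allI ballI) auto
qed

lemma L1_lipschitz_scale:
  assumes f: "L1_lipschitz n f"
  shows "L1_lipschitz n (\<lambda>p. c * f p)"
proof -
  note [measurable] = f[THEN L1_lipschitz_measurable]
  obtain B where B: "\<And>p. \<bar>f p\<bar> \<le> B"
    using f by (auto simp: L1_lipschitz_def)
  obtain K where K0: "0 \<le> K" and
    K: "\<And>x y. x \<in> space (coord_space n) \<Longrightarrow> y \<in> space (coord_space n) \<Longrightarrow>
      (\<integral>\<^sup>+q. ennreal \<bar>f (x, q) - f (y, q)\<bar> \<partial>lborel) \<le> ennreal (K * (\<Sum>i<n. \<bar>x i - y i\<bar>))"
    using f by (auto simp: L1_lipschitz_def)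
  have "(\<integral>\<^sup>+q. ennreal \<bar>c * f (x, q) - c * f (y, q)\<bar> \<partial>lborel)
      \<le> ennreal ((\<bar>c\<bar> * K) * (\<Sum>i<n. \<bar>x i - y i\<bar>))"
    if [measurable]: "x \<in> space (coord_space n)" "y \<in> space (coord_space n)" for x y
  proof -
    have "(\<integral>\<^sup>+q. ennreal \<bar>c * f (x, q) - c * f (y, q)\<bar> \<partial>lborel)
      = (\<integral>\<^sup>+q. ennreal \<bar>c\<bar> * ennreal \<bar>f (x, q) - f (y, q)\<bar> \<partial>lborel)"
      by (intro nn_integral_cong) (simp add: abs_mult flip: ennreal_mult right_diff_distrib)
    also have "\<dots> = ennreal \<bar>c\<bar> * (\<integral>\<^sup>+q. ennreal \<bar>f (x, q) - f (y, q)\<bar> \<partial>lborel)"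
      by (intro nn_integral_cmult) measurable
    also have "\<dots> \<le> ennreal \<bar>c\<bar> * ennreal (K * (\<Sum>i<n. \<bar>x i - y i\<bar>))"
      by (intro mult_left_mono K that) simp
    also have "\<dots> = ennreal ((\<bar>c\<bar> * K) * (\<Sum>i<n. \<bar>x i - y i\<bar>))"
      using K0 by (simp add: sum_nonneg mult.assoc flip: ennreal_mult)
    finally show ?thesis .
  qed
  moreover have "\<bar>c * f p\<bar> \<le> \<bar>c\<bar> * B" for p
    using B[of p] by (simp add: abs_mult mult_left_mono)
  ultimately show ?thesis
    unfolding L1_lipschitz_def using K0 by (intro conjI exI[of _ "\<bar>c\<bar> * B"] exI[of _ "\<bar>c\<bar> * K"] allI ballI) auto
qed

text \<open>
  A function that is \<open>1\<close> on the orthant, \<open>k\<close>-Lipschitz for the sum norm, and decreases to the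
  indicator of the orthant as \<open>k\<close> tends to infinity.
\<close>

definition orthant_cutoff :: "nat \<Rightarrow> (nat \<Rightarrow> real) \<Rightarrow> nat \<Rightarrow> (nat \<Rightarrow> real) \<Rightarrow> real" where
  "orthant_cutoff n a k x = max 0 (1 - real k * (\<Sum>i<n. max 0 (x i - a i)))"

lemma orthant_cutoff_measurable [measurable]: "orthant_cutoff n a k \<in> borel_measurable (coord_space n)"
  unfolding orthant_cutoff_def by measurable

lemma orthant_cutoff_bounds: "0 \<le> orthant_cutoff n a k x" "orthant_cutoff n a k x \<le> 1"
  by (auto simp: orthant_cutoff_def sum_nonneg)

lemma orthant_cutoff_lipschitz:
  "\<bar>orthant_cutoff n a k x - orthant_cutoff n a k y\<bar> \<le> real k * (\<Sum>i<n. \<bar>x i - y i\<bar>)"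
proof -
  have "\<bar>orthant_cutoff n a k x - orthant_cutoff n a k y\<bar> \<le>
      \<bar>real k * (\<Sum>i<n. max 0 (x i - a i)) - real k * (\<Sum>i<n. max 0 (y i - a i))\<bar>"
    unfolding orthant_cutoff_def by linarith
  also have "\<dots> = real k * \<bar>\<Sum>i<n. max 0 (x i - a i) - max 0 (y i - a i)\<bar>"
    by (simp add: abs_mult sum_subtractf flip: right_diff_distrib)
  also have "\<dots> \<le> real k * (\<Sum>i<n. \<bar>max 0 (x i - a i) - max 0 (y i - a i)\<bar>)"
    by (intro mult_left_mono sum_abs) auto
  also have "\<dots> \<le> real k * (\<Sum>i<n. \<bar>x i - y i\<bar>)"
    by (intro mult_left_mono sum_mono) auto
  finally show ?thesis .
qed

lemma orthant_cutoff_tendsto: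
  assumes "x \<in> space (coord_space n)"
  shows "(\<lambda>k. orthant_cutoff n a k x) \<longlonglongrightarrow> indicator (orthant n a) x"
proof (cases "x \<in> orthant n a")
  case True
  then have "orthant_cutoff n a k x = 1" for k
    unfolding orthant_cutoff_def by (subst sum.neutral) (auto simp: orthant_def)
  with True show ?thesis by simp
next
  case False
  define s where "s = (\<Sum>i<n. max 0 (x i - a i))"
  from False assms obtain i where i: "i < n" "a i < x i" by (auto simp: orthant_def not_le)
  have "max 0 (x i - a i) \<le> s"
    unfolding s_def using i by (intro member_le_sum) auto
  then have "0 < s" using i by simp
  then obtain m :: nat where m: "1 < real m * s" using reals_Archimedean3 by blast
  have "orthant_cutoff n a k x = 0" if "m \<le> k" for k
  proof -
    have "real m * s \<le> real k * s" using that \<open>0 < s\<close> by (intro mult_right_mono) auto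
    with m show ?thesis by (simp add: orthant_cutoff_def s_def)
  qed
  then have "eventually (\<lambda>k. orthant_cutoff n a k x = 0) sequentially"
    by (auto simp: eventually_sequentially)
  with False show ?thesis by (simp add: tendsto_eventually)
qed

lemma L1_lipschitz_orthant_cutoff:
  assumes [measurable]: "B \<in> sets borel" and fin: "emeasure lborel B < \<infinity>"
  shows "L1_lipschitz n (\<lambda>p. orthant_cutoff n a k (fst p) * indicator B (snd p))"
proof -
  have "(\<integral>\<^sup>+q. ennreal \<bar>orthant_cutoff n a k x * indicator B q - orthant_cutoff n a k y * indicator B q\<bar> \<partial>lborel)
      \<le> ennreal ((real k * measure lborel B) * (\<Sum>i<n. \<bar>x i - y i\<bar>))" for x y
  proof -
    have "(\<integral>\<^sup>+q. ennreal \<bar>orthant_cutoff n a k x * indicator B q - orthant_cutoff n a k y * indicator B q\<bar> \<partial>lborel)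
      \<le> (\<integral>\<^sup>+q. ennreal (real k * (\<Sum>i<n. \<bar>x i - y i\<bar>)) * indicator B q \<partial>lborel)"
      using orthant_cutoff_lipschitz[of n a k x y]
      by (intro nn_integral_mono) (auto simp: indicator_def intro!: ennreal_leI)
    also have "\<dots> = ennreal (real k * (\<Sum>i<n. \<bar>x i - y i\<bar>)) * emeasure lborel B"
      by (rule nn_integral_cmult_indicator) simp
    also have "\<dots> = ennreal ((real k * measure lborel B) * (\<Sum>i<n. \<bar>x i - y i\<bar>))"
      using fin by (simp add: emeasure_eq_ennreal_measure ennreal_mult[symmetric] sum_nonneg mult_ac)
    finally show ?thesis .
  qed
  moreover have "\<bar>orthant_cutoff n a k (fst p) * indicator B (snd p)\<bar> \<le> 1" for p
    using orthant_cutoff_bounds[of n a k "fst p"] by (auto simp: indicator_def)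
  ultimately show ?thesis
    unfolding L1_lipschitz_def
    by (intro conjI exI[of _ 1] exI[of _ "real k * measure lborel B"] allI ballI) auto
qed

text \<open>
  The functions that can be approximated form a linear space that is closed under dominated
  limits. It contains the indicators of products of orthants with bounded Borel sets, hence by
  Dynkin's argument those of all measurable sets of finite measure, and hence all integrable functions.
\<close>

lemma L1_lipschitz_dense:
  fixes h :: "(nat \<Rightarrow> real) \<times> real \<Rightarrow> real"
  assumes "prob_space \<mu>" and [measurable_cong]: "sets \<mu> = sets (coord_space n)"
    and h: "integrable (\<mu> \<Otimes>\<^sub>M lborel) h" and "0 < e"
  shows "\<exists>g. L1_lipschitz n g \<and> (\<integral>\<^sup>+p. ennreal \<bar>h p - g p\<bar> \<partial>(\<mu> \<Otimes>\<^sub>M lborel)) < ennreal e"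
proof -
  interpret \<mu>: prob_space \<mu> by fact
  interpret \<mu>l: pair_sigma_finite \<mu> lborel ..
  let ?N = "\<mu> \<Otimes>\<^sub>M lborel :: ((nat \<Rightarrow> real) \<times> real) measure"
  let ?slab = "\<lambda>m. {p :: (nat \<Rightarrow> real) \<times> real. snd p \<in> {- real m..real m}}"
  have sp: "space \<mu> = space (coord_space n)" by (rule sets_eq_imp_space_eq) fact
  \<comment> \<open>\<open>Ap f\<close>: the function \<open>f\<close> is a limit in \<open>L^1\<close> of the functions in question.\<close>
  define Ap where "Ap f \<longleftrightarrow> f \<in> borel_measurable ?N \<and>
    (\<forall>e>0. \<exists>g. L1_lipschitz n g \<and> (\<integral>\<^sup>+p. ennreal \<bar>f p - g p\<bar> \<partial>?N) < ennreal e)" for f :: "(nat \<Rightarrow> real) \<times> real \<Rightarrow> real"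
  have Ap_meas[measurable_dest]: "Ap f \<Longrightarrow> f \<in> borel_measurable ?N" for f by (simp add: Ap_def)
  have L_meas: "L1_lipschitz n g \<Longrightarrow> g \<in> borel_measurable ?N" for g
    using L1_lipschitz_measurable by (simp cong: measurable_cong_sets)
  have tri: "(\<integral>\<^sup>+p. ennreal \<bar>f p - h p\<bar> \<partial>?N) \<le>
      (\<integral>\<^sup>+p. ennreal \<bar>f p - g p\<bar> \<partial>?N) + (\<integral>\<^sup>+p. ennreal \<bar>g p - h p\<bar> \<partial>?N)"
    if [measurable]: "f \<in> borel_measurable ?N" "g \<in> borel_measurable ?N" "h \<in> borel_measurable ?N" for f g h
    by (subst nn_integral_add[symmetric]) (auto intro!: nn_integral_mono simp flip: ennreal_plus)
  have half: "a + b < ennreal e" if "0 < e" "a < ennreal (e/2)" "b < ennreal (e/2)" for a b e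
  proof -
    have "a + b < ennreal (e/2) + ennreal (e/2)" by (rule add_strict_mono) fact+
    then show ?thesis using that by (simp flip: ennreal_plus)
  qed
  have Ap_L: "Ap g" if "L1_lipschitz n g" for g
    using that L_meas[OF that] unfolding Ap_def by (auto intro!: exI[of _ g])
  have Ap_cong: "Ap g" if f: "Ap f" and eq: "\<And>p. p \<in> space ?N \<Longrightarrow> f p = g p" for f g
  proof -
    have "(\<integral>\<^sup>+p. ennreal \<bar>f p - h p\<bar> \<partial>?N) = (\<integral>\<^sup>+p. ennreal \<bar>g p - h p\<bar> \<partial>?N)" for h
      by (intro nn_integral_cong) (simp add: eq)
    moreover have "g \<in> borel_measurable ?N"
      using measurable_cong[of ?N f g borel, OF eq] Ap_meas[OF f] by simp
    ultimately show ?thesis using f unfolding Ap_def by simp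
  qed
  have Ap_lim: "Ap f" if s: "\<And>i::nat. Ap (s i)" and f[measurable]: "f \<in> borel_measurable ?N"
    and lim: "(\<lambda>i. \<integral>\<^sup>+p. ennreal (norm (f p - s i p)) \<partial>?N) \<longlonglongrightarrow> 0" for f s
    unfolding Ap_def
  proof (intro conjI f allI impI)
    fix e :: real assume "0 < e"
    then have "eventually (\<lambda>i. (\<integral>\<^sup>+p. ennreal (norm (f p - s i p)) \<partial>?N) < ennreal (e/2)) sequentially"
      by (intro order_tendstoD[OF lim]) auto
    then obtain i where i: "(\<integral>\<^sup>+p. ennreal \<bar>f p - s i p\<bar> \<partial>?N) < ennreal (e/2)"
      by (auto simp: eventually_sequentially)
    have "0 < e/2" using \<open>0 < e\<close> by simp
    with s[of i] obtain g where g: "L1_lipschitz n g" "(\<integral>\<^sup>+p. ennreal \<bar>s i p - g p\<bar> \<partial>?N) < ennreal (e/2)"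
      unfolding Ap_def by blast
    have "(\<integral>\<^sup>+p. ennreal \<bar>f p - g p\<bar> \<partial>?N) < ennreal e"
      using s[of i] L_meas[OF g(1)] by (intro le_less_trans[OF tri[of f "s i" g] half[OF \<open>0 < e\<close> i g(2)]]) (auto dest: Ap_meas)
    with g(1) show "\<exists>g. L1_lipschitz n g \<and> (\<integral>\<^sup>+p. ennreal \<bar>f p - g p\<bar> \<partial>?N) < ennreal e" by blast
  qed
  have Ap_dom: "Ap f" if s: "\<And>i::nat. Ap (s i)" and f[measurable]: "f \<in> borel_measurable ?N"
    and w: "w \<in> borel_measurable ?N" "(\<integral>\<^sup>+p. ennreal (w p) \<partial>?N) < \<infinity>" "\<And>i p. p \<in> space ?N \<Longrightarrow> \<bar>s i p\<bar> \<le> w p"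
    and lim: "\<And>p. p \<in> space ?N \<Longrightarrow> (\<lambda>i. s i p) \<longlonglongrightarrow> f p" for f s w
  proof (rule Ap_lim[OF s f])
    show "(\<lambda>i. \<integral>\<^sup>+p. ennreal (norm (f p - s i p)) \<partial>?N) \<longlonglongrightarrow> 0"
      using s w lim by (intro nn_integral_dominated_convergence_norm[where w=w]) (auto dest: Ap_meas)
  qed
  have Ap_add: "Ap (\<lambda>p. f p + g p)" if f: "Ap f" and g: "Ap g" for f g
    unfolding Ap_def
  proof (intro conjI allI impI)
    note [measurable] = Ap_meas[OF f] Ap_meas[OF g]
    show "(\<lambda>p. f p + g p) \<in> borel_measurable ?N" by measurable
    fix e :: real assume "0 < e"
    then have "0 < e/2" by simp
    with f obtain f' where f': "L1_lipschitz n f'" "(\<integral>\<^sup>+p. ennreal \<bar>f p - f' p\<bar> \<partial>?N) < ennreal (e/2)"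
      unfolding Ap_def by blast
    with g \<open>0 < e/2\<close> obtain g' where g': "L1_lipschitz n g'" "(\<integral>\<^sup>+p. ennreal \<bar>g p - g' p\<bar> \<partial>?N) < ennreal (e/2)"
      unfolding Ap_def by blast
    note [measurable] = L_meas[OF f'(1)] L_meas[OF g'(1)]
    have "(\<integral>\<^sup>+p. ennreal \<bar>(f p + g p) - (f' p + g' p)\<bar> \<partial>?N)
        \<le> (\<integral>\<^sup>+p. ennreal \<bar>f p - f' p\<bar> + ennreal \<bar>g p - g' p\<bar> \<partial>?N)"
      by (intro nn_integral_mono) (simp flip: ennreal_plus)
    also have "\<dots> = (\<integral>\<^sup>+p. ennreal \<bar>f p - f' p\<bar> \<partial>?N) + (\<integral>\<^sup>+p. ennreal \<bar>g p - g' p\<bar> \<partial>?N)"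
      by (intro nn_integral_add) measurable
    also have "\<dots> < ennreal e"
      by (intro half f' g' \<open>0 < e\<close>)
    finally show "\<exists>g'. L1_lipschitz n g' \<and> (\<integral>\<^sup>+p. ennreal \<bar>(f p + g p) - g' p\<bar> \<partial>?N) < ennreal e"
      using L1_lipschitz_add[OF f'(1) g'(1)] by blast
  qed
  have Ap_scale: "Ap (\<lambda>p. c * f p)" if f: "Ap f" for f c
    unfolding Ap_def
  proof (intro conjI allI impI)
    note [measurable] = Ap_meas[OF f]
    show "(\<lambda>p. c * f p) \<in> borel_measurable ?N" by measurable
    fix e :: real assume "0 < e"
    then have "0 < e / (\<bar>c\<bar> + 1)" by simp
    with f obtain f' where f': "L1_lipschitz n f'" "(\<integral>\<^sup>+p. ennreal \<bar>f p - f' p\<bar> \<partial>?N) < ennreal (e / (\<bar>c\<bar> + 1))"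
      unfolding Ap_def by blast
    note [measurable] = L_meas[OF f'(1)]
    have "ennreal \<bar>c * f p - c * f' p\<bar> \<le> ennreal (\<bar>c\<bar> + 1) * ennreal \<bar>f p - f' p\<bar>" for p
    proof -
      have "\<bar>c * f p - c * f' p\<bar> \<le> (\<bar>c\<bar> + 1) * \<bar>f p - f' p\<bar>"
        by (simp add: abs_mult mult_right_mono flip: right_diff_distrib)
      then show ?thesis
        by (subst ennreal_mult[symmetric]) (auto intro: ennreal_leI)
    qed
    then have "(\<integral>\<^sup>+p. ennreal \<bar>c * f p - c * f' p\<bar> \<partial>?N) \<le> (\<integral>\<^sup>+p. ennreal (\<bar>c\<bar> + 1) * ennreal \<bar>f p - f' p\<bar> \<partial>?N)"
      by (intro nn_integral_mono)
    also have "\<dots> = ennreal (\<bar>c\<bar> + 1) * (\<integral>\<^sup>+p. ennreal \<bar>f p - f' p\<bar> \<partial>?N)"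
      by (intro nn_integral_cmult) measurable
    also have "\<dots> < ennreal (\<bar>c\<bar> + 1) * ennreal (e / (\<bar>c\<bar> + 1))"
      using f'(2) by (intro ennreal_mult_strict_left_mono) (simp_all del: ennreal_plus)
    also have "\<dots> = ennreal e"
      using \<open>0 < e\<close> by (subst ennreal_mult[symmetric]) auto
    finally show "\<exists>g. L1_lipschitz n g \<and> (\<integral>\<^sup>+p. ennreal \<bar>c * f p - g p\<bar> \<partial>?N) < ennreal e"
      using L1_lipschitz_scale[OF f'(1)] by blast
  qed
  have slab_fin: "(\<integral>\<^sup>+p. ennreal (indicator (?slab m) p) \<partial>?N) < \<infinity>" for m
  proof -
    have "(\<integral>\<^sup>+p. ennreal (indicator (?slab m) p) \<partial>?N)
        = (\<integral>\<^sup>+p. indicator (space \<mu> \<times> {- real m..real m}) p \<partial>?N)"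
      by (intro nn_integral_cong) (auto simp: indicator_def space_pair_measure)
    also have "\<dots> = emeasure ?N (space \<mu> \<times> {- real m..real m})"
      by (rule nn_integral_indicator) measurable
    also have "\<dots> = emeasure \<mu> (space \<mu>) * emeasure lborel {- real m..real m}"
      by (rule lborel.emeasure_pair_measure_Times) auto
    finally show ?thesis by (simp add: \<mu>.emeasure_space_1)
  qed
  \<comment> \<open>The product measure is infinite; complements are taken within slabs of finite measure.\<close>
  have Ap_slab: "Ap (\<lambda>p. indicator A p * indicator (?slab m) p)" if A: "A \<in> sets ?N" for A m
  proof -
    let ?S = "?slab m"
    let ?E = "{orthant n a \<times> B |a B. B \<in> sets (borel :: real measure)}"
    let ?\<Omega> = "space (coord_space n) \<times> (UNIV :: real set)"
    have sets_N: "sets ?N = sigma_sets ?\<Omega> ?E"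
      using sets_pair_measure_cong[OF assms(2) sets_lborel]
      unfolding sets_coord_space_pair[symmetric] .
    have S_snd: "(indicator ?S :: _ \<Rightarrow> real) = (\<lambda>p. indicator {- real m..real m} (snd p))"
      by (auto simp: indicator_def fun_eq_iff)
    have [measurable]: "(indicator ?S :: _ \<Rightarrow> real) \<in> borel_measurable ?N"
      unfolding S_snd by measurable
    have Ap_S: "Ap (indicator ?S)"
    proof -
      have "L1_lipschitz n (\<lambda>p. indicator {- real m..real m} (snd p))"
        by (rule L1_lipschitz_snd[of _ 1]) auto
      then show ?thesis unfolding S_snd by (rule Ap_L)
    qed
    have "Int_stable ?E"
    proof (rule Int_stableI)
      fix X Y assume "X \<in> ?E" "Y \<in> ?E"
      then obtain a b A B where XY: "X = orthant n a \<times> A" "Y = orthant n b \<times> B" "A \<in> sets borel" "B \<in> sets borel" by auto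
      then have "X \<inter> Y = orthant n (\<lambda>i. min (a i) (b i)) \<times> (A \<inter> B)"
        by (auto simp: orthant_def)
      with XY show "X \<inter> Y \<in> ?E" by blast
    qed
    moreover have "?E \<subseteq> Pow ?\<Omega>" by (auto simp: orthant_def)
    moreover have "A \<in> sigma_sets ?\<Omega> ?E" using A unfolding sets_N .
    ultimately show ?thesis
    proof (induction rule: sigma_sets_induct_disjoint)
      case (basic A)
      then obtain a B where A: "A = orthant n a \<times> B" and [measurable]: "B \<in> sets borel" by auto
      have [measurable]: "A \<in> sets ?N" unfolding sets_N using basic by auto
      have "emeasure lborel (B \<inter> {- real m..real m}) \<le> emeasure lborel {- real m..real m}"
        by (intro emeasure_mono) auto
      then have "emeasure lborel (B \<inter> {- real m..real m}) < \<infinity>"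
        by (rule le_less_trans) simp
      then have L: "L1_lipschitz n (\<lambda>p. orthant_cutoff n a k (fst p) * indicator (B \<inter> {- real m..real m}) (snd p))" for k
        by (intro L1_lipschitz_orthant_cutoff) auto
      show ?case
      proof (rule Ap_dom[OF Ap_L[OF L] _ _ slab_fin])
        show "\<bar>orthant_cutoff n a k (fst p) * indicator (B \<inter> {- real m..real m}) (snd p)\<bar> \<le> indicator ?S p" for k p
          using orthant_cutoff_bounds[of n a k "fst p"] by (auto simp: indicator_def)
        fix p assume "p \<in> space ?N"
        then have "(\<lambda>k. orthant_cutoff n a k (fst p)) \<longlonglongrightarrow> indicator (orthant n a) (fst p)"
          by (intro orthant_cutoff_tendsto) (auto simp: space_pair_measure sp)
        from tendsto_mult[OF this tendsto_const]
        have "(\<lambda>k. orthant_cutoff n a k (fst p) * indicator (B \<inter> {- real m..real m}) (snd p)) \<longlonglongrightarrow>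
            indicator (orthant n a) (fst p) * indicator (B \<inter> {- real m..real m}) (snd p)" .
        also have "indicator (orthant n a) (fst p) * indicator (B \<inter> {- real m..real m}) (snd p) = (indicator A p * indicator ?S p :: real)"
          by (cases p) (auto simp: A indicator_def)
        finally show "(\<lambda>k. orthant_cutoff n a k (fst p) * indicator (B \<inter> {- real m..real m}) (snd p)) \<longlonglongrightarrow>
          indicator A p * indicator ?S p" .
      qed measurable
    next
      case empty
      show ?case using Ap_scale[OF Ap_S, of 0] by simp
    next
      case (compl A)
      have "Ap (\<lambda>p. indicator ?S p + (-1) * (indicator A p * indicator ?S p))"
        by (intro Ap_add Ap_S Ap_scale compl)
      then show ?case
        by (rule Ap_cong) (auto simp: indicator_def space_pair_measure sp)
    next
      case (union A)
      have [measurable]: "A i \<in> sets ?N" for i unfolding sets_N using union(2) by blast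
      have [measurable]: "(\<Union>i. A i) \<in> sets ?N" by measurable
      have sum: "(\<Sum>i<k. indicator (A i) p) = (indicator (\<Union>i<k. A i) p :: real)" for k p
        using union(1) by (subst indicator_UN_disjoint) (auto simp: disjoint_family_on_def)
      have Ap_sum: "Ap (\<lambda>p. \<Sum>i<k. indicator (A i) p * indicator ?S p)" for k
        by (induction k) (use Ap_scale[OF Ap_S, of 0] in simp, use Ap_add[OF _ union(3)] in simp)
      show ?case
      proof (rule Ap_dom[OF Ap_sum _ _ slab_fin])
        show "\<bar>\<Sum>i<k. indicator (A i) p * indicator ?S p\<bar> \<le> (indicator ?S p :: real)" for k p
          by (simp only: sum sum_distrib_right[symmetric]) (auto simp: indicator_def)
        show "(\<lambda>k. \<Sum>i<k. indicator (A i) p * indicator ?S p) \<longlonglongrightarrow> (indicator (\<Union>i. A i) p * indicator ?S p :: real)" for p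
          unfolding sum_distrib_right[symmetric] sum
          by (intro tendsto_mult tendsto_const LIMSEQ_indicator_UN)
      qed measurable
    qed
  qed
  have "Ap h"
    using h
  proof (induction rule: integrable_induct)
    case (base A c)
    have "Ap (indicator A)"
    proof (rule Ap_dom[OF Ap_slab[OF base(1)]])
      show "\<bar>indicator A p * indicator (?slab m) p\<bar> \<le> (indicator A p :: real)" for m p
        by (auto simp: indicator_def)
      show "(\<integral>\<^sup>+p. ennreal (indicator A p) \<partial>?N) < \<infinity>"
        using base by (simp add: ennreal_indicator)
      fix p :: "(nat \<Rightarrow> real) \<times> real"
      obtain k :: nat where k: "\<bar>snd p\<bar> \<le> real k" using real_arch_simple by blast
      have "indicator A p * indicator (?slab m) p = (indicator A p :: real)" if "k \<le> m" for m
        using k that by (auto simp: indicator_def)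
      then have "eventually (\<lambda>m. indicator A p * indicator (?slab m) p = (indicator A p :: real)) sequentially"
        by (auto simp: eventually_sequentially)
      then show "(\<lambda>m. indicator A p * indicator (?slab m) p :: real) \<longlonglongrightarrow> indicator A p"
        by (rule tendsto_eventually)
    qed (use base in auto)
    from Ap_scale[OF this, of c] show ?case by (simp add: mult.commute)
  next
    case (add f g)
    then show ?case by (intro Ap_add)
  next
    case (lim f s)
    show ?case
    proof (rule Ap_dom[OF lim.IH])
      show "f \<in> borel_measurable ?N" "(\<lambda>p. 2 * \<bar>f p\<bar>) \<in> borel_measurable ?N" using \<open>integrable ?N f\<close> by auto
      have "integrable ?N (\<lambda>p. 2 * \<bar>f p\<bar>)" using \<open>integrable ?N f\<close> by auto
      then show "(\<integral>\<^sup>+p. ennreal (2 * \<bar>f p\<bar>) \<partial>?N) < \<infinity>"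
        unfolding integrable_iff_bounded by (simp add: abs_mult)
    qed (use lim in auto)
  qed
  then show ?thesis using \<open>0 < e\<close> unfolding Ap_def by blast
qed

section \<open>Successive conditional quantiles of a law of sequences\<close>

text \<open>The law of the first \<open>n\<close> coordinates.\<close>

definition marginal :: "nat \<Rightarrow> (nat \<Rightarrow> real) measure \<Rightarrow> (nat \<Rightarrow> real) measure" where
  "marginal n \<mu> = distr \<mu> (coord_space n) (\<lambda>x. restrict x {..<n})"

lemma sets_marginal [simp, measurable_cong]: "sets (marginal n \<mu>) = sets (coord_space n)"
  by (simp add: marginal_def)

lemma space_marginal [simp]: "space (marginal n \<mu>) = space (coord_space n)"
  by (simp add: marginal_def)

lemma measurable_restrict_coord [measurable]:
  "n \<le> N \<Longrightarrow> (\<lambda>x. restrict x {..<n}) \<in> coord_space N \<rightarrow>\<^sub>M coord_space n"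
  by (rule measurable_restrict_subset) auto

lemma measurable_restrict_coord':
  assumes "sets \<mu> = sets (coord_space N)" "n \<le> N"
  shows "(\<lambda>x. restrict x {..<n}) \<in> \<mu> \<rightarrow>\<^sub>M coord_space n"
  using assms by (simp add: measurable_cong_sets[OF assms(1) refl] measurable_restrict_coord)

lemma prob_space_marginal:
  assumes "prob_space \<mu>" and "sets \<mu> = sets (coord_space N)" and "n \<le> N"
  shows "prob_space (marginal n \<mu>)"
  unfolding marginal_def
  by (rule prob_space.prob_space_distr[OF assms(1) measurable_restrict_coord'[OF assms(2,3)]])

lemma marginal_self:
  assumes "sets \<mu> = sets (coord_space N)"
  shows "marginal N \<mu> = \<mu>"
proof -
  have "marginal N \<mu> = distr \<mu> \<mu> (\<lambda>x. x)"
    unfolding marginal_def using sets_eq_imp_space_eq[OF assms] assms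
    by (intro distr_cong) (auto simp: space_PiM)
  then show ?thesis by simp
qed

text \<open>
  \<open>Q (x, \<cdot>)\<close> is, as a function on the open unit interval, a quantile function of the conditional
  law under \<open>\<mu>\<close> of coordinate \<open>n\<close> given that coordinates \<open>0, \<dots>, n - 1\<close> are \<open>x\<close>.
\<close>

definition is_quantile :: "nat \<Rightarrow> (nat \<Rightarrow> real) measure \<Rightarrow> ((nat \<Rightarrow> real) \<times> real \<Rightarrow> real) \<Rightarrow> bool" where
  "is_quantile n \<mu> Q \<longleftrightarrow>
    Q \<in> borel_measurable (coord_space n \<Otimes>\<^sub>M borel) \<and>
    (\<forall>x. mono_on {0<..<1} (\<lambda>u. Q (x, u))) \<and>
    marginal (Suc n) \<mu> = distr (marginal n \<mu> \<Otimes>\<^sub>M unif) (coord_space (Suc n)) (\<lambda>(x, u). x(n := Q (x, u)))"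

lemma is_quantile_measurable: "is_quantile n \<mu> Q \<Longrightarrow> Q \<in> borel_measurable (coord_space n \<Otimes>\<^sub>M borel)"
  by (simp add: is_quantile_def)

lemma measurable_upd_coord [measurable]:
  "(\<lambda>(x, v). x(n := v)) \<in> coord_space n \<Otimes>\<^sub>M borel \<rightarrow>\<^sub>M coord_space (Suc n)"
  using measurable_add_dim[of n "{..<n}" "\<lambda>_. borel :: real measure"] by (simp add: lessThan_Suc)

lemma measurable_upd_coord' [measurable (raw)]:
  assumes [measurable]: "f \<in> M \<rightarrow>\<^sub>M coord_space n" "g \<in> borel_measurable M"
  shows "(\<lambda>w. (f w)(n := g w)) \<in> M \<rightarrow>\<^sub>M coord_space (Suc n)"
proof -
  have "(\<lambda>w. (\<lambda>(x, v). x(n := v)) (f w, g w)) \<in> M \<rightarrow>\<^sub>M coord_space (Suc n)"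
    by measurable
  then show ?thesis by simp
qed

lemma exists_is_quantile:
  assumes \<mu>: "prob_space \<mu>" and [measurable_cong]: "sets \<mu> = sets (coord_space N)" and "n < N"
  shows "\<exists>Q. is_quantile n \<mu> Q"
proof -
  interpret prob_space \<mu> by fact
  have [measurable]: "(\<lambda>x. restrict x {..<n}) \<in> \<mu> \<rightarrow>\<^sub>M coord_space n"
    using \<open>n < N\<close> by (intro measurable_restrict_coord'[OF assms(2)]) simp
  have [measurable]: "(\<lambda>x. x n) \<in> borel_measurable \<mu>"
    using \<open>n < N\<close> by (simp add: measurable_cong_sets[OF assms(2) refl])
  have sp: "space \<mu> = space (coord_space N)" by (rule sets_eq_imp_space_eq) fact
  define P where "P = distr \<mu> (coord_space n \<Otimes>\<^sub>M borel) (\<lambda>x. (restrict x {..<n}, x n))"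
  have "prob_space P" "sets P = sets (coord_space n \<Otimes>\<^sub>M borel)"
    unfolding P_def by (auto intro!: prob_space_distr)
  from exists_conditional_quantile[OF this] obtain Q where
    [measurable]: "Q \<in> borel_measurable (coord_space n \<Otimes>\<^sub>M borel)" and mono: "\<forall>x. mono_on {0<..<1} (\<lambda>u. Q (x, u))"
    and PQ: "P = distr (distr P (coord_space n) fst \<Otimes>\<^sub>M unif) (coord_space n \<Otimes>\<^sub>M borel) (\<lambda>(x, u). (x, Q (x, u)))"
    by blast
  have D: "distr P (coord_space n) fst = marginal n \<mu>"
    unfolding P_def marginal_def by (subst distr_distr) (auto simp: comp_def)
  have "marginal (Suc n) \<mu> = distr P (coord_space (Suc n)) (\<lambda>(x, v). x(n := v))"
    unfolding P_def marginal_def using \<open>n < N\<close>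
    by (subst distr_distr) (auto simp: comp_def fun_eq_iff intro!: distr_cong)
  also have "\<dots> = distr (marginal n \<mu> \<Otimes>\<^sub>M unif) (coord_space (Suc n)) (\<lambda>(x, u). x(n := Q (x, u)))"
    unfolding PQ[unfolded D] by (subst distr_distr) (auto simp: comp_def split_beta')
  finally have "is_quantile n \<mu> Q"
    unfolding is_quantile_def using mono by simp
  then show ?thesis by blast
qed

text \<open>
  The left-continuous conditional distribution function that belongs to \<open>Q\<close>: \<open>qcdf Q (x, q)\<close> is the
  conditional probability of the open half-line below \<open>q\<close>.
\<close>

definition qcdf :: "('a \<times> real \<Rightarrow> real) \<Rightarrow> 'a \<times> real \<Rightarrow> real" where
  "qcdf Q = (\<lambda>(x, q). measure unif {u. Q (x, u) < q})"

lemma qcdf_measurable [measurable (raw)]: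
  assumes [measurable]: "Q \<in> borel_measurable (M \<Otimes>\<^sub>M borel)"
  shows "qcdf Q \<in> borel_measurable (M \<Otimes>\<^sub>M borel)"
proof -
  let ?S = "{x \<in> space ((M \<Otimes>\<^sub>M borel) \<Otimes>\<^sub>M unif). Q (fst (fst x), snd x) < snd (fst x)}"
  have "(\<lambda>p. enn2real (\<integral>\<^sup>+u. indicator ?S (p, u) \<partial>unif))
      \<in> borel_measurable (M \<Otimes>\<^sub>M borel)"
    by measurable
  also have "(\<lambda>p. enn2real (\<integral>\<^sup>+u. indicator ?S (p, u) \<partial>unif))
      \<in> borel_measurable (M \<Otimes>\<^sub>M borel) \<longleftrightarrow> qcdf Q \<in> borel_measurable (M \<Otimes>\<^sub>M borel)"
  proof (rule measurable_cong)
    fix p assume p: "p \<in> space (M \<Otimes>\<^sub>M (borel :: real measure))"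
    then have [measurable]: "fst p \<in> space M" by (auto simp: space_pair_measure)
    have "(\<integral>\<^sup>+u. indicator ?S (p, u) \<partial>unif)
       = (\<integral>\<^sup>+u. indicator {u. Q (fst p, u) < snd p} u \<partial>unif)"
      using p by (intro nn_integral_cong) (auto simp: indicator_def space_pair_measure)
    also have "\<dots> = emeasure unif {u. Q (fst p, u) < snd p}"
      by (rule nn_integral_indicator) measurable
    finally show "enn2real (\<integral>\<^sup>+u. indicator ?S (p, u) \<partial>unif) = qcdf Q p"
      by (simp add: qcdf_def split_beta' measure_def)
  qed
  finally show ?thesis .
qed

lemma qcdf_bounds: "0 \<le> qcdf Q p" "qcdf Q p \<le> 1"
  by (auto simp: qcdf_def split_beta')

lemma nn_integral_quantile_diff:
  assumes "is_quantile n \<mu> Q" "is_quantile n \<nu> R" and [measurable]: "x \<in> space (coord_space n)" "y \<in> space (coord_space n)"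
  shows "(\<integral>\<^sup>+u. ennreal \<bar>Q (x, u) - R (y, u)\<bar> \<partial>unif) = (\<integral>\<^sup>+q. ennreal \<bar>qcdf Q (x, q) - qcdf R (y, q)\<bar> \<partial>lborel)"
proof -
  note [measurable] = assms(1,2)[THEN is_quantile_measurable]
  show ?thesis
    unfolding qcdf_def prod.case using assms(1,2)
    by (intro nn_integral_unif_abs_diff) (measurable, auto simp: is_quantile_def)
qed

section \<open>Generating sequences from independent uniform variables\<close>

text \<open>The driving sequence of independent uniform variables.\<close>

definition noise :: "(nat \<Rightarrow> real) measure" where
  "noise = PiM UNIV (\<lambda>_. unif)"

lemma sets_noise [simp, measurable_cong]: "sets noise = sets (PiM UNIV (\<lambda>_. borel))"
  unfolding noise_def by (intro sets_PiM_cong) auto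

lemma prob_space_noise: "prob_space noise"
  unfolding noise_def by (rule prob_space_PiM) (rule prob_space_unif)

interpretation noise: prob_space noise by (rule prob_space_noise)

lemma distr_noise_component: "distr noise borel (\<lambda>u. u i) = unif"
proof -
  have "distr noise borel (\<lambda>u. u i) = distr noise unif (\<lambda>u. u i)"
    by (intro distr_cong) auto
  also have "\<dots> = unif"
    unfolding noise_def by (rule distr_PiM_component) (auto intro: prob_space_unif)
  finally show ?thesis .
qed

lemma indep_vars_noise: "noise.indep_vars (\<lambda>_. borel) (\<lambda>i u. u i) UNIV"
proof -
  have "distr noise (PiM UNIV (\<lambda>_. borel)) (\<lambda>x. \<lambda>i\<in>UNIV. x i) = noise"
    using sets_noise by (subst distr_cong[OF refl _ refl, of _ noise]) (simp_all add: restrict_UNIV)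
  also have "\<dots> = PiM UNIV (\<lambda>i. distr noise borel (\<lambda>u. u i))"
    unfolding distr_noise_component by (simp add: noise_def)
  finally show ?thesis
    by (subst noise.indep_vars_iff_distr_eq_PiM) auto
qed

lemma distr_noise_pair:
  assumes "A \<inter> B = {}" and f: "f \<in> PiM A (\<lambda>_. borel) \<rightarrow>\<^sub>M S" and g: "g \<in> PiM B (\<lambda>_. borel) \<rightarrow>\<^sub>M T"
  shows "distr noise (S \<Otimes>\<^sub>M T) (\<lambda>u. (f (restrict u A), g (restrict u B))) =
    distr noise S (\<lambda>u. f (restrict u A)) \<Otimes>\<^sub>M distr noise T (\<lambda>u. g (restrict u B))"
proof -
  have "noise.indep_var (PiM A (\<lambda>_. borel)) (\<lambda>u. restrict (\<lambda>i. u i) A) (PiM B (\<lambda>_. borel)) (\<lambda>u. restrict (\<lambda>i. u i) B)"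
    by (rule noise.indep_var_restrict[OF indep_vars_noise]) (use assms in auto)
  then have *: "distr noise (PiM A (\<lambda>_. borel) \<Otimes>\<^sub>M PiM B (\<lambda>_. borel)) (\<lambda>u. (restrict u A, restrict u B)) =
      distr noise (PiM A (\<lambda>_. borel)) (\<lambda>u. restrict u A) \<Otimes>\<^sub>M distr noise (PiM B (\<lambda>_. borel)) (\<lambda>u. restrict u B)"
    unfolding noise.indep_var_distribution_eq by simp
  interpret B: prob_space "distr noise (PiM B (\<lambda>_. borel)) (\<lambda>u. restrict u B)"
    by (rule noise.prob_space_distr) measurable
  interpret gB: prob_space "distr (distr noise (PiM B (\<lambda>_. borel)) (\<lambda>u. restrict u B)) T g"
    by (rule B.prob_space_distr) (use g in simp)
  note [measurable] = f g
  have "distr noise S (\<lambda>u. f (restrict u A)) \<Otimes>\<^sub>M distr noise T (\<lambda>u. g (restrict u B)) =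
      distr (distr noise (PiM A (\<lambda>_. borel)) (\<lambda>u. restrict u A)) S f \<Otimes>\<^sub>M
      distr (distr noise (PiM B (\<lambda>_. borel)) (\<lambda>u. restrict u B)) T g"
    by (simp add: distr_distr comp_def)
  also have "\<dots> = distr (distr noise (PiM A (\<lambda>_. borel)) (\<lambda>u. restrict u A) \<Otimes>\<^sub>M
      distr noise (PiM B (\<lambda>_. borel)) (\<lambda>u. restrict u B)) (S \<Otimes>\<^sub>M T) (\<lambda>(x, y). (f x, g y))"
    by (rule pair_measure_distr) (use gB.sigma_finite_measure_axioms in auto)
  also have "\<dots> = distr noise (S \<Otimes>\<^sub>M T) (\<lambda>u. (f (restrict u A), g (restrict u B)))"
    unfolding *[symmetric] by (subst distr_distr) (auto simp: comp_def)
  finally show ?thesis ..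
qed

text \<open>
  If \<open>f\<close> only depends on the uniforms with index in \<open>A\<close> and \<open>i\<close> is not in \<open>A\<close>, then the \<open>i\<close>-th uniform
  can be integrated out first.
\<close>

lemma nn_integral_noise_split:
  assumes f: "f \<in> PiM A (\<lambda>_. borel) \<rightarrow>\<^sub>M S" and f_cong: "\<And>u. f (restrict u A) = f u" and "i \<notin> A"
    and h[measurable]: "h \<in> borel_measurable (S \<Otimes>\<^sub>M borel)"
  shows "(\<integral>\<^sup>+u. h (f u, u i) \<partial>noise) = (\<integral>\<^sup>+u. \<integral>\<^sup>+v. h (f u, v) \<partial>unif \<partial>noise)"
proof -
  have fm[measurable]: "f \<in> noise \<rightarrow>\<^sub>M S"
  proof -
    have "(\<lambda>u. f (restrict u A)) \<in> noise \<rightarrow>\<^sub>M S"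
      by (rule measurable_compose[OF _ f]) measurable
    then show ?thesis by (simp add: f_cong)
  qed
  have "(\<integral>\<^sup>+u. h (f u, u i) \<partial>noise) = integral\<^sup>N (distr noise (S \<Otimes>\<^sub>M borel) (\<lambda>u. (f u, u i))) h"
    by (subst nn_integral_distr) auto
  also have "distr noise (S \<Otimes>\<^sub>M borel) (\<lambda>u. (f u, u i)) = distr noise S f \<Otimes>\<^sub>M distr noise borel (\<lambda>u. u i)"
    using distr_noise_pair[of A "{i}" f S "\<lambda>w. w i" borel] f \<open>i \<notin> A\<close> by (simp add: f_cong)
  also have "integral\<^sup>N \<dots> h = (\<integral>\<^sup>+x. \<integral>\<^sup>+v. h (x, v) \<partial>unif \<partial>distr noise S f)"
    unfolding distr_noise_component by (subst unif.nn_integral_fst) auto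
  also have "\<dots> = (\<integral>\<^sup>+u. \<integral>\<^sup>+v. h (f u, v) \<partial>unif \<partial>noise)"
    by (subst nn_integral_distr) auto
  finally show ?thesis .
qed

text \<open>
  \<open>extend Q u m x j\<close> appends the coordinates \<open>m, \<dots>, m + j - 1\<close> to a sequence \<open>x\<close> of length \<open>m\<close>, where
  coordinate \<open>k\<close> is computed by \<open>Q k\<close> from all earlier coordinates and \<open>u k\<close>.
\<close>

primrec extend :: "(nat \<Rightarrow> (nat \<Rightarrow> real) \<times> real \<Rightarrow> real) \<Rightarrow> (nat \<Rightarrow> real) \<Rightarrow> nat \<Rightarrow> (nat \<Rightarrow> real) \<Rightarrow> nat \<Rightarrow> nat \<Rightarrow> real"
where
  "extend Q u m x 0 = x"
| "extend Q u m x (Suc j) = (extend Q u m x j)(m + j := Q (m + j) (extend Q u m x j, u (m + j)))"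

lemma extend_add: "extend Q u m x (j + k) = extend Q u (m + j) (extend Q u m x j) k"
  by (induction k) (simp_all add: add.assoc)

lemma extend_cong:
  assumes "\<And>i. m \<le> i \<Longrightarrow> i < m + j \<Longrightarrow> u i = v i"
  shows "extend Q u m x j = extend Q v m x j"
  using assms by (induction j) auto

lemma extend_less: "i < m \<Longrightarrow> extend Q u m x j i = x i"
  by (induction j) auto

lemma extend_measurable:
  assumes Q: "\<And>k. k < m + j \<Longrightarrow> Q k \<in> borel_measurable (coord_space k \<Otimes>\<^sub>M borel)"
    and x[measurable]: "x \<in> M \<rightarrow>\<^sub>M coord_space m"
    and u: "\<And>k. m \<le> k \<Longrightarrow> k < m + j \<Longrightarrow> (\<lambda>w. u w k) \<in> borel_measurable M"
  shows "(\<lambda>w. extend Q (u w) m (x w) j) \<in> M \<rightarrow>\<^sub>M coord_space (m + j)"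
  using Q u
proof (induction j)
  case 0
  show ?case by simp
next
  case (Suc j)
  have [measurable]: "(\<lambda>w. extend Q (u w) m (x w) j) \<in> M \<rightarrow>\<^sub>M coord_space (m + j)"
    by (rule Suc.IH) (auto intro: Suc.prems)
  have [measurable]: "Q (m + j) \<in> borel_measurable (coord_space (m + j) \<Otimes>\<^sub>M borel)"
    "(\<lambda>w. u w (m + j)) \<in> borel_measurable M"
    by (auto intro: Suc.prems)
  show ?case unfolding extend.simps add_Suc_right by measurable
qed

text \<open>
  The first \<open>n\<close> generated coordinates, starting from the empty sequence.
\<close>

definition run :: "(nat \<Rightarrow> (nat \<Rightarrow> real) \<times> real \<Rightarrow> real) \<Rightarrow> nat \<Rightarrow> (nat \<Rightarrow> real) \<Rightarrow> nat \<Rightarrow> real" where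
  "run Q n u = extend Q u 0 (\<lambda>_. undefined) n"

lemma run_0: "run Q 0 u = (\<lambda>_. undefined)"
  by (simp add: run_def)

lemma run_Suc: "run Q (Suc n) u = (run Q n u)(n := Q n (run Q n u, u n))"
  by (simp add: run_def)

lemma run_add: "run Q (m + j) u = extend Q u m (run Q m u) j"
  unfolding run_def using extend_add[of Q u 0 _ m j] by simp

lemma run_restrict: "run Q n (restrict u {..<n}) = run Q n u"
  unfolding run_def by (rule extend_cong) auto

lemma run_le: "i < m \<Longrightarrow> m \<le> n \<Longrightarrow> run Q n u i = run Q m u i"
  using run_add[of Q m "n - m" u] extend_less[of i m Q u "run Q m u" "n - m"] by simp

lemma run_measurable_coord:
  assumes "\<And>k. k < n \<Longrightarrow> Q k \<in> borel_measurable (coord_space k \<Otimes>\<^sub>M borel)"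
  shows "run Q n \<in> coord_space n \<rightarrow>\<^sub>M coord_space n"
  using extend_measurable[of 0 n Q "\<lambda>_ _. undefined" "coord_space n" "\<lambda>u. u"] assms
  by (auto simp: run_def[abs_def] space_PiM)

lemma run_measurable:
  assumes "\<And>k. k < n \<Longrightarrow> Q k \<in> borel_measurable (coord_space k \<Otimes>\<^sub>M borel)"
  shows "run Q n \<in> noise \<rightarrow>\<^sub>M coord_space n"
  using extend_measurable[of 0 n Q "\<lambda>_ _. undefined" noise "\<lambda>u. u"] assms
  by (auto simp: run_def[abs_def] space_PiM)

text \<open>
  Inverse transform sampling: if the \<open>Q k\<close> are conditional quantile functions of \<open>\<mu>\<close>, then the
  generated sequence has law \<open>\<mu>\<close>.
\<close>

lemma distr_run:
  assumes \<mu>: "prob_space \<mu>" and [measurable_cong]: "sets \<mu> = sets (coord_space N)"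
    and "n \<le> N" and Q: "\<And>k. k < n \<Longrightarrow> is_quantile k \<mu> (Q k)"
  shows "distr noise (coord_space n) (run Q n) = marginal n \<mu>"
  using \<open>n \<le> N\<close> Q
proof (induction n)
  case 0
  interpret M: prob_space "marginal 0 \<mu>" by (rule prob_space_marginal[OF assms(1,2)]) simp
  interpret D: prob_space "distr noise (coord_space 0) (run Q 0)"
    by (rule noise.prob_space_distr) (auto simp: run_0[abs_def] space_PiM)
  show ?case
  proof (rule measure_eqI)
    fix A assume "A \<in> sets (distr noise (coord_space 0) (run Q 0))"
    then have "A = {} \<or> A = space (coord_space 0)" by (auto simp: sets_PiM_empty space_PiM_empty)
    then show "emeasure (distr noise (coord_space 0) (run Q 0)) A = emeasure (marginal 0 \<mu>) A"
      using M.emeasure_space_1 D.emeasure_space_1 by auto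
  qed simp
next
  case (Suc n)
  have Qm: "\<And>k. k \<le> n \<Longrightarrow> Q k \<in> borel_measurable (coord_space k \<Otimes>\<^sub>M borel)"
    using Suc.prems(2) by (auto intro: is_quantile_measurable simp: less_Suc_eq_le)
  note [measurable] = Qm[of n, simplified]
  have [measurable]: "run Q n \<in> noise \<rightarrow>\<^sub>M coord_space n" by (rule run_measurable) (simp add: Qm)
  have IH: "distr noise (coord_space n) (run Q n) = marginal n \<mu>"
    by (rule Suc.IH) (use Suc.prems in auto)
  have pair: "distr noise (coord_space n \<Otimes>\<^sub>M borel) (\<lambda>u. (run Q n u, u n)) = marginal n \<mu> \<Otimes>\<^sub>M unif"
    using distr_noise_pair[of "{..<n}" "{n}" "run Q n" "coord_space n" "\<lambda>w. w n" borel] run_measurable_coord[of n Q]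
    by (simp add: run_restrict IH distr_noise_component Qm)
  have "distr noise (coord_space (Suc n)) (run Q (Suc n)) =
      distr (distr noise (coord_space n \<Otimes>\<^sub>M borel) (\<lambda>u. (run Q n u, u n))) (coord_space (Suc n)) (\<lambda>(x, v). x(n := Q n (x, v)))"
    by (subst distr_distr) (auto simp: comp_def run_Suc intro!: distr_cong)
  also have "\<dots> = marginal (Suc n) \<mu>"
    unfolding pair using Suc.prems(2)[of n] by (simp add: is_quantile_def)
  finally show ?case .
qed

section \<open>Contraction of conditional distribution functions under convolution\<close>

text \<open>Convolution of laws of sequences of length \<open>N\<close>.\<close>

definition coord_conv :: "nat \<Rightarrow> (nat \<Rightarrow> real) measure \<Rightarrow> (nat \<Rightarrow> real) measure \<Rightarrow> (nat \<Rightarrow> real) measure" where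
  "coord_conv N \<mu> \<gamma> = distr (\<mu> \<Otimes>\<^sub>M \<gamma>) (coord_space N) (\<lambda>(x, z). \<lambda>i\<in>{..<N}. x i + z i)"

lemma sets_coord_conv [simp, measurable_cong]: "sets (coord_conv N \<mu> \<gamma>) = sets (coord_space N)"
  by (simp add: coord_conv_def)

lemma coord_borel_measurable:
  assumes "sets \<gamma> = sets (coord_space N)" "i < N"
  shows "(\<lambda>z. z i) \<in> borel_measurable \<gamma>"
  using assms by (simp add: measurable_cong_sets[OF assms(1) refl])

lemma prob_space_coord_conv:
  assumes "prob_space \<mu>" "prob_space \<gamma>"
    and [measurable_cong]: "sets \<mu> = sets (coord_space N)" "sets \<gamma> = sets (coord_space N)"
  shows "prob_space (coord_conv N \<mu> \<gamma>)"
proof -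
  interpret \<mu>: prob_space \<mu> by fact
  interpret \<gamma>: prob_space \<gamma> by fact
  interpret pair_prob_space \<mu> \<gamma> ..
  show ?thesis
    unfolding coord_conv_def by (rule prob_space_distr) measurable
qed

text \<open>
  The noise is put first in the product, so that with the noise fixed the coordinate generated last
  can be integrated out before the others.
\<close>

lemma marginal_coord_conv:
  assumes "prob_space \<mu>" "prob_space \<gamma>"
    and \<mu>[measurable_cong]: "sets \<mu> = sets (coord_space N)" and \<gamma>[measurable_cong]: "sets \<gamma> = sets (coord_space N)" and n: "n \<le> N"
  shows "marginal n (coord_conv N \<mu> \<gamma>) =
    distr (\<gamma> \<Otimes>\<^sub>M marginal n \<mu>) (coord_space n) (\<lambda>(z, x). \<lambda>i\<in>{..<n}. x i + z i)"
proof -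
  interpret \<mu>: prob_space \<mu> by fact
  interpret \<gamma>: prob_space \<gamma> by fact
  interpret \<mu>\<gamma>: pair_prob_space \<mu> \<gamma> ..
  interpret m: prob_space "marginal n \<mu>" by (rule prob_space_marginal) fact+
  note [measurable] = measurable_restrict_coord'[OF \<mu> n] measurable_restrict_coord[OF n]
  have c[measurable]: "(\<lambda>z. z i) \<in> borel_measurable \<gamma>" "(\<lambda>z. z i) \<in> borel_measurable \<mu>" if "i < n" for i
    using coord_borel_measurable[OF \<gamma>] coord_borel_measurable[OF \<mu>] that n by auto
  have [measurable]: "(\<lambda>(z, x). \<lambda>i\<in>{..<n}. x i + z i) \<in> \<gamma> \<Otimes>\<^sub>M coord_space n \<rightarrow>\<^sub>M coord_space n"
    "(\<lambda>(z, x). \<lambda>i\<in>{..<n}. x i + z i) \<in> \<gamma> \<Otimes>\<^sub>M \<mu> \<rightarrow>\<^sub>M coord_space n"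
    unfolding split_beta' by (auto intro!: measurable_restrict borel_measurable_add measurable_compose[OF measurable_fst c(1)]
      measurable_compose[OF measurable_snd c(2)] measurable_compose[OF measurable_snd measurable_component_singleton])
  have "marginal n (coord_conv N \<mu> \<gamma>) = distr (\<mu> \<Otimes>\<^sub>M \<gamma>) (coord_space n) (\<lambda>(x, z). \<lambda>i\<in>{..<n}. x i + z i)"
    unfolding marginal_def coord_conv_def using n
    by (subst distr_distr) (auto simp: comp_def fun_eq_iff intro!: distr_cong)
  also have "\<dots> = distr (\<gamma> \<Otimes>\<^sub>M \<mu>) (coord_space n) (\<lambda>(z, x). \<lambda>i\<in>{..<n}. x i + z i)"
  proof -
    have [measurable]: "(\<lambda>(x, z). \<lambda>i\<in>{..<n}. x i + z i) \<in> \<mu> \<Otimes>\<^sub>M \<gamma> \<rightarrow>\<^sub>M coord_space n"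
      unfolding split_beta' by (auto intro!: measurable_restrict borel_measurable_add measurable_compose[OF measurable_snd c(1)]
        measurable_compose[OF measurable_fst c(2)])
    show ?thesis
      by (subst \<mu>\<gamma>.distr_pair_swap, subst distr_distr) (auto simp: comp_def intro!: distr_cong)
  qed
  also have "\<dots> = distr (distr (\<gamma> \<Otimes>\<^sub>M \<mu>) (\<gamma> \<Otimes>\<^sub>M coord_space n) (\<lambda>(z, x). (z, restrict x {..<n}))) (coord_space n) (\<lambda>(z, x). \<lambda>i\<in>{..<n}. x i + z i)"
    by (subst distr_distr) (auto simp: comp_def fun_eq_iff intro!: distr_cong)
  also have "distr (\<gamma> \<Otimes>\<^sub>M \<mu>) (\<gamma> \<Otimes>\<^sub>M coord_space n) (\<lambda>(z, x). (z, restrict x {..<n})) = distr \<gamma> \<gamma> (\<lambda>z. z) \<Otimes>\<^sub>M marginal n \<mu>"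
    unfolding marginal_def
    by (rule pair_measure_distr[symmetric]) (use m.sigma_finite_measure_axioms in \<open>auto simp: marginal_def\<close>)
  finally show ?thesis unfolding distr_id .
qed

lemma measurable_coord_add:
  assumes \<gamma>[measurable_cong]: "sets \<gamma> = sets (coord_space N)" and "n \<le> N"
    and f[measurable]: "f \<in> M \<rightarrow>\<^sub>M \<gamma>" and g[measurable]: "g \<in> M \<rightarrow>\<^sub>M coord_space n"
  shows "(\<lambda>w. \<lambda>i\<in>{..<n}. g w i + f w i) \<in> M \<rightarrow>\<^sub>M coord_space n"
proof (intro measurable_restrict borel_measurable_add)
  fix i assume "i \<in> {..<n}"
  then show "(\<lambda>w. g w i) \<in> borel_measurable M"
    by (intro measurable_compose[OF g measurable_component_singleton])
  show "(\<lambda>w. f w i) \<in> borel_measurable M"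
    using \<open>i \<in> {..<n}\<close> \<open>n \<le> N\<close> by (intro measurable_compose[OF f coord_borel_measurable[OF \<gamma>]]) auto
qed

lemma marginal_Suc_coord_conv:
  assumes "prob_space \<mu>" "prob_space \<gamma>"
    and \<mu>: "sets \<mu> = sets (coord_space N)" and \<gamma>[measurable_cong]: "sets \<gamma> = sets (coord_space N)" and n: "n < N"
    and Q: "is_quantile n \<mu> Q"
  shows "marginal (Suc n) (coord_conv N \<mu> \<gamma>) =
    distr (\<gamma> \<Otimes>\<^sub>M (marginal n \<mu> \<Otimes>\<^sub>M unif)) (coord_space (Suc n))
      (\<lambda>(z, x, u). (\<lambda>i\<in>{..<n}. x i + z i)(n := Q (x, u) + z n))"
proof -
  interpret \<gamma>: prob_space \<gamma> by fact
  interpret m: prob_space "marginal n \<mu>" by (rule prob_space_marginal[OF assms(1) \<mu>]) (use n in simp)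
  interpret mu: pair_prob_space "marginal n \<mu>" unif ..
  note [measurable] = is_quantile_measurable[OF Q] coord_borel_measurable[OF \<gamma> n] 
  have n': "Suc n \<le> N" using n by simp
  have pr: "prob_space (distr (marginal n \<mu> \<Otimes>\<^sub>M unif) (coord_space (Suc n)) (\<lambda>(x, u). x(n := Q (x, u))))"
    by (rule mu.prob_space_distr) measurable
  have [measurable]: "(\<lambda>(z, x). \<lambda>i\<in>{..<Suc n}. x i + z i) \<in> \<gamma> \<Otimes>\<^sub>M coord_space (Suc n) \<rightarrow>\<^sub>M coord_space (Suc n)"
    unfolding split_beta' by (rule measurable_coord_add[OF \<gamma> n']) auto
  have "marginal (Suc n) (coord_conv N \<mu> \<gamma>) =
      distr (\<gamma> \<Otimes>\<^sub>M marginal (Suc n) \<mu>) (coord_space (Suc n)) (\<lambda>(z, x). \<lambda>i\<in>{..<Suc n}. x i + z i)"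
    by (rule marginal_coord_conv) fact+
  also have "marginal (Suc n) \<mu> = distr (marginal n \<mu> \<Otimes>\<^sub>M unif) (coord_space (Suc n)) (\<lambda>(x, u). x(n := Q (x, u)))"
    using Q by (simp add: is_quantile_def)
  also have "\<gamma> \<Otimes>\<^sub>M \<dots> = distr \<gamma> \<gamma> (\<lambda>z. z) \<Otimes>\<^sub>M \<dots>"
    by simp
  also have "\<dots> = distr (\<gamma> \<Otimes>\<^sub>M (marginal n \<mu> \<Otimes>\<^sub>M unif)) (\<gamma> \<Otimes>\<^sub>M coord_space (Suc n))
      (\<lambda>(z, xu). (z, (\<lambda>(x, u). x(n := Q (x, u))) xu))"
    by (rule pair_measure_distr) (use pr in \<open>auto intro: prob_space_imp_sigma_finite\<close>)
  also have "distr \<dots> (coord_space (Suc n)) (\<lambda>(z, x). \<lambda>i\<in>{..<Suc n}. x i + z i) =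
    distr (\<gamma> \<Otimes>\<^sub>M (marginal n \<mu> \<Otimes>\<^sub>M unif)) (coord_space (Suc n))
      (\<lambda>(z, x, u). (\<lambda>i\<in>{..<n}. x i + z i)(n := Q (x, u) + z n))"
    by (subst distr_distr; (measurable)?) (auto simp: comp_def fun_eq_iff restrict_def intro!: distr_cong)
  finally show ?thesis .
qed

lemma integral_unif_indicator:
  assumes "is_quantile n \<mu> Q" "x \<in> space (coord_space n)"
  shows "(\<integral>u. c * indicator {..<q} (Q (x, u)) \<partial>unif) = c * qcdf Q (x, q)"
proof -
  note [measurable] = is_quantile_measurable[OF assms(1)] assms(2)
  have "(\<integral>u. c * indicator {..<q} (Q (x, u)) \<partial>unif) = (\<integral>u. c * indicator {u. Q (x, u) < q} u \<partial>unif)"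
    by (intro Bochner_Integration.integral_cong) (auto simp: indicator_def)
  then show ?thesis by (simp add: qcdf_def)
qed

text \<open>
  For \<open>Y = X + Z\<close> with \<open>X \<sim> \<mu>\<close> and \<open>Z \<sim> \<gamma>\<close> independent, \<open>qcdf R (Y, q)\<close> is the conditional
  expectation of \<open>qcdf Q (X, q - Z_n)\<close> given the first \<open>n\<close> coordinates of \<open>Y\<close>, and \<open>g\<close> is a function
  of these coordinates.
\<close>

lemma qcdf_contraction:
  assumes "prob_space \<mu>" "prob_space \<gamma>"
    and \<mu>: "sets \<mu> = sets (coord_space N)" and \<gamma>[measurable_cong]: "sets \<gamma> = sets (coord_space N)" and n: "n < N"
    and Q: "is_quantile n \<mu> Q" and R: "is_quantile n (coord_conv N \<mu> \<gamma>) R"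
    and g[measurable]: "g \<in> borel_measurable (coord_space n)" and B: "\<And>y. \<bar>g y\<bar> \<le> B"
  shows "(\<integral>\<^sup>+y. ennreal \<bar>g y - qcdf R (y, q)\<bar> \<partial>marginal n (coord_conv N \<mu> \<gamma>)) \<le>
    (\<integral>\<^sup>+(z, x). ennreal \<bar>g (\<lambda>i\<in>{..<n}. x i + z i) - qcdf Q (x, q - z n)\<bar> \<partial>(\<gamma> \<Otimes>\<^sub>M marginal n \<mu>))"
proof -
  let ?\<nu> = "coord_conv N \<mu> \<gamma>" and ?add = "\<lambda>z x. \<lambda>i\<in>{..<n}. x i + z i :: real"
  let ?V = "marginal n ?\<nu>" and ?M = "marginal n \<mu>"
  interpret \<gamma>: prob_space \<gamma> by fact
  interpret \<nu>: prob_space ?\<nu> by (rule prob_space_coord_conv) fact+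
  have nN: "n \<le> N" using n by simp
  interpret M: prob_space ?M by (rule prob_space_marginal[OF assms(1) \<mu> nN])
  interpret V: prob_space ?V by (rule prob_space_marginal[OF \<nu>.prob_space_axioms sets_coord_conv nN])
  interpret Mu: pair_prob_space ?M unif ..
  interpret Vu: pair_prob_space ?V unif ..
  interpret \<gamma>M: pair_prob_space \<gamma> ?M ..
  interpret \<gamma>Mu: pair_prob_space \<gamma> "?M \<Otimes>\<^sub>M unif" ..
  note [measurable] = is_quantile_measurable[OF Q] is_quantile_measurable[OF R] coord_borel_measurable[OF \<gamma> n]
    qcdf_measurable[OF is_quantile_measurable[OF Q]] qcdf_measurable[OF is_quantile_measurable[OF R]]
  have add[measurable]: "(\<lambda>w. ?add (f w) (h w)) \<in> M' \<rightarrow>\<^sub>M coord_space n"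
    if "f \<in> M' \<rightarrow>\<^sub>M \<gamma>" "h \<in> M' \<rightarrow>\<^sub>M coord_space n" for f h and M' :: "'z measure"
    by (rule measurable_coord_add[OF \<gamma> nN that])
  have [measurable]: "(\<lambda>w. w n) \<in> borel_measurable (coord_space (Suc n))" by simp
  have [measurable]: "(\<lambda>x. restrict x {..<n}) \<in> coord_space (Suc n) \<rightarrow>\<^sub>M coord_space n" by simp
  \<comment> \<open>Testing against the sign \<open>s\<close> recovers the \<open>L^1\<close> norm and makes the claim linear in \<open>qcdf R\<close>.\<close>
  define s where "s y = sgn (qcdf R (y, q) - g y)" for y
  have [measurable]: "s \<in> borel_measurable (coord_space n)" unfolding s_def by measurable
  have s1: "\<bar>s y\<bar> \<le> 1" for y by (auto simp: s_def sgn_if)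
  let ?D = "\<lambda>z x. s (?add z x) * qcdf Q (x, q - z n) - s (?add z x) * g (?add z x)"
  have sB: "\<bar>s y * g y'\<bar> \<le> B" for y y'
    using mult_mono[OF s1[of y] B[of y']] by (simp add: abs_mult)
  have sG: "\<bar>s y * qcdf R p\<bar> \<le> 1" "\<bar>s y * qcdf Q p'\<bar> \<le> 1" for y p p'
    using mult_mono[OF s1[of y] qcdf_bounds(2)[of R p]] mult_mono[OF s1[of y] qcdf_bounds(2)[of Q p']] qcdf_bounds[of R p] qcdf_bounds[of Q p']
    by (simp_all add: abs_mult)
  have sI: "\<bar>s y * indicator A v\<bar> \<le> 1" for y v and A :: "real set"
    using s1[of y] by (auto simp: indicator_def)
  have addn: "z \<in> space \<gamma> \<Longrightarrow> x \<in> space (coord_space n) \<Longrightarrow> ?add z x \<in> space (coord_space n)" for z x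
    by (auto simp: space_PiM)
  \<comment> \<open>Both sides are the expectation of \<open>s (Y)\<close> on the event that \<open>Y_n < q\<close>, computed from \<open>\<nu>\<close> and from \<open>\<mu>\<close> and \<open>\<gamma>\<close>.\<close>
  have I1: "(\<integral>y. s y * qcdf R (y, q) \<partial>?V) = (\<integral>(z, x). s (?add z x) * qcdf Q (x, q - z n) \<partial>(\<gamma> \<Otimes>\<^sub>M ?M))"
  proof -
    have "(\<integral>y. s y * qcdf R (y, q) \<partial>?V) = (\<integral>y. (\<integral>u. s y * indicator {..<q} (R (y, u)) \<partial>unif) \<partial>?V)"
      by (intro Bochner_Integration.integral_cong refl integral_unif_indicator[OF R, symmetric]) simp
    also have "\<dots> = (\<integral>p. s (fst p) * indicator {..<q} (R p) \<partial>(?V \<Otimes>\<^sub>M unif))"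
      by (subst Vu.integral_fst'[symmetric])
         (auto intro!: Vu.integrable_const_bound[where B=1] simp: sI)
    also have "\<dots> = (\<integral>p. s (restrict ((fst p)(n := R p)) {..<n}) * indicator {..<q} (((fst p)(n := R p)) n) \<partial>(?V \<Otimes>\<^sub>M unif))"
      by (intro Bochner_Integration.integral_cong refl arg_cong2[where f=times] arg_cong[where f=s])
         (auto simp: space_pair_measure space_PiM fun_eq_iff PiE_iff extensional_def)
    also have "\<dots> = (\<integral>y. s (restrict y {..<n}) * indicator {..<q} (y n) \<partial>marginal (Suc n) ?\<nu>)"
      using R unfolding is_quantile_def by (simp add: integral_distr split_beta')
    also have "\<dots> = (\<integral>(z, x, u). s (?add z x) * indicator {..<q} (Q (x, u) + z n) \<partial>(\<gamma> \<Otimes>\<^sub>M (?M \<Otimes>\<^sub>M unif)))"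
    proof -
      have map: "(\<lambda>w. (?add (fst w) (fst (snd w)))(n := Q (fst (snd w), snd (snd w)) + fst w n))
          \<in> \<gamma> \<Otimes>\<^sub>M (?M \<Otimes>\<^sub>M unif) \<rightarrow>\<^sub>M coord_space (Suc n)"
        by measurable
      have h: "(\<lambda>y. s (restrict y {..<n}) * indicator {..<q} (y n)) \<in> borel_measurable (coord_space (Suc n))"
        by measurable
      have "restrict ((?add z x)(n := v)) {..<n} = ?add z x" for z x v
        by (auto simp: fun_eq_iff restrict_def)
      then show ?thesis
        unfolding marginal_Suc_coord_conv[OF assms(1,2) \<mu> \<gamma> n Q] split_beta'
        by (subst integral_distr[OF map h]) simp
    qed
    also have "\<dots> = (\<integral>z. (\<integral>(x, u). s (?add z x) * indicator {..<q} (Q (x, u) + z n) \<partial>(?M \<Otimes>\<^sub>M unif)) \<partial>\<gamma>)"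
      by (subst \<gamma>Mu.integral_fst'[symmetric])
         (auto intro!: \<gamma>Mu.integrable_const_bound[where B=1] simp: sI split_beta')
    also have "\<dots> = (\<integral>z. (\<integral>x. s (?add z x) * qcdf Q (x, q - z n) \<partial>?M) \<partial>\<gamma>)"
    proof (intro Bochner_Integration.integral_cong refl)
      fix z assume [measurable]: "z \<in> space \<gamma>"
      have "(\<integral>(x, u). s (?add z x) * indicator {..<q} (Q (x, u) + z n) \<partial>(?M \<Otimes>\<^sub>M unif)) =
          (\<integral>x. (\<integral>u. s (?add z x) * indicator {..<q} (Q (x, u) + z n) \<partial>unif) \<partial>?M)"
        by (subst Mu.integral_fst'[symmetric])
           (auto intro!: Mu.integrable_const_bound[where B=1] simp: sI split_beta')
      also have "\<dots> = (\<integral>x. (\<integral>u. s (?add z x) * indicator {..<q - z n} (Q (x, u)) \<partial>unif) \<partial>?M)"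
        by (intro Bochner_Integration.integral_cong refl) (auto simp: indicator_def)
      also have "\<dots> = (\<integral>x. s (?add z x) * qcdf Q (x, q - z n) \<partial>?M)"
        by (intro Bochner_Integration.integral_cong refl integral_unif_indicator[OF Q]) simp
      finally show "(\<integral>(x, u). s (?add z x) * indicator {..<q} (Q (x, u) + z n) \<partial>(?M \<Otimes>\<^sub>M unif)) =
        (\<integral>x. s (?add z x) * qcdf Q (x, q - z n) \<partial>?M)" .
    qed
    also have "\<dots> = (\<integral>(z, x). s (?add z x) * qcdf Q (x, q - z n) \<partial>(\<gamma> \<Otimes>\<^sub>M ?M))"
      by (subst \<gamma>M.integral_fst'[symmetric])
         (auto intro!: \<gamma>M.integrable_const_bound[where B=1] simp: sG split_beta')
    finally show ?thesis .
  qed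
  have I2: "(\<integral>y. s y * g y \<partial>?V) = (\<integral>(z, x). s (?add z x) * g (?add z x) \<partial>(\<gamma> \<Otimes>\<^sub>M ?M))"
    unfolding marginal_coord_conv[OF assms(1,2) \<mu> \<gamma> nN] split_beta'
    by (subst integral_distr) auto
  have "(\<integral>\<^sup>+y. ennreal \<bar>g y - qcdf R (y, q)\<bar> \<partial>?V) = (\<integral>\<^sup>+y. ennreal (s y * qcdf R (y, q) - s y * g y) \<partial>?V)"
    by (intro nn_integral_cong) (auto simp: s_def sgn_if abs_if)
  also have "\<dots> = ennreal (\<integral>y. s y * qcdf R (y, q) - s y * g y \<partial>?V)"
  proof (rule nn_integral_eq_integral)
    show "AE y in ?V. 0 \<le> s y * qcdf R (y, q) - s y * g y"
      by (auto simp: s_def sgn_if)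
    show "integrable ?V (\<lambda>y. s y * qcdf R (y, q) - s y * g y)"
      by (intro Bochner_Integration.integrable_diff V.integrable_const_bound[where B=1] V.integrable_const_bound[where B=B])
         (auto simp: sG sB)
  qed
  also have "(\<integral>y. s y * qcdf R (y, q) - s y * g y \<partial>?V) = (\<integral>y. s y * qcdf R (y, q) \<partial>?V) - (\<integral>y. s y * g y \<partial>?V)"
    by (intro Bochner_Integration.integral_diff V.integrable_const_bound[where B=1] V.integrable_const_bound[where B=B])
       (auto simp: sG sB)
  also have "\<dots> = (\<integral>(z, x). ?D z x \<partial>(\<gamma> \<Otimes>\<^sub>M ?M))"
    unfolding I1 I2 split_beta'
    by (intro Bochner_Integration.integral_diff[symmetric] \<gamma>M.integrable_const_bound[where B=1] \<gamma>M.integrable_const_bound[where B=B])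
       (auto simp: sG sB)
  also have "ennreal \<dots> \<le> (\<integral>\<^sup>+p. ennreal (norm (case p of (z, x) \<Rightarrow> ?D z x)) \<partial>(\<gamma> \<Otimes>\<^sub>M ?M))"
  proof (rule order_trans[OF _ integral_norm_bound_ennreal])
    show "integrable (\<gamma> \<Otimes>\<^sub>M ?M) (\<lambda>(z, x). ?D z x)"
      unfolding split_beta'
      by (intro Bochner_Integration.integrable_diff \<gamma>M.integrable_const_bound[where B=1] \<gamma>M.integrable_const_bound[where B=B])
         (auto simp: sG sB)
  qed (auto intro!: ennreal_leI)
  also have "\<dots> \<le> (\<integral>\<^sup>+(z, x). ennreal \<bar>g (?add z x) - qcdf Q (x, q - z n)\<bar> \<partial>(\<gamma> \<Otimes>\<^sub>M ?M))"
  proof (intro nn_integral_mono)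
    fix p :: "(nat \<Rightarrow> real) \<times> (nat \<Rightarrow> real)"
    obtain z x where p: "p = (z, x)" by (cases p)
    have "\<bar>?D z x\<bar> =
        \<bar>s (?add z x)\<bar> * \<bar>g (?add z x) - qcdf Q (x, q - z n)\<bar>"
      by (simp add: abs_mult abs_minus_commute flip: right_diff_distrib)
    also have "\<dots> \<le> 1 * \<bar>g (?add z x) - qcdf Q (x, q - z n)\<bar>"
      by (intro mult_right_mono s1) simp
    finally show "ennreal (norm (case p of (z, x) \<Rightarrow> ?D z x))
        \<le> (case p of (z, x) \<Rightarrow> ennreal \<bar>g (?add z x) - qcdf Q (x, q - z n)\<bar>)"
      by (simp add: p ennreal_leI)
  qed
  finally show ?thesis .
qed

section \<open>Convergence of the coordinates under the quantile coupling\<close>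

text \<open>Translating a law by \<open>c\<close> moves its distribution function by \<open>|c|\<close> in \<open>L^1\<close>.\<close>

lemma nn_integral_qcdf_shift:
  assumes Q: "is_quantile n \<mu> Q" and x[measurable]: "x \<in> space (coord_space n)"
  shows "(\<integral>\<^sup>+q. ennreal \<bar>qcdf Q (x, q) - qcdf Q (x, q - c)\<bar> \<partial>lborel) = ennreal \<bar>c\<bar>"
proof -
  note [measurable] = is_quantile_measurable[OF Q]
  have m: "mono_on {0<..<1} (\<lambda>u. Q (x, u))" using Q by (simp add: is_quantile_def)
  then have m': "mono_on {0<..<1} (\<lambda>u. Q (x, u) + c)" by (auto simp: mono_on_def)
  have eq: "{u. Q (x, u) + c < q} = {u. Q (x, u) < q - c}" for q by auto
  have "(\<integral>\<^sup>+u. ennreal \<bar>Q (x, u) - (Q (x, u) + c)\<bar> \<partial>unif) =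
      (\<integral>\<^sup>+q. ennreal \<bar>measure unif {u. Q (x, u) < q} - measure unif {u. Q (x, u) + c < q}\<bar> \<partial>lborel)"
    by (intro nn_integral_unif_abs_diff m m') measurable
  then show ?thesis
    by (simp add: qcdf_def eq unif.emeasure_space_1[simplified])
qed

lemma nn_integral_abs_diff_triangle:
  fixes a b c d :: "'a \<Rightarrow> real"
  assumes [measurable]: "a \<in> borel_measurable M" "b \<in> borel_measurable M" "c \<in> borel_measurable M" "d \<in> borel_measurable M"
  shows "(\<integral>\<^sup>+q. ennreal \<bar>a q - d q\<bar> \<partial>M) \<le> (\<integral>\<^sup>+q. ennreal \<bar>a q - b q\<bar> \<partial>M) +
    (\<integral>\<^sup>+q. ennreal \<bar>b q - c q\<bar> \<partial>M) + (\<integral>\<^sup>+q. ennreal \<bar>c q - d q\<bar> \<partial>M)"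
proof -
  have "(\<integral>\<^sup>+q. ennreal \<bar>a q - d q\<bar> \<partial>M) \<le>
      (\<integral>\<^sup>+q. (ennreal \<bar>a q - b q\<bar> + ennreal \<bar>b q - c q\<bar>) + ennreal \<bar>c q - d q\<bar> \<partial>M)"
    by (intro nn_integral_mono) (simp flip: ennreal_plus)
  also have "\<dots> = (\<integral>\<^sup>+q. ennreal \<bar>a q - b q\<bar> + ennreal \<bar>b q - c q\<bar> \<partial>M) + (\<integral>\<^sup>+q. ennreal \<bar>c q - d q\<bar> \<partial>M)"
    by (rule nn_integral_add) measurable
  also have "(\<integral>\<^sup>+q. ennreal \<bar>a q - b q\<bar> + ennreal \<bar>b q - c q\<bar> \<partial>M) =
      (\<integral>\<^sup>+q. ennreal \<bar>a q - b q\<bar> \<partial>M) + (\<integral>\<^sup>+q. ennreal \<bar>b q - c q\<bar> \<partial>M)"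
    by (rule nn_integral_add) measurable
  finally show ?thesis .
qed

text \<open>
  If \<open>g\<close> is close to the conditional distribution function of \<open>\<mu>\<close>, then it is also close to that of
  the convolution, up to the moments of the noise.
\<close>

lemma nn_integral_coord_conv_bound:
  assumes "prob_space \<mu>" "prob_space \<gamma>"
    and \<mu>: "sets \<mu> = sets (coord_space N)" and \<gamma>[measurable_cong]: "sets \<gamma> = sets (coord_space N)" and n: "n < N"
    and Q: "is_quantile n \<mu> Q" and R: "is_quantile n (coord_conv N \<mu> \<gamma>) R"
    and g[measurable]: "g \<in> borel_measurable (coord_space n \<Otimes>\<^sub>M borel)" and B: "\<And>p. \<bar>g p\<bar> \<le> B"
    and "0 \<le> L" and L: "\<And>x y. x \<in> space (coord_space n) \<Longrightarrow> y \<in> space (coord_space n) \<Longrightarrow>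
      (\<integral>\<^sup>+q. ennreal \<bar>g (x, q) - g (y, q)\<bar> \<partial>lborel) \<le> ennreal (L * (\<Sum>i<n. \<bar>x i - y i\<bar>))"
  shows "(\<integral>\<^sup>+y. \<integral>\<^sup>+q. ennreal \<bar>g (y, q) - qcdf R (y, q)\<bar> \<partial>lborel \<partial>marginal n (coord_conv N \<mu> \<gamma>)) \<le>
    ennreal L * (\<Sum>i<n. \<integral>\<^sup>+z. ennreal \<bar>z i\<bar> \<partial>\<gamma>) +
    (\<integral>\<^sup>+x. \<integral>\<^sup>+q. ennreal \<bar>g (x, q) - qcdf Q (x, q)\<bar> \<partial>lborel \<partial>marginal n \<mu>) +
    (\<integral>\<^sup>+z. ennreal \<bar>z n\<bar> \<partial>\<gamma>)"
proof -
  let ?\<nu> = "coord_conv N \<mu> \<gamma>" and ?add = "\<lambda>z x. \<lambda>i\<in>{..<n}. x i + z i :: real"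
  let ?V = "marginal n ?\<nu>" and ?M = "marginal n \<mu>"
  interpret \<gamma>: prob_space \<gamma> by fact
  interpret \<nu>: prob_space ?\<nu> by (rule prob_space_coord_conv) fact+
  have nN: "n \<le> N" using n by simp
  interpret M: prob_space ?M by (rule prob_space_marginal[OF assms(1) \<mu> nN])
  interpret V: prob_space ?V by (rule prob_space_marginal[OF \<nu>.prob_space_axioms sets_coord_conv nN])
  interpret \<gamma>M: pair_prob_space \<gamma> ?M ..
  interpret Vl: pair_sigma_finite ?V lborel ..
  interpret \<gamma>Ml: pair_sigma_finite "\<gamma> \<Otimes>\<^sub>M ?M" lborel ..
  note [measurable] = is_quantile_measurable[OF Q] is_quantile_measurable[OF R]
    qcdf_measurable[OF is_quantile_measurable[OF Q]] qcdf_measurable[OF is_quantile_measurable[OF R]]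
  have zi[measurable]: "(\<lambda>z. z i) \<in> borel_measurable \<gamma>" if "i \<le> n" for i
    using that n by (intro coord_borel_measurable[OF \<gamma>]) simp
  have [measurable]: "(\<lambda>w. ?add (f w) (h w)) \<in> M' \<rightarrow>\<^sub>M coord_space n"
    if "f \<in> M' \<rightarrow>\<^sub>M \<gamma>" "h \<in> M' \<rightarrow>\<^sub>M coord_space n" for f h and M' :: "'z measure"
    by (rule measurable_coord_add[OF \<gamma> nN that])
  have sum_m[measurable]: "(\<lambda>z. \<Sum>i<n. ennreal \<bar>z i\<bar>) \<in> borel_measurable \<gamma>"
    by (intro borel_measurable_sum) (auto intro!: measurable_compose[OF zi])
  have "(\<integral>\<^sup>+y. \<integral>\<^sup>+q. ennreal \<bar>g (y, q) - qcdf R (y, q)\<bar> \<partial>lborel \<partial>?V) =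
      (\<integral>\<^sup>+q. \<integral>\<^sup>+y. ennreal \<bar>g (y, q) - qcdf R (y, q)\<bar> \<partial>?V \<partial>lborel)"
    by (intro Vl.Fubini'[symmetric]) measurable
  also have "\<dots> \<le> (\<integral>\<^sup>+q. \<integral>\<^sup>+(z, x). ennreal \<bar>g (?add z x, q) - qcdf Q (x, q - z n)\<bar> \<partial>(\<gamma> \<Otimes>\<^sub>M ?M) \<partial>lborel)"
    by (intro nn_integral_mono qcdf_contraction[OF assms(1,2) \<mu> \<gamma> n Q R _ B]) measurable
  also have "\<dots> = (\<integral>\<^sup>+p. \<integral>\<^sup>+q. ennreal \<bar>g (?add (fst p) (snd p), q) - qcdf Q (snd p, q - fst p n)\<bar> \<partial>lborel \<partial>(\<gamma> \<Otimes>\<^sub>M ?M))"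
    unfolding split_beta' by (intro \<gamma>Ml.Fubini') measurable
  also have "\<dots> \<le> (\<integral>\<^sup>+p. (ennreal L * (\<Sum>i<n. ennreal \<bar>fst p i\<bar>) +
      (\<integral>\<^sup>+q. ennreal \<bar>g (snd p, q) - qcdf Q (snd p, q)\<bar> \<partial>lborel)) + ennreal \<bar>fst p n\<bar> \<partial>(\<gamma> \<Otimes>\<^sub>M ?M))"
  proof (intro nn_integral_mono)
    fix p assume "p \<in> space (\<gamma> \<Otimes>\<^sub>M ?M)"
    then obtain z x where p: "p = (z, x)" and "z \<in> space \<gamma>" and x_sp: "x \<in> space (coord_space n)"
      by (auto simp: space_pair_measure)
    have add_sp: "?add z x \<in> space (coord_space n)" by (simp add: space_PiM)
    have sec: "(\<lambda>q. g (?add z x, q)) \<in> borel_measurable borel" "(\<lambda>q. g (x, q)) \<in> borel_measurable borel"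
      "(\<lambda>q. qcdf Q (x, q)) \<in> borel_measurable borel"
      by (rule measurable_Pair2, measurable, fact)+
    have qs: "(\<lambda>q. qcdf Q (x, q - z n)) \<in> borel_measurable borel"
      by (rule measurable_compose[OF _ sec(3)]) simp
    have "(\<integral>\<^sup>+q. ennreal \<bar>g (?add z x, q) - g (x, q)\<bar> \<partial>lborel) \<le> ennreal (L * (\<Sum>i<n. \<bar>?add z x i - x i\<bar>))"
      by (intro L add_sp x_sp)
    also have "(\<Sum>i<n. \<bar>?add z x i - x i\<bar>) = (\<Sum>i<n. \<bar>z i\<bar>)"
      by (intro sum.cong) auto
    also have "ennreal (L * (\<Sum>i<n. \<bar>z i\<bar>)) = ennreal L * (\<Sum>i<n. ennreal \<bar>z i\<bar>)"
      using \<open>0 \<le> L\<close> by (simp add: ennreal_mult sum_nonneg)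
    finally have lip: "(\<integral>\<^sup>+q. ennreal \<bar>g (?add z x, q) - g (x, q)\<bar> \<partial>lborel) \<le> ennreal L * (\<Sum>i<n. ennreal \<bar>z i\<bar>)" .
    have tri: "(\<integral>\<^sup>+q. ennreal \<bar>g (?add z x, q) - qcdf Q (x, q - z n)\<bar> \<partial>lborel) \<le>
      (\<integral>\<^sup>+q. ennreal \<bar>g (?add z x, q) - g (x, q)\<bar> \<partial>lborel) + (\<integral>\<^sup>+q. ennreal \<bar>g (x, q) - qcdf Q (x, q)\<bar> \<partial>lborel) +
        (\<integral>\<^sup>+q. ennreal \<bar>qcdf Q (x, q) - qcdf Q (x, q - z n)\<bar> \<partial>lborel)"
      by (rule nn_integral_abs_diff_triangle[where a="\<lambda>q. g (?add z x, q)" and b="\<lambda>q. g (x, q)"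
            and c="\<lambda>q. qcdf Q (x, q)" and d="\<lambda>q. qcdf Q (x, q - z n)"]) (simp_all add: sec qs)
    show "(\<integral>\<^sup>+q. ennreal \<bar>g (?add (fst p) (snd p), q) - qcdf Q (snd p, q - fst p n)\<bar> \<partial>lborel) \<le>
      (ennreal L * (\<Sum>i<n. ennreal \<bar>fst p i\<bar>) + (\<integral>\<^sup>+q. ennreal \<bar>g (snd p, q) - qcdf Q (snd p, q)\<bar> \<partial>lborel)) + ennreal \<bar>fst p n\<bar>"
      unfolding p fst_conv snd_conv
      by (rule order_trans[OF tri[unfolded nn_integral_qcdf_shift[OF Q x_sp]]]) (intro add_right_mono lip)
  qed
  also have "\<dots> = (\<integral>\<^sup>+z. \<integral>\<^sup>+x. (ennreal L * (\<Sum>i<n. ennreal \<bar>z i\<bar>) +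
      (\<integral>\<^sup>+q. ennreal \<bar>g (x, q) - qcdf Q (x, q)\<bar> \<partial>lborel)) + ennreal \<bar>z n\<bar> \<partial>?M \<partial>\<gamma>)"
  proof (subst M.nn_integral_fst[symmetric])
    have [measurable]: "(\<lambda>p. \<Sum>i<n. ennreal \<bar>fst p i\<bar>) \<in> borel_measurable (\<gamma> \<Otimes>\<^sub>M ?M)"
      by (rule measurable_compose[OF measurable_fst sum_m])
    show "(\<lambda>p. (ennreal L * (\<Sum>i<n. ennreal \<bar>fst p i\<bar>) + (\<integral>\<^sup>+q. ennreal \<bar>g (snd p, q) - qcdf Q (snd p, q)\<bar> \<partial>lborel)) +
        ennreal \<bar>fst p n\<bar>) \<in> borel_measurable (\<gamma> \<Otimes>\<^sub>M ?M)"
      by measurable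
  qed simp
  also have "\<dots> = (\<integral>\<^sup>+z. (ennreal L * (\<Sum>i<n. ennreal \<bar>z i\<bar>) +
      (\<integral>\<^sup>+x. \<integral>\<^sup>+q. ennreal \<bar>g (x, q) - qcdf Q (x, q)\<bar> \<partial>lborel \<partial>?M)) + ennreal \<bar>z n\<bar> \<partial>\<gamma>)"
    by (intro nn_integral_cong) (simp add: nn_integral_add M.emeasure_space_1[simplified])
  also have "\<dots> = (\<integral>\<^sup>+z. ennreal L * (\<Sum>i<n. ennreal \<bar>z i\<bar>) \<partial>\<gamma>) +
      (\<integral>\<^sup>+x. \<integral>\<^sup>+q. ennreal \<bar>g (x, q) - qcdf Q (x, q)\<bar> \<partial>lborel \<partial>?M) + (\<integral>\<^sup>+z. ennreal \<bar>z n\<bar> \<partial>\<gamma>)"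
    by (simp add: nn_integral_add \<gamma>.emeasure_space_1)
  also have "(\<integral>\<^sup>+z. ennreal L * (\<Sum>i<n. ennreal \<bar>z i\<bar>) \<partial>\<gamma>) = ennreal L * (\<Sum>i<n. \<integral>\<^sup>+z. ennreal \<bar>z i\<bar> \<partial>\<gamma>)"
    by (subst nn_integral_cmult, rule sum_m, subst nn_integral_sum) (auto intro!: measurable_compose[OF zi])
  finally show ?thesis .
qed

lemma nn_integral_run_step:
  assumes Q: "\<And>k. k \<le> n \<Longrightarrow> is_quantile k \<mu> (Q k)" and R: "\<And>k. k \<le> n \<Longrightarrow> is_quantile k \<nu> (R k)"
  shows "(\<integral>\<^sup>+u. ennreal \<bar>run Q (Suc n) u n - run R (Suc n) u n\<bar> \<partial>noise) =
    (\<integral>\<^sup>+u. \<integral>\<^sup>+q. ennreal \<bar>qcdf (Q n) (run Q n u, q) - qcdf (R n) (run R n u, q)\<bar> \<partial>lborel \<partial>noise)"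
proof -
  note [measurable] = is_quantile_measurable[OF Q] is_quantile_measurable[OF R]
  have [measurable]: "run Q n \<in> coord_space n \<rightarrow>\<^sub>M coord_space n" "run R n \<in> coord_space n \<rightarrow>\<^sub>M coord_space n"
    by (auto intro!: run_measurable_coord is_quantile_measurable Q R)
  have rm: "run Q n \<in> noise \<rightarrow>\<^sub>M coord_space n" "run R n \<in> noise \<rightarrow>\<^sub>M coord_space n"
    by (auto intro!: run_measurable is_quantile_measurable Q R)
  have "(\<integral>\<^sup>+u. ennreal \<bar>run Q (Suc n) u n - run R (Suc n) u n\<bar> \<partial>noise) =
    (\<integral>\<^sup>+u. (\<lambda>p. ennreal \<bar>Q n (fst (fst p), snd p) - R n (snd (fst p), snd p)\<bar>) ((run Q n u, run R n u), u n) \<partial>noise)"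
    by (simp add: run_Suc)
  also have "\<dots> = (\<integral>\<^sup>+u. \<integral>\<^sup>+v. (\<lambda>p. ennreal \<bar>Q n (fst (fst p), snd p) - R n (snd (fst p), snd p)\<bar>) ((run Q n u, run R n u), v) \<partial>unif \<partial>noise)"
    by (rule nn_integral_noise_split[where A="{..<n}" and S="coord_space n \<Otimes>\<^sub>M coord_space n"]) (auto simp: run_restrict)
  also have "\<dots> = (\<integral>\<^sup>+u. \<integral>\<^sup>+q. ennreal \<bar>qcdf (Q n) (run Q n u, q) - qcdf (R n) (run R n u, q)\<bar> \<partial>lborel \<partial>noise)"
  proof (intro nn_integral_cong)
    fix u assume "u \<in> space noise"
    then have "run Q n u \<in> space (coord_space n)" "run R n u \<in> space (coord_space n)"
      using rm by (auto dest: measurable_space)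
    from nn_integral_quantile_diff[OF Q R this]
    show "(\<integral>\<^sup>+v. (\<lambda>p. ennreal \<bar>Q n (fst (fst p), snd p) - R n (snd (fst p), snd p)\<bar>) ((run Q n u, run R n u), v) \<partial>unif) =
      (\<integral>\<^sup>+q. ennreal \<bar>qcdf (Q n) (run Q n u, q) - qcdf (R n) (run R n u, q)\<bar> \<partial>lborel)"
      by simp
  qed
  finally show ?thesis .
qed

lemma run_step_bound:
  assumes "prob_space \<mu>" "prob_space \<gamma>"
    and \<mu>: "sets \<mu> = sets (coord_space N)" and \<gamma>: "sets \<gamma> = sets (coord_space N)" and n: "n < N"
    and Q: "\<And>k. k < N \<Longrightarrow> is_quantile k \<mu> (Q k)" and R: "\<And>k. k < N \<Longrightarrow> is_quantile k (coord_conv N \<mu> \<gamma>) (R k)"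
    and g[measurable]: "g \<in> borel_measurable (coord_space n \<Otimes>\<^sub>M borel)" and B: "\<And>p. \<bar>g p\<bar> \<le> B"
    and "0 \<le> L" and L: "\<And>x y. x \<in> space (coord_space n) \<Longrightarrow> y \<in> space (coord_space n) \<Longrightarrow>
      (\<integral>\<^sup>+q. ennreal \<bar>g (x, q) - g (y, q)\<bar> \<partial>lborel) \<le> ennreal (L * (\<Sum>i<n. \<bar>x i - y i\<bar>))"
    and I: "I = (\<integral>\<^sup>+x. \<integral>\<^sup>+q. ennreal \<bar>g (x, q) - qcdf (Q n) (x, q)\<bar> \<partial>lborel \<partial>marginal n \<mu>)"
  shows "(\<integral>\<^sup>+u. ennreal \<bar>run Q N u n - run R N u n\<bar> \<partial>noise) \<le>
    (I + I) + (ennreal L * (\<Sum>k<n. \<integral>\<^sup>+u. ennreal \<bar>run Q N u k - run R N u k\<bar> \<partial>noise) +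
      ennreal L * (\<Sum>k<n. \<integral>\<^sup>+z. ennreal \<bar>z k\<bar> \<partial>\<gamma>) + (\<integral>\<^sup>+z. ennreal \<bar>z n\<bar> \<partial>\<gamma>))"
proof -
  let ?\<nu> = "coord_conv N \<mu> \<gamma>"
  let ?a = "\<lambda>u. \<integral>\<^sup>+q. ennreal \<bar>g (run Q n u, q) - qcdf (Q n) (run Q n u, q)\<bar> \<partial>lborel"
  let ?b = "\<lambda>u. \<integral>\<^sup>+q. ennreal \<bar>g (run R n u, q) - qcdf (R n) (run R n u, q)\<bar> \<partial>lborel"
  have pr: "prob_space ?\<nu>" by (rule prob_space_coord_conv) fact+
  have nN: "n \<le> N" using n by simp
  have [measurable]: "qcdf (Q n) \<in> borel_measurable (coord_space n \<Otimes>\<^sub>M borel)" "qcdf (R n) \<in> borel_measurable (coord_space n \<Otimes>\<^sub>M borel)"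
    by (intro qcdf_measurable is_quantile_measurable[OF Q[OF n]] is_quantile_measurable[OF R[OF n]])+
  have rm[measurable]: "run Q m \<in> noise \<rightarrow>\<^sub>M coord_space m" "run R m \<in> noise \<rightarrow>\<^sub>M coord_space m" if "m \<le> N" for m
    using that by (auto intro!: run_measurable is_quantile_measurable Q R)
  note [measurable] = rm[OF nN]
  have lawQ: "distr noise (coord_space n) (run Q n) = marginal n \<mu>"
    by (rule distr_run[OF assms(1) \<mu> nN]) (use nN Q in auto)
  have lawR: "distr noise (coord_space n) (run R n) = marginal n ?\<nu>"
    by (rule distr_run[OF pr sets_coord_conv nN]) (use nN R in auto)
  have "(\<integral>\<^sup>+u. ennreal \<bar>run Q N u n - run R N u n\<bar> \<partial>noise) = (\<integral>\<^sup>+u. ennreal \<bar>run Q (Suc n) u n - run R (Suc n) u n\<bar> \<partial>noise)"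
    using run_le[of n "Suc n" N] n by simp
  also have "\<dots> = (\<integral>\<^sup>+u. \<integral>\<^sup>+q. ennreal \<bar>qcdf (Q n) (run Q n u, q) - qcdf (R n) (run R n u, q)\<bar> \<partial>lborel \<partial>noise)"
    using n by (intro nn_integral_run_step[of n \<mu> Q ?\<nu> R] Q R) simp_all
  also have "\<dots> \<le> (\<integral>\<^sup>+u. ?a u +
      ennreal L * (\<Sum>k<n. ennreal \<bar>run Q N u k - run R N u k\<bar>) +
      ?b u \<partial>noise)"
  proof (intro nn_integral_mono)
    fix u assume "u \<in> space noise"
    then have sp: "run Q n u \<in> space (coord_space n)" "run R n u \<in> space (coord_space n)"
      using measurable_space[OF rm(1)[OF nN]] measurable_space[OF rm(2)[OF nN]] by blast+
    have sec: "(\<lambda>q. g (run Q n u, q)) \<in> borel_measurable borel" "(\<lambda>q. g (run R n u, q)) \<in> borel_measurable borel"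
      "(\<lambda>q. qcdf (Q n) (run Q n u, q)) \<in> borel_measurable borel"
      "(\<lambda>q. qcdf (R n) (run R n u, q)) \<in> borel_measurable borel"
      by (rule measurable_Pair2, measurable, fact)+
    have "(\<integral>\<^sup>+q. ennreal \<bar>qcdf (Q n) (run Q n u, q) - qcdf (R n) (run R n u, q)\<bar> \<partial>lborel) \<le>
      (\<integral>\<^sup>+q. ennreal \<bar>qcdf (Q n) (run Q n u, q) - g (run Q n u, q)\<bar> \<partial>lborel) +
        (\<integral>\<^sup>+q. ennreal \<bar>g (run Q n u, q) - g (run R n u, q)\<bar> \<partial>lborel) +
        ?b u"
      by (rule nn_integral_abs_diff_triangle[where a="\<lambda>q. qcdf (Q n) (run Q n u, q)" and b="\<lambda>q. g (run Q n u, q)"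
            and c="\<lambda>q. g (run R n u, q)" and d="\<lambda>q. qcdf (R n) (run R n u, q)"]) (simp_all add: sec)
    also have "(\<integral>\<^sup>+q. ennreal \<bar>qcdf (Q n) (run Q n u, q) - g (run Q n u, q)\<bar> \<partial>lborel) =
        ?a u"
      by (simp add: abs_minus_commute)
    also have "(\<integral>\<^sup>+q. ennreal \<bar>g (run Q n u, q) - g (run R n u, q)\<bar> \<partial>lborel) \<le> ennreal (L * (\<Sum>i<n. \<bar>run Q n u i - run R n u i\<bar>))"
      by (intro L sp)
    also have "ennreal (L * (\<Sum>i<n. \<bar>run Q n u i - run R n u i\<bar>)) = ennreal L * (\<Sum>k<n. ennreal \<bar>run Q N u k - run R N u k\<bar>)"
      using \<open>0 \<le> L\<close> nN by (simp add: ennreal_mult sum_nonneg run_le[of _ n N])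
    finally show "(\<integral>\<^sup>+q. ennreal \<bar>qcdf (Q n) (run Q n u, q) - qcdf (R n) (run R n u, q)\<bar> \<partial>lborel) \<le>
      ?a u +
      ennreal L * (\<Sum>k<n. ennreal \<bar>run Q N u k - run R N u k\<bar>) +
      ?b u"
      by (simp add: add_mono)
  qed
  also have "\<dots> = (\<integral>\<^sup>+u. ?a u \<partial>noise) +
      ennreal L * (\<Sum>k<n. \<integral>\<^sup>+u. ennreal \<bar>run Q N u k - run R N u k\<bar> \<partial>noise) +
      (\<integral>\<^sup>+u. ?b u \<partial>noise)"
  proof -
    have k[measurable]: "(\<lambda>u. ennreal \<bar>run Q N u k - run R N u k\<bar>) \<in> borel_measurable noise" if "k < n" for k
      using that n by (auto intro!: measurable_compose[OF _ measurable_ennreal] borel_measurable_abs borel_measurable_diff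
        measurable_compose[OF rm(1) measurable_component_singleton] measurable_compose[OF rm(2) measurable_component_singleton])
    have s[measurable]: "(\<lambda>u. \<Sum>k<n. ennreal \<bar>run Q N u k - run R N u k\<bar>) \<in> borel_measurable noise"
      by (intro borel_measurable_sum k) simp
    have "(\<Sum>k<n. \<integral>\<^sup>+u. ennreal \<bar>run Q N u k - run R N u k\<bar> \<partial>noise) = (\<integral>\<^sup>+u. (\<Sum>k<n. ennreal \<bar>run Q N u k - run R N u k\<bar>) \<partial>noise)"
      by (intro nn_integral_sum[symmetric] k) simp
    then show ?thesis
      by (simp add: nn_integral_add nn_integral_cmult del: sum_ennreal)
  qed
  also have "(\<integral>\<^sup>+u. ?a u \<partial>noise) = I"
    unfolding I lawQ[symmetric] by (subst nn_integral_distr) auto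
  also have "(\<integral>\<^sup>+u. ?b u \<partial>noise) =
      (\<integral>\<^sup>+y. \<integral>\<^sup>+q. ennreal \<bar>g (y, q) - qcdf (R n) (y, q)\<bar> \<partial>lborel \<partial>marginal n ?\<nu>)"
    unfolding lawR[symmetric] by (subst nn_integral_distr) auto
  also have "\<dots> \<le> ennreal L * (\<Sum>k<n. \<integral>\<^sup>+z. ennreal \<bar>z k\<bar> \<partial>\<gamma>) + I + (\<integral>\<^sup>+z. ennreal \<bar>z n\<bar> \<partial>\<gamma>)"
    unfolding I by (rule nn_integral_coord_conv_bound[OF assms(1,2) \<mu> \<gamma> n Q[OF n] R[OF n] g B \<open>0 \<le> L\<close> L])
  finally show ?thesis
    by (simp add: add_left_mono add_ac)
qed

text \<open>
  Subtracting the distribution function \<open>1_{q > 0}\<close> of the point mass at \<open>0\<close> makes \<open>qcdf Q\<close>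
  integrable, with norm the first absolute moment of coordinate \<open>n\<close>.
\<close>

lemma exists_L1_lipschitz_approx:
  assumes "prob_space \<mu>" and \<mu>: "sets \<mu> = sets (coord_space N)" and n: "n < N"
    and Q: "is_quantile n \<mu> Q" and fin: "(\<integral>\<^sup>+x. ennreal \<bar>x n\<bar> \<partial>\<mu>) < \<infinity>" and "0 < e"
  shows "\<exists>g. L1_lipschitz n g \<and> (\<integral>\<^sup>+x. \<integral>\<^sup>+q. ennreal \<bar>g (x, q) - qcdf Q (x, q)\<bar> \<partial>lborel \<partial>marginal n \<mu>) < ennreal e"
proof -
  let ?M = "marginal n \<mu>"
  have nN: "n \<le> N" using n by simp
  interpret M: prob_space ?M by (rule prob_space_marginal[OF assms(1) \<mu> nN])
  interpret Ml: pair_sigma_finite ?M lborel ..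
  note [measurable] = is_quantile_measurable[OF Q] qcdf_measurable[OF is_quantile_measurable[OF Q]]
  define h where "h p = qcdf Q p - indicator {0<..} (snd p)" for p
  have [measurable]: "h \<in> borel_measurable (coord_space n \<Otimes>\<^sub>M borel)" unfolding h_def by measurable
  have "(\<integral>\<^sup>+p. ennreal (norm (h p)) \<partial>(?M \<Otimes>\<^sub>M lborel)) = (\<integral>\<^sup>+x. \<integral>\<^sup>+q. ennreal (norm (h (x, q))) \<partial>lborel \<partial>?M)"
    by (intro lborel.nn_integral_fst[symmetric]) measurable
  also have "\<dots> = (\<integral>\<^sup>+x. \<integral>\<^sup>+u. ennreal \<bar>Q (x, u) - 0\<bar> \<partial>unif \<partial>?M)"
  proof (intro nn_integral_cong)
    fix x assume "x \<in> space ?M"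
    then have [measurable]: "x \<in> space (coord_space n)" by simp
    have "measure unif {u. 0 < q} = indicator {0<..} q" for q :: real
      using unif.prob_space by (auto simp: indicator_def)
    then show "(\<integral>\<^sup>+q. ennreal (norm (h (x, q))) \<partial>lborel) = (\<integral>\<^sup>+u. ennreal \<bar>Q (x, u) - 0\<bar> \<partial>unif)"
      using Q by (subst nn_integral_unif_abs_diff) (auto simp: h_def qcdf_def is_quantile_def mono_on_def)
  qed
  also have "\<dots> = (\<integral>\<^sup>+p. ennreal \<bar>Q p\<bar> \<partial>(?M \<Otimes>\<^sub>M unif))"
    by (subst unif.nn_integral_fst[symmetric]) auto
  also have "\<dots> = (\<integral>\<^sup>+x. ennreal \<bar>x n\<bar> \<partial>marginal (Suc n) \<mu>)"
    using Q unfolding is_quantile_def by (simp add: nn_integral_distr split_beta')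
  also have "\<dots> = (\<integral>\<^sup>+x. ennreal \<bar>x n\<bar> \<partial>\<mu>)"
    unfolding marginal_def using n by (subst nn_integral_distr) (auto intro!: measurable_restrict_coord'[OF \<mu>])
  finally have "integrable (?M \<Otimes>\<^sub>M lborel) h"
    using fin by (intro integrableI_bounded) auto
  from L1_lipschitz_dense[OF M.prob_space_axioms sets_marginal this \<open>0 < e\<close>] obtain g where
    g: "L1_lipschitz n g" "(\<integral>\<^sup>+p. ennreal \<bar>h p - g p\<bar> \<partial>(?M \<Otimes>\<^sub>M lborel)) < ennreal e" by blast
  note [measurable] = L1_lipschitz_measurable[OF g(1)]
  have "L1_lipschitz n (\<lambda>p. g p + indicator {0<..} (snd p))"
    by (intro L1_lipschitz_add g L1_lipschitz_snd[of _ 1]) auto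
  moreover have "(\<integral>\<^sup>+x. \<integral>\<^sup>+q. ennreal \<bar>(g (x, q) + indicator {0<..} (snd (x, q))) - qcdf Q (x, q)\<bar> \<partial>lborel \<partial>?M) < ennreal e"
  proof -
    have "(\<integral>\<^sup>+x. \<integral>\<^sup>+q. ennreal \<bar>(g (x, q) + indicator {0<..} (snd (x, q))) - qcdf Q (x, q)\<bar> \<partial>lborel \<partial>?M) =
        (\<integral>\<^sup>+x. \<integral>\<^sup>+q. ennreal \<bar>h (x, q) - g (x, q)\<bar> \<partial>lborel \<partial>?M)"
      by (intro nn_integral_cong arg_cong[where f=ennreal]) (auto simp: h_def)
    also have "\<dots> = (\<integral>\<^sup>+p. ennreal \<bar>h p - g p\<bar> \<partial>(?M \<Otimes>\<^sub>M lborel))"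
      by (intro lborel.nn_integral_fst) measurable
    finally show ?thesis using g(2) by simp
  qed
  ultimately show ?thesis by blast
qed

lemma run_tendsto:
  assumes "prob_space \<mu>" and \<mu>: "sets \<mu> = sets (coord_space N)"
    and fin: "\<And>n. n < N \<Longrightarrow> (\<integral>\<^sup>+x. ennreal \<bar>x n\<bar> \<partial>\<mu>) < \<infinity>"
    and Q: "\<And>k. k < N \<Longrightarrow> is_quantile k \<mu> (Q k)"
    and \<gamma>: "eventually (\<lambda>i. prob_space (\<gamma> i) \<and> sets (\<gamma> i) = sets (coord_space N) \<and>
      (\<forall>k<N. is_quantile k (coord_conv N \<mu> (\<gamma> i)) (R i k))) F"
    and lim: "\<And>n. n < N \<Longrightarrow> ((\<lambda>i. \<integral>\<^sup>+z. ennreal \<bar>z n\<bar> \<partial>\<gamma> i) \<longlongrightarrow> 0) F"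
    and "n < N"
  shows "((\<lambda>i. \<integral>\<^sup>+u. ennreal \<bar>run Q N u n - run (R i) N u n\<bar> \<partial>noise) \<longlongrightarrow> 0) F"
  using \<open>n < N\<close>
proof (induction n rule: less_induct)
  case (less n)
  let ?A = "\<lambda>k i. \<integral>\<^sup>+u. ennreal \<bar>run Q N u k - run (R i) N u k\<bar> \<partial>noise"
  let ?m = "\<lambda>k i. \<integral>\<^sup>+z. ennreal \<bar>z k\<bar> \<partial>\<gamma> i"
  have small: "eventually (\<lambda>i. ?A n i < ennreal e) F" if "0 < e" for e
  proof -
    have "0 < e / 2" using \<open>0 < e\<close> by simp
    from exists_L1_lipschitz_approx[OF assms(1) \<mu> less.prems Q[OF less.prems] fin[OF less.prems] this]
    obtain g where g: "L1_lipschitz n g" and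
      ge: "(\<integral>\<^sup>+x. \<integral>\<^sup>+q. ennreal \<bar>g (x, q) - qcdf (Q n) (x, q)\<bar> \<partial>lborel \<partial>marginal n \<mu>) < ennreal (e/2)"
      by blast
    define I where "I = (\<integral>\<^sup>+x. \<integral>\<^sup>+q. ennreal \<bar>g (x, q) - qcdf (Q n) (x, q)\<bar> \<partial>lborel \<partial>marginal n \<mu>)"
    have "I + I < ennreal (e/2) + ennreal (e/2)"
      using ge unfolding I_def[symmetric] by (intro add_strict_mono)
    then have I2: "I + I < ennreal e" using \<open>0 < e\<close> by (simp flip: ennreal_plus)
    obtain B where B: "\<And>p. \<bar>g p\<bar> \<le> B" using g unfolding L1_lipschitz_def by blast
    obtain L where L0: "0 \<le> L" and L: "\<And>x y. x \<in> space (coord_space n) \<Longrightarrow> y \<in> space (coord_space n) \<Longrightarrow>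
        (\<integral>\<^sup>+q. ennreal \<bar>g (x, q) - g (y, q)\<bar> \<partial>lborel) \<le> ennreal (L * (\<Sum>i<n. \<bar>x i - y i\<bar>))"
      using g unfolding L1_lipschitz_def by blast
    have "((\<lambda>i. (I + I) + (ennreal L * (\<Sum>k<n. ?A k i) + ennreal L * (\<Sum>k<n. ?m k i) + ?m n i)) \<longlongrightarrow>
        (I + I) + (ennreal L * (\<Sum>k<n. 0) + ennreal L * (\<Sum>k<n. 0) + 0)) F"
      using less.prems by (intro tendsto_add tendsto_const ennreal_tendsto_cmult tendsto_sum less.IH lim) auto
    then have "eventually (\<lambda>i. (I + I) + (ennreal L * (\<Sum>k<n. ?A k i) + ennreal L * (\<Sum>k<n. ?m k i) + ?m n i) < ennreal e) F"
      by (rule order_tendstoD) (use I2 in simp)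
    with \<gamma> show ?thesis
    proof eventually_elim
      case (elim i)
      have "?A n i \<le> (I + I) + (ennreal L * (\<Sum>k<n. ?A k i) + ennreal L * (\<Sum>k<n. ?m k i) + ?m n i)"
        by (rule run_step_bound[OF assms(1) _ \<mu> _ less.prems Q _ L1_lipschitz_measurable[OF g] B L0 L I_def]) (use elim in auto)
      also note elim(2)
      finally show ?case .
    qed
  qed
  show ?case
  proof (rule order_tendstoI)
    fix a :: ennreal assume "0 < a"
    then obtain b where b: "0 < b" "b < a" using dense by blast
    then obtain e where "b = ennreal e" by (cases b) auto
    with b have "0 < e" "ennreal e < a" by auto
    with small[of e] show "eventually (\<lambda>i. ?A n i < a) F"
      by (auto elim: eventually_mono)
  qed simp
qed

section \<open>Paths of vectors and bi-causality\<close>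

text \<open>
  If \<open>\<eta>\<close> is a function \<open>\<phi>\<close> of \<open>\<xi>\<close> and of an innovation \<open>E\<close> independent of \<open>\<xi>\<close>, then the conditional
  law of \<open>\<eta>\<close> given that \<open>\<xi> = x\<close> is the law of \<open>\<phi> (x, E)\<close>. Here \<open>\<xi>\<close> and \<open>\<eta>\<close> live on the space of \<open>P\<close>,
  whereas \<open>E\<close> lives on a space \<open>W\<close> from which \<open>P\<close> is the image under \<open>Z\<close>.
\<close>

lemma is_cond_law_innovation:
  assumes "prob_space W" and X[measurable]: "X \<in> W \<rightarrow>\<^sub>M M" and E[measurable]: "E \<in> W \<rightarrow>\<^sub>M L"
    and \<phi>[measurable]: "\<phi> \<in> M \<Otimes>\<^sub>M L \<rightarrow>\<^sub>M N"
    and indep: "distr W (M \<Otimes>\<^sub>M L) (\<lambda>w. (X w, E w)) = distr W M X \<Otimes>\<^sub>M distr W L E"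
    and Z[measurable]: "Z \<in> W \<rightarrow>\<^sub>M S" and P: "P = distr W S Z"
    and \<xi>[measurable]: "\<xi> \<in> S \<rightarrow>\<^sub>M M" and \<eta>[measurable]: "\<eta> \<in> S \<rightarrow>\<^sub>M N"
    and \<xi>Z: "\<And>w. w \<in> space W \<Longrightarrow> \<xi> (Z w) = X w" and \<eta>Z: "\<And>w. w \<in> space W \<Longrightarrow> \<eta> (Z w) = \<phi> (X w, E w)"
  shows "is_cond_law P M \<xi> N \<eta> (\<lambda>x. distr (distr W L E) N (\<lambda>v. \<phi> (x, v)))"
  unfolding is_cond_law_def
proof (intro conjI ballI)
  interpret W: prob_space W by fact
  interpret E: prob_space "distr W L E" by (rule W.prob_space_distr) fact
  interpret X: prob_space "distr W M X" by (rule W.prob_space_distr) fact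
  show "(\<lambda>x. distr (distr W L E) N (\<lambda>v. \<phi> (x, v))) \<in> M \<rightarrow>\<^sub>M prob_algebra N"
  proof (rule measurable_distr_prob_space2)
    show "(\<lambda>x. distr W L E) \<in> M \<rightarrow>\<^sub>M prob_algebra L"
      by (rule measurable_const) (simp add: space_prob_algebra E.prob_space_axioms)
    show "(\<lambda>(x, v). \<phi> (x, v)) \<in> M \<Otimes>\<^sub>M L \<rightarrow>\<^sub>M N" by simp
  qed
  fix A B assume [measurable]: "A \<in> sets M" "B \<in> sets N"
  let ?S = "{p \<in> space (M \<Otimes>\<^sub>M L). fst p \<in> A \<and> \<phi> p \<in> B}"
  have law: "distr P M \<xi> = distr W M X"
    unfolding P by (subst distr_distr) (auto simp: comp_def \<xi>Z intro!: distr_cong)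
  have "emeasure P {w \<in> space P. \<xi> w \<in> A \<and> \<eta> w \<in> B} = emeasure W {w \<in> space W. X w \<in> A \<and> \<phi> (X w, E w) \<in> B}"
    unfolding P using measurable_space[OF Z]
    by (subst emeasure_distr) (auto simp: \<xi>Z \<eta>Z intro!: arg_cong[where f="emeasure W"])
  also have "\<dots> = emeasure (distr W (M \<Otimes>\<^sub>M L) (\<lambda>w. (X w, E w))) ?S"
    using measurable_space[OF X] measurable_space[OF E]
    by (subst emeasure_distr) (auto simp: space_pair_measure intro!: arg_cong[where f="emeasure W"])
  also have "\<dots> = (\<integral>\<^sup>+x. emeasure (distr W L E) (Pair x -` ?S) \<partial>distr W M X)"
    unfolding indep by (rule E.emeasure_pair_measure_alt) measurable
  also have "\<dots> = (\<integral>\<^sup>+x\<in>A. emeasure (distr (distr W L E) N (\<lambda>v. \<phi> (x, v))) B \<partial>distr W M X)"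
  proof (intro nn_integral_cong)
    fix x assume "x \<in> space (distr W M X)"
    then have x: "x \<in> space M" by simp
    have [measurable]: "(\<lambda>v. \<phi> (x, v)) \<in> L \<rightarrow>\<^sub>M N" by (rule measurable_Pair2[OF \<phi> x])
    show "emeasure (distr W L E) (Pair x -` ?S) =
      emeasure (distr (distr W L E) N (\<lambda>v. \<phi> (x, v))) B * indicator A x"
      using x by (cases "x \<in> A")
        (auto simp: emeasure_distr space_pair_measure intro!: arg_cong[where f="emeasure _"])
  qed
  finally show "emeasure P {w \<in> space P. \<xi> w \<in> A \<and> \<eta> w \<in> B} =
      (\<integral>\<^sup>+x\<in>A. emeasure (distr (distr W L E) N (\<lambda>v. \<phi> (x, v))) B \<partial>distr P M \<xi>)"
    unfolding law .
qed

text \<open>An arbitrary numbering of the coordinates of a vector, from \<open>0\<close> to \<open>d - 1\<close>.\<close>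

definition idx :: "'d::finite \<Rightarrow> nat" where
  "idx = (SOME h. bij_betw h UNIV {..<CARD('d)})"

lemma bij_idx: "bij_betw (idx :: 'd::finite \<Rightarrow> nat) UNIV {..<CARD('d)}"
proof -
  have "\<exists>h. bij_betw h (UNIV :: 'd set) {..<CARD('d)}"
    using ex_bij_betw_finite_nat[of "UNIV :: 'd set"] by (simp add: atLeast0LessThan)
  then show ?thesis unfolding idx_def by (rule someI_ex)
qed

lemma idx_less: "idx (i :: 'd::finite) < CARD('d)"
  using bij_idx[where 'd='d] by (auto simp: bij_betw_def)

lemma inv_idx [simp]: "inv idx (idx i) = i"
  using bij_idx by (intro inv_f_f) (auto simp: bij_betw_def)

lemma idx_inv [simp]: "m < CARD('d) \<Longrightarrow> idx (inv idx m :: 'd::finite) = m"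
  using bij_idx[where 'd='d] by (intro f_inv_into_f) (auto simp: bij_betw_def)

text \<open>
  Paths of length \<open>t\<close> in \<open>\<real>^d\<close> correspond to sequences of length \<open>t d\<close>: coordinate \<open>i\<close> at time \<open>s\<close>, with
  times counted from \<open>1\<close>, has the position \<open>(s - 1) d + idx i\<close>.
\<close>

definition flatten :: "nat \<Rightarrow> (nat \<Rightarrow> real ^ 'd) \<Rightarrow> nat \<Rightarrow> real" where
  "flatten t x = (\<lambda>m\<in>{..<t * CARD('d)}. x (Suc (m div CARD('d))) $ inv idx (m mod CARD('d)))"

definition unflatten :: "nat \<Rightarrow> (nat \<Rightarrow> real) \<Rightarrow> nat \<Rightarrow> real ^ 'd" where
  "unflatten t z = (\<lambda>s\<in>{1..t}. \<chi> i. z ((s - 1) * CARD('d) + idx i))"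

lemma index_less:
  assumes "s \<in> {1..t}"
  shows "(s - 1) * CARD('d) + idx (i :: 'd::finite) < t * CARD('d)"
proof -
  have "(s - 1) * CARD('d) + idx i < (s - 1) * CARD('d) + CARD('d)" using idx_less[of i] by simp
  also have "\<dots> = s * CARD('d)" using assms by (cases s) auto
  also have "\<dots> \<le> t * CARD('d)" using assms by (intro mult_right_mono) auto
  finally show ?thesis .
qed

lemma unflatten_flatten:
  assumes "x \<in> space (path_space t)"
  shows "unflatten t (flatten t x) = (x :: nat \<Rightarrow> real ^ 'd)"
proof
  fix s
  show "unflatten t (flatten t x) s = x s"
  proof (cases "s \<in> {1..t}")
    case True
    have "flatten t x ((s - 1) * CARD('d) + idx i) = x s $ i" for i :: 'd
      using True index_less[OF True, of i] idx_less[of i] by (simp add: flatten_def)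
    with True show ?thesis by (simp add: unflatten_def vec_eq_iff)
  next
    case False
    then show ?thesis using assms by (auto simp: unflatten_def path_space_def space_PiM PiE_def extensional_def)
  qed
qed

lemma flatten_unflatten:
  assumes "z \<in> space (coord_space (t * CARD('d)))"
  shows "flatten t (unflatten t z :: nat \<Rightarrow> real ^ 'd) = z"
proof
  fix m
  show "flatten t (unflatten t z :: nat \<Rightarrow> real ^ 'd) m = z m"
  proof (cases "m < t * CARD('d)")
    case True
    then have "m div CARD('d) < t" by (simp add: less_mult_imp_div_less)
    then show ?thesis using True by (simp add: flatten_def unflatten_def)
  next
    case False
    then show ?thesis using assms by (auto simp: flatten_def space_PiM PiE_def extensional_def)
  qed
qed

lemma measurable_vec_nth [measurable]: "(\<lambda>y :: real ^ 'd. y $ i) \<in> borel_measurable borel"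
  by (intro borel_measurable_continuous_onI continuous_intros)

lemma measurable_vec_lambda:
  assumes "\<And>i. f i \<in> borel_measurable M"
  shows "(\<lambda>w. \<chi> i. f i w :: real ^ 'd) \<in> borel_measurable M"
proof (subst borel_measurable_euclidean_space, intro ballI)
  fix b :: "real ^ 'd" assume "b \<in> Basis"
  then obtain i where "b = axis i 1" by (auto simp: Basis_vec_def)
  then show "(\<lambda>w. (\<chi> i. f i w) \<bullet> b) \<in> borel_measurable M"
    using assms by (simp add: inner_axis)
qed

lemma measurable_path_nth:
  "s \<in> {1..t} \<Longrightarrow> (\<lambda>x. x s) \<in> path_space t \<rightarrow>\<^sub>M borel"
  unfolding path_space_def by (rule measurable_component_singleton)

lemma flatten_measurable [measurable]:
  "(flatten t :: (nat \<Rightarrow> real ^ 'd) \<Rightarrow> _) \<in> path_space t \<rightarrow>\<^sub>M coord_space (t * CARD('d))"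
  unfolding flatten_def
proof (rule measurable_restrict)
  fix m assume "m \<in> {..<t * CARD('d)}"
  then have "Suc (m div CARD('d)) \<in> {1..t}" by (auto simp: less_mult_imp_div_less Suc_le_eq)
  then show "(\<lambda>x :: nat \<Rightarrow> real ^ 'd. x (Suc (m div CARD('d))) $ inv idx (m mod CARD('d))) \<in> borel_measurable (path_space t)"
    by (intro measurable_compose[OF measurable_path_nth measurable_vec_nth])
qed

lemma unflatten_measurable [measurable]:
  "(unflatten t :: _ \<Rightarrow> nat \<Rightarrow> real ^ 'd) \<in> coord_space (t * CARD('d)) \<rightarrow>\<^sub>M path_space t"
  unfolding unflatten_def path_space_def
proof (intro measurable_restrict measurable_vec_lambda)
  fix s and i :: 'd assume "s \<in> {1..t}"
  from index_less[OF this, of i]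
  show "(\<lambda>z. z ((s - 1) * CARD('d) + idx i)) \<in> borel_measurable (coord_space (t * CARD('d)))"
    by (intro measurable_component_singleton) simp
qed

text \<open>The first \<open>t\<close> vectors of the path generated from the uniforms \<open>u\<close>.\<close>

definition run_path :: "nat \<Rightarrow> (nat \<Rightarrow> (nat \<Rightarrow> real) \<times> real \<Rightarrow> real) \<Rightarrow> (nat \<Rightarrow> real) \<Rightarrow> nat \<Rightarrow> real ^ 'd" where
  "run_path t Q u = unflatten t (run Q (t * CARD('d)) u)"

text \<open>
  The vector at time \<open>t + 1\<close> as a function of the path up to time \<open>t\<close> and of the \<open>d\<close> uniforms with
  indices \<open>t d, \<dots>, t d + d - 1\<close>.
\<close>

definition run_next :: "nat \<Rightarrow> (nat \<Rightarrow> (nat \<Rightarrow> real) \<times> real \<Rightarrow> real) \<Rightarrow> (nat \<Rightarrow> real ^ 'd) \<times> (nat \<Rightarrow> real) \<Rightarrow> real ^ 'd" where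
  "run_next t Q = (\<lambda>(x, v). \<chi> i. extend Q v (t * CARD('d)) (flatten t x) CARD('d) (t * CARD('d) + idx i))"

text \<open>The space of the uniforms with indices \<open>m, \<dots>, m + d - 1\<close>.\<close>

abbreviation noise_block :: "nat \<Rightarrow> nat \<Rightarrow> (nat \<Rightarrow> real) measure" where
  "noise_block m d \<equiv> PiM {m..<m + d} (\<lambda>_. borel)"

context
  fixes Q :: "nat \<Rightarrow> (nat \<Rightarrow> real) \<times> real \<Rightarrow> real" and T :: nat
  assumes Q: "\<And>k. k < T * CARD('d::finite) \<Longrightarrow> Q k \<in> borel_measurable (coord_space k \<Otimes>\<^sub>M borel)"
begin

lemma run_path_measurable:
  assumes "t \<le> T"
  shows "(run_path t Q :: _ \<Rightarrow> nat \<Rightarrow> real ^ 'd) \<in> noise \<rightarrow>\<^sub>M path_space t"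
proof -
  have "run Q (t * CARD('d)) \<in> noise \<rightarrow>\<^sub>M coord_space (t * CARD('d))"
    using assms by (intro run_measurable Q) (auto intro: less_le_trans)
  then show ?thesis
    unfolding run_path_def[abs_def] by measurable
qed

lemma run_path_block:
  assumes "t \<le> T"
  shows "\<exists>f :: _ \<Rightarrow> nat \<Rightarrow> real ^ 'd. f \<in> coord_space (t * CARD('d)) \<rightarrow>\<^sub>M path_space t \<and>
    (\<forall>u. run_path t Q u = f (restrict u {..<t * CARD('d)}))"
proof (intro exI conjI allI)
  have "run Q (t * CARD('d)) \<in> coord_space (t * CARD('d)) \<rightarrow>\<^sub>M coord_space (t * CARD('d))"
    using assms by (intro run_measurable_coord Q) (auto intro: less_le_trans)
  then show "(\<lambda>u. unflatten t (run Q (t * CARD('d)) u) :: nat \<Rightarrow> real ^ 'd) \<in> coord_space (t * CARD('d)) \<rightarrow>\<^sub>M path_space t"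
    by measurable
qed (simp add: run_path_def run_restrict)

lemma restrict_run_path:
  assumes "t \<le> T"
  shows "restrict (run_path T Q u) {1..t} = (run_path t Q u :: nat \<Rightarrow> real ^ 'd)"
proof
  fix s
  have le: "t * CARD('d) \<le> T * CARD('d)" using assms by simp
  show "restrict (run_path T Q u) {1..t} s = (run_path t Q u s :: real ^ 'd)"
    using assms run_le[OF index_less le, of s Q u]
    by (auto simp: run_path_def unflatten_def vec_eq_iff)
qed

lemma run_path_Suc:
  assumes "t < T"
  shows "run_path T Q u (Suc t) =
    (run_next t Q (run_path t Q u, restrict u {t * CARD('d)..<t * CARD('d) + CARD('d)}) :: real ^ 'd)"
proof -
  have "run Q (t * CARD('d)) u \<in> space (coord_space (t * CARD('d)))"
  proof -
    have "run Q (t * CARD('d)) \<in> noise \<rightarrow>\<^sub>M coord_space (t * CARD('d))"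
      using assms by (intro run_measurable Q) (auto intro: less_le_trans)
    from measurable_space[OF this, of u] show ?thesis by (simp add: noise_def space_PiM)
  qed
  then have fl: "flatten t (run_path t Q u :: nat \<Rightarrow> real ^ 'd) = run Q (t * CARD('d)) u"
    unfolding run_path_def by (rule flatten_unflatten)
  have "run Q (T * CARD('d)) u (t * CARD('d) + idx i) =
      extend Q u (t * CARD('d)) (run Q (t * CARD('d)) u) CARD('d) (t * CARD('d) + idx i)" for i :: 'd
  proof -
    have "Suc t * CARD('d) \<le> T * CARD('d)" using assms by (intro mult_right_mono) auto
    then have "run Q (T * CARD('d)) u (t * CARD('d) + idx i) = run Q (t * CARD('d) + CARD('d)) u (t * CARD('d) + idx i)"
      using idx_less[of i] by (intro run_le) auto
    then show ?thesis by (simp add: run_add)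
  qed
  also have "extend Q u (t * CARD('d)) (run Q (t * CARD('d)) u) CARD('d) =
      extend Q (restrict u {t * CARD('d)..<t * CARD('d) + CARD('d)}) (t * CARD('d)) (run Q (t * CARD('d)) u) CARD('d)"
    by (rule extend_cong) simp
  finally have "run Q (T * CARD('d)) u (t * CARD('d) + idx i) =
      extend Q (restrict u {t * CARD('d)..<t * CARD('d) + CARD('d)}) (t * CARD('d)) (run Q (t * CARD('d)) u) CARD('d) (t * CARD('d) + idx i)"
    for i :: 'd .
  then have "(\<chi> i. run Q (T * CARD('d)) u (t * CARD('d) + idx i)) =
      (run_next t Q (run_path t Q u, restrict u {t * CARD('d)..<t * CARD('d) + CARD('d)}) :: real ^ 'd)"
    unfolding run_next_def prod.case fl by simp
  then show ?thesis
    using assms by (simp add: run_path_def[of T] unflatten_def)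
qed

lemma run_next_measurable:
  assumes "t < T"
  shows "(run_next t Q :: _ \<Rightarrow> real ^ 'd) \<in> path_space t \<Otimes>\<^sub>M noise_block (t * CARD('d)) CARD('d) \<rightarrow>\<^sub>M borel"
  unfolding run_next_def split_beta'
proof (rule measurable_vec_lambda)
  fix i :: 'd
  have le: "t * CARD('d) + CARD('d) \<le> T * CARD('d)"
    using mult_right_mono[of "Suc t" T "CARD('d)"] assms by simp
  have "(\<lambda>w. extend Q (snd w) (t * CARD('d)) (flatten t (fst w :: nat \<Rightarrow> real ^ 'd)) CARD('d)) \<in>
      path_space t \<Otimes>\<^sub>M noise_block (t * CARD('d)) CARD('d) \<rightarrow>\<^sub>M coord_space (t * CARD('d) + CARD('d))"
    using le by (intro extend_measurable Q) auto
  then show "(\<lambda>w. extend Q (snd w) (t * CARD('d)) (flatten t (fst w :: nat \<Rightarrow> real ^ 'd)) CARD('d) (t * CARD('d) + idx i)) \<in>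
      borel_measurable (path_space t \<Otimes>\<^sub>M noise_block (t * CARD('d)) CARD('d))"
    by (rule measurable_compose[OF _ measurable_component_singleton]) (use idx_less[of i] in simp)
qed

end

text \<open>
  Since the block of uniforms used at time \<open>t + 1\<close> is independent of all earlier ones, the pair of
  next vectors has, given the two pasts, the law of the pair of values of \<open>run_next\<close> on a common fresh
  block. Its components only depend on one past each, and their laws are the conditional laws
  under \<open>\<mu>\<close> and \<open>\<nu>\<close>.
\<close>

lemma run_path_coupling_bicausal:
  fixes Q R :: "nat \<Rightarrow> (nat \<Rightarrow> real) \<times> real \<Rightarrow> real" and \<mu> \<nu> :: "(nat \<Rightarrow> real ^ 'd) measure"
  assumes Q: "\<And>k. k < T * CARD('d) \<Longrightarrow> Q k \<in> borel_measurable (coord_space k \<Otimes>\<^sub>M borel)"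
    and R: "\<And>k. k < T * CARD('d) \<Longrightarrow> R k \<in> borel_measurable (coord_space k \<Otimes>\<^sub>M borel)"
    and \<mu>: "\<mu> = distr noise (path_space T) (run_path T Q)"
    and \<nu>: "\<nu> = distr noise (path_space T) (run_path T R)"
  shows "distr noise (path_space T \<Otimes>\<^sub>M path_space T) (\<lambda>u. (run_path T Q u, run_path T R u)) \<in> Cpl_bc T \<mu> \<nu>"
    (is "?\<pi> \<in> _")
proof -
  have mQ: "(run_path t Q :: _ \<Rightarrow> nat \<Rightarrow> real ^ 'd) \<in> noise \<rightarrow>\<^sub>M path_space t"
    and mR: "(run_path t R :: _ \<Rightarrow> nat \<Rightarrow> real ^ 'd) \<in> noise \<rightarrow>\<^sub>M path_space t" if "t \<le> T" for t
    using that by (auto intro!: run_path_measurable Q R)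
  have rQ: "restrict (run_path T Q u) {1..t} = (run_path t Q u :: nat \<Rightarrow> real ^ 'd)"
    and rR: "restrict (run_path T R u) {1..t} = (run_path t R u :: nat \<Rightarrow> real ^ 'd)" if "t \<le> T" for t u
    by (rule restrict_run_path[OF Q that], assumption, rule restrict_run_path[OF R that], assumption)
  note [measurable] = mQ[OF order_refl] mR[OF order_refl]
  have pm[measurable]: "(\<lambda>u. (run_path T Q u, run_path T R u) :: (nat \<Rightarrow> real ^ 'd) \<times> (nat \<Rightarrow> real ^ 'd)) \<in> noise \<rightarrow>\<^sub>M path_space T \<Otimes>\<^sub>M path_space T"
    by (intro measurable_Pair mQ mR) auto
  have sets_\<pi>: "sets ?\<pi> = sets (\<mu> \<Otimes>\<^sub>M \<nu>)" by (simp add: \<mu> \<nu> cong: sets_pair_measure_cong)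
  have "?\<pi> \<in> Cpl \<mu> \<nu>"
    unfolding Cpl_def mem_Collect_eq
  proof (intro conjI)
    show "?\<pi> \<in> space (prob_algebra (\<mu> \<Otimes>\<^sub>M \<nu>))"
      using sets_\<pi> by (auto simp: space_prob_algebra intro!: noise.prob_space_distr)
    have "distr ?\<pi> \<mu> fst = distr ?\<pi> (path_space T) fst"
      by (rule distr_cong) (auto simp: \<mu>)
    also have "\<dots> = \<mu>" unfolding \<mu> by (subst distr_distr) (auto simp: comp_def)
    finally show "distr ?\<pi> \<mu> fst = \<mu>" .
    have "distr ?\<pi> \<nu> snd = distr ?\<pi> (path_space T) snd"
      by (rule distr_cong) (auto simp: \<nu>)
    also have "\<dots> = \<nu>" unfolding \<nu> by (subst distr_distr) (auto simp: comp_def)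
    finally show "distr ?\<pi> \<nu> snd = \<nu>" .
  qed
  moreover have "\<exists>K\<^sub>\<mu> K\<^sub>\<nu> K\<^sub>\<pi>. is_disintegration t \<mu> K\<^sub>\<mu> \<and> is_disintegration t \<nu> K\<^sub>\<nu> \<and> is_disintegration2 t ?\<pi> K\<^sub>\<pi> \<and>
     (AE (x, y) in ?\<pi>. K\<^sub>\<pi> (restrict x {1..t}, restrict y {1..t}) \<in>
        Cpl (K\<^sub>\<mu> (restrict x {1..t})) (K\<^sub>\<nu> (restrict y {1..t})))" if t: "t \<in> {1..<T}" for t
  proof -
    have tT: "t \<le> T" "t < T" using t by auto
    define m where "m = t * CARD('d)"
    define L where "L = noise_block m CARD('d)"
    define E where "E u = restrict u {m..<m + CARD('d)}" for u :: "nat \<Rightarrow> real"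
    define D where "D = distr noise L E"
    have E[measurable]: "E \<in> noise \<rightarrow>\<^sub>M L" unfolding E_def[abs_def] L_def by measurable
    have \<phi>Q: "(run_next t Q :: _ \<Rightarrow> real ^ 'd) \<in> path_space t \<Otimes>\<^sub>M L \<rightarrow>\<^sub>M borel"
      and \<phi>R: "(run_next t R :: _ \<Rightarrow> real ^ 'd) \<in> path_space t \<Otimes>\<^sub>M L \<rightarrow>\<^sub>M borel"
      unfolding L_def m_def
      by (rule run_next_measurable[OF Q tT(2)], assumption, rule run_next_measurable[OF R tT(2)], assumption)
    have sQ: "run_path T Q u (Suc t) = (run_next t Q (run_path t Q u, E u) :: real ^ 'd)"
      and sR: "run_path T R u (Suc t) = (run_next t R (run_path t R u, E u) :: real ^ 'd)" for u
      unfolding E_def m_def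
      by (rule run_path_Suc[OF Q tT(2)], assumption, rule run_path_Suc[OF R tT(2)], assumption)
    have "\<exists>f :: _ \<Rightarrow> nat \<Rightarrow> real ^ 'd. f \<in> coord_space m \<rightarrow>\<^sub>M path_space t \<and> (\<forall>u. run_path t Q u = f (restrict u {..<m}))"
      unfolding m_def by (rule run_path_block[OF Q tT(1)], assumption)
    then obtain f where f: "f \<in> coord_space m \<rightarrow>\<^sub>M path_space t" "\<And>u. (run_path t Q u :: nat \<Rightarrow> real ^ 'd) = f (restrict u {..<m})"
      by blast
    have "\<exists>g :: _ \<Rightarrow> nat \<Rightarrow> real ^ 'd. g \<in> coord_space m \<rightarrow>\<^sub>M path_space t \<and> (\<forall>u. run_path t R u = g (restrict u {..<m}))"
      unfolding m_def by (rule run_path_block[OF R tT(1)], assumption)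
    then obtain g where g: "g \<in> coord_space m \<rightarrow>\<^sub>M path_space t" "\<And>u. (run_path t R u :: nat \<Rightarrow> real ^ 'd) = g (restrict u {..<m})"
      by blast
    have indep: "distr noise (S \<Otimes>\<^sub>M L) (\<lambda>u. (X u, E u)) = distr noise S X \<Otimes>\<^sub>M distr noise L E"
      if h: "h \<in> coord_space m \<rightarrow>\<^sub>M S" "\<And>u. X u = h (restrict u {..<m})" for X h and S :: "'z measure"
    proof -
      have "(\<lambda>v. v) \<in> noise_block m CARD('d) \<rightarrow>\<^sub>M L" unfolding L_def by simp
      from distr_noise_pair[OF _ h(1) this] show ?thesis
        unfolding h(2) E_def by force
    qed
    have r[measurable]: "(\<lambda>x. restrict x {1..t}) \<in> path_space T \<rightarrow>\<^sub>M path_space t"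
      unfolding path_space_def using tT by (intro measurable_restrict_subset) auto
    have s[measurable]: "(\<lambda>x. x (Suc t)) \<in> path_space T \<rightarrow>\<^sub>M borel"
      using tT by (intro measurable_path_nth) auto
    define K\<mu> where "K\<mu> x = distr D borel (\<lambda>v. run_next t Q (x, v) :: real ^ 'd)" for x
    define K\<nu> where "K\<nu> x = distr D borel (\<lambda>v. run_next t R (x, v) :: real ^ 'd)" for x
    define \<phi> where "\<phi> = (\<lambda>w. (run_next t Q (fst (fst w), snd w) :: real ^ 'd, run_next t R (snd (fst w), snd w) :: real ^ 'd))"
    define K\<pi> where "K\<pi> p = distr D (borel \<Otimes>\<^sub>M borel) (\<lambda>v. \<phi> (p, v))" for p
    note [measurable] = \<phi>Q \<phi>R
    have \<phi>[measurable]: "\<phi> \<in> (path_space t \<Otimes>\<^sub>M path_space t) \<Otimes>\<^sub>M L \<rightarrow>\<^sub>M borel \<Otimes>\<^sub>M borel"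
      unfolding \<phi>_def by measurable
    have 1: "is_disintegration t \<mu> K\<mu>"
      unfolding is_disintegration_def K\<mu>_def[abs_def] D_def
    proof (rule is_cond_law_innovation[OF noise.prob_space_axioms mQ[OF tT(1)] E \<phi>Q indep[OF f] mQ[OF order_refl] \<mu> r s])
      show "restrict (run_path T Q u) {1..t} = (run_path t Q u :: nat \<Rightarrow> real ^ 'd)" for u
        by (rule rQ[OF tT(1)])
      show "run_path T Q u (Suc t) = (run_next t Q (run_path t Q u, E u) :: real ^ 'd)" for u
        by (rule sQ)
    qed
    have 2: "is_disintegration t \<nu> K\<nu>"
      unfolding is_disintegration_def K\<nu>_def[abs_def] D_def
    proof (rule is_cond_law_innovation[OF noise.prob_space_axioms mR[OF tT(1)] E \<phi>R indep[OF g] mR[OF order_refl] \<nu> r s])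
      show "restrict (run_path T R u) {1..t} = (run_path t R u :: nat \<Rightarrow> real ^ 'd)" for u
        by (rule rR[OF tT(1)])
      show "run_path T R u (Suc t) = (run_next t R (run_path t R u, E u) :: real ^ 'd)" for u
        by (rule sR)
    qed
    have 3: "is_disintegration2 t ?\<pi> K\<pi>"
      unfolding is_disintegration2_def K\<pi>_def[abs_def] D_def
    proof (rule is_cond_law_innovation[OF noise.prob_space_axioms _ E \<phi> indep _ refl])
      show "(\<lambda>u. (run_path t Q u, run_path t R u) :: (nat \<Rightarrow> real ^ 'd) \<times> (nat \<Rightarrow> real ^ 'd)) \<in> noise \<rightarrow>\<^sub>M path_space t \<Otimes>\<^sub>M path_space t"
        by (intro measurable_Pair mQ[OF tT(1)] mR[OF tT(1)])
      show "(\<lambda>v. (f v, g v)) \<in> coord_space m \<rightarrow>\<^sub>M path_space t \<Otimes>\<^sub>M path_space t"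
        by (intro measurable_Pair f g)
      show "(\<lambda>(x, y). (restrict x {1..t}, restrict y {1..t})) \<in> path_space T \<Otimes>\<^sub>M path_space T \<rightarrow>\<^sub>M path_space t \<Otimes>\<^sub>M path_space t"
        by measurable
      show "(\<lambda>(x, y). (x (Suc t), y (Suc t))) \<in> path_space T \<Otimes>\<^sub>M path_space T \<rightarrow>\<^sub>M borel \<Otimes>\<^sub>M borel"
        by measurable
    qed (auto simp: f(2)[symmetric] g(2)[symmetric] \<phi>_def rQ[OF tT(1)] rR[OF tT(1)]
        sQ sR simp del: One_nat_def)
    have "K\<pi> (x, y) \<in> Cpl (K\<mu> x) (K\<nu> y)" if x: "x \<in> space (path_space t)" and y: "y \<in> space (path_space t)" for x y
    proof -
      interpret D: prob_space D unfolding D_def by (rule noise.prob_space_distr) measurable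
      have sD[measurable_cong]: "sets D = sets L" by (simp add: D_def)
      have [measurable]: "(\<lambda>v. run_next t Q (x, v) :: real ^ 'd) \<in> D \<rightarrow>\<^sub>M borel"
        "(\<lambda>v. run_next t R (y, v) :: real ^ 'd) \<in> D \<rightarrow>\<^sub>M borel"
        using measurable_Pair2[OF \<phi>Q x] measurable_Pair2[OF \<phi>R y] by (simp_all add: measurable_cong_sets[OF sD refl])
      show ?thesis
        unfolding Cpl_def mem_Collect_eq
      proof (intro conjI)
        show "K\<pi> (x, y) \<in> space (prob_algebra (K\<mu> x \<Otimes>\<^sub>M K\<nu> y))"
          by (auto simp: space_prob_algebra K\<pi>_def \<phi>_def K\<mu>_def K\<nu>_def cong: sets_pair_measure_cong intro!: D.prob_space_distr)
        have "distr (K\<pi> (x, y)) (K\<mu> x) fst = distr (K\<pi> (x, y)) borel fst"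
          by (rule distr_cong) (auto simp: K\<mu>_def)
        also have "\<dots> = K\<mu> x" unfolding K\<pi>_def K\<mu>_def \<phi>_def by (subst distr_distr) (auto simp: comp_def)
        finally show "distr (K\<pi> (x, y)) (K\<mu> x) fst = K\<mu> x" .
        have "distr (K\<pi> (x, y)) (K\<nu> y) snd = distr (K\<pi> (x, y)) borel snd"
          by (rule distr_cong) (auto simp: K\<nu>_def)
        also have "\<dots> = K\<nu> y" unfolding K\<pi>_def K\<nu>_def \<phi>_def by (subst distr_distr) (auto simp: comp_def)
        finally show "distr (K\<pi> (x, y)) (K\<nu> y) snd = K\<nu> y" .
      qed
    qed
    then have "AE (x, y) in ?\<pi>. K\<pi> (restrict x {1..t}, restrict y {1..t}) \<in> Cpl (K\<mu> (restrict x {1..t})) (K\<nu> (restrict y {1..t}))"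
      using measurable_space[OF r] by (intro AE_I2) (auto simp: space_pair_measure)
    with 1 2 3 show ?thesis by blast
  qed
  ultimately show ?thesis unfolding Cpl_bc_def by blast
qed

section \<open>The Gaussian noise\<close>

lemma nn_integral_lborel_vec_prod:
  assumes [measurable]: "\<And>i :: 'd::finite. f i \<in> borel_measurable borel" and nn: "\<And>i x. 0 \<le> f i x"
  shows "(\<integral>\<^sup>+y. ennreal (\<Prod>i\<in>UNIV. f i ((y :: real ^ 'd) $ i)) \<partial>lborel) = (\<Prod>i\<in>UNIV. \<integral>\<^sup>+x. ennreal (f i x) \<partial>lborel)"
proof -
  define g where "g b = f (THE i. b = axis i (1 :: real))" for b :: "real ^ 'd"
  have g: "g (axis i 1) = f i" for i
    unfolding g_def by (rule arg_cong[where f=f]) (auto simp: axis_eq_axis)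
  have inj: "inj (\<lambda>i :: 'd. axis i (1 :: real))" by (auto simp: inj_on_def axis_eq_axis)
  have B: "(Basis :: (real ^ 'd) set) = range (\<lambda>i. axis i 1)" by (auto simp: Basis_vec_def)
  have "(\<integral>\<^sup>+y. (\<Prod>b\<in>Basis. ennreal (g b ((y :: real ^ 'd) \<bullet> b))) \<partial>lborel) = (\<Prod>b\<in>Basis. \<integral>\<^sup>+x. ennreal (g b x) \<partial>lborel)"
    by (rule nn_integral_lborel_prod) (auto simp: B g nn)
  then show ?thesis
    unfolding B by (simp add: prod.reindex[OF inj] g inner_axis prod_ennreal nn)
qed

lemma nn_integral_gaussian_prod:
  fixes f :: "nat \<Rightarrow> 'd::finite \<Rightarrow> real \<Rightarrow> real"
  assumes [measurable]: "\<And>t i. f t i \<in> borel_measurable borel" and nn: "\<And>t i x. 0 \<le> f t i x"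
  shows "(\<integral>\<^sup>+x. ennreal (\<Prod>t\<in>{1..T}. \<Prod>i\<in>UNIV. f t i (x t $ i)) \<partial>gaussian T \<sigma>) =
    (\<Prod>t\<in>{1..T}. \<Prod>i\<in>UNIV. \<integral>\<^sup>+x. ennreal (normal_density 0 \<sigma> x * f t i x) \<partial>lborel)"
proof -
  interpret product_sigma_finite "\<lambda>_ :: nat. lborel :: (real ^ 'd) measure"
    by unfold_locales
  have nd: "0 \<le> normal_density 0 \<sigma> x" for x by (simp add: normal_density_def)
  have m[measurable]: "(\<lambda>x :: nat \<Rightarrow> real ^ 'd. h t i (x t $ i)) \<in> borel_measurable (PiM {1..T} (\<lambda>_. lborel))"
    if "t \<in> {1..T}" "\<And>t i. h t i \<in> borel_measurable borel" for h :: "nat \<Rightarrow> 'd \<Rightarrow> real \<Rightarrow> real" and t i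
  proof -
    have "(\<lambda>x :: nat \<Rightarrow> real ^ 'd. x t) \<in> PiM {1..T} (\<lambda>_. lborel) \<rightarrow>\<^sub>M lborel"
      by (rule measurable_component_singleton) fact
    then have "(\<lambda>x :: nat \<Rightarrow> real ^ 'd. x t) \<in> PiM {1..T} (\<lambda>_. lborel) \<rightarrow>\<^sub>M borel" by simp
    from measurable_compose[OF measurable_compose[OF this measurable_vec_nth] that(2)] show ?thesis .
  qed
  have "(\<integral>\<^sup>+x. ennreal (\<Prod>t\<in>{1..T}. \<Prod>i\<in>UNIV. f t i (x t $ i)) \<partial>gaussian T \<sigma>) =
    (\<integral>\<^sup>+x. ennreal (\<Prod>t\<in>{1..T}. \<Prod>i\<in>UNIV. normal_density 0 \<sigma> (x t $ i)) *
      ennreal (\<Prod>t\<in>{1..T}. \<Prod>i\<in>UNIV. f t i (x t $ i)) \<partial>PiM {1..T} (\<lambda>_. lborel :: (real ^ 'd) measure))"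
    unfolding gaussian_def
    by (rule nn_integral_density) (auto intro!: measurable_compose[OF _ measurable_ennreal] borel_measurable_prod m)
  also have "\<dots> = (\<integral>\<^sup>+x. (\<Prod>t\<in>{1..T}. ennreal (\<Prod>i\<in>UNIV. normal_density 0 \<sigma> (x t $ i) * f t i (x t $ i))) \<partial>PiM {1..T} (\<lambda>_. lborel))"
    by (intro nn_integral_cong) (simp add: prod.distrib ennreal_mult prod_nonneg nd nn prod_ennreal)
  also have "\<dots> = (\<Prod>t\<in>{1..T}. \<integral>\<^sup>+y. ennreal (\<Prod>i\<in>UNIV. normal_density 0 \<sigma> ((y :: real ^ 'd) $ i) * f t i (y $ i)) \<partial>lborel)"
    by (rule product_nn_integral_prod) auto
  also have "\<dots> = (\<Prod>t\<in>{1..T}. \<Prod>i\<in>UNIV. \<integral>\<^sup>+x. ennreal (normal_density 0 \<sigma> x * f t i x) \<partial>lborel)"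
    by (intro prod.cong refl nn_integral_lborel_vec_prod) (auto simp: nd nn)
  finally show ?thesis .
qed

lemma sets_gaussian [simp, measurable_cong]: "sets (gaussian T \<sigma>) = sets (path_space T)"
  by (simp add: gaussian_def path_space_def cong: sets_PiM_cong)

lemma nn_integral_normal_density:
  "0 < \<sigma> \<Longrightarrow> (\<integral>\<^sup>+x. ennreal (normal_density 0 \<sigma> x) \<partial>lborel) = 1"
  by (subst nn_integral_eq_integral) auto

lemma prob_space_gaussian:
  assumes "0 < \<sigma>"
  shows "prob_space (gaussian T \<sigma> :: (nat \<Rightarrow> real ^ 'd) measure)"
proof
  have "emeasure (gaussian T \<sigma>) (space (gaussian T \<sigma> :: (nat \<Rightarrow> real ^ 'd) measure)) =
      (\<integral>\<^sup>+x. ennreal (\<Prod>t\<in>{1..T}. \<Prod>i\<in>(UNIV :: 'd set). (\<lambda>_. 1) (x t $ i)) \<partial>gaussian T \<sigma>)"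
    by simp
  also have "\<dots> = 1"
    using assms by (subst nn_integral_gaussian_prod) (simp_all add: nn_integral_normal_density)
  finally show "emeasure (gaussian T \<sigma>) (space (gaussian T \<sigma> :: (nat \<Rightarrow> real ^ 'd) measure)) = 1" .
qed

lemma gaussian_abs_moment:
  assumes "0 < \<sigma>" and s: "s \<in> {1..T}"
  shows "(\<integral>\<^sup>+z. ennreal \<bar>(z s :: real ^ 'd) $ j\<bar> \<partial>gaussian T \<sigma>) = ennreal (\<sigma> * sqrt (2 / pi))"
proof -
  define f where "f t i = (if t = s \<and> i = j then abs else (\<lambda>_. 1 :: real))" for t :: nat and i :: 'd
  have [measurable]: "f t i \<in> borel_measurable borel" for t i by (simp add: f_def)
  have nn: "0 \<le> f t i x" for t i x by (simp add: f_def)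
  have "(\<Prod>t\<in>{1..T}. \<Prod>i\<in>UNIV. f t i (z t $ i)) = \<bar>z s $ j\<bar>" for z :: "nat \<Rightarrow> real ^ 'd"
  proof -
    have "(\<Prod>i\<in>UNIV. f t i (z t $ i)) = (if t = s then \<bar>z s $ j\<bar> else 1)" for t
    proof (cases "t = s")
      case True
      then have "(\<Prod>i\<in>UNIV. f t i (z t $ i)) = (\<Prod>i\<in>UNIV. if i = j then \<bar>z s $ j\<bar> else 1)"
        by (intro prod.cong) (auto simp: f_def)
      with True show ?thesis by simp
    qed (simp add: f_def)
    then show ?thesis using s by simp
  qed
  then have "(\<integral>\<^sup>+z. ennreal \<bar>(z s :: real ^ 'd) $ j\<bar> \<partial>gaussian T \<sigma>) =
      (\<integral>\<^sup>+z. ennreal (\<Prod>t\<in>{1..T}. \<Prod>i\<in>UNIV. f t i (z t $ i)) \<partial>gaussian T \<sigma>)"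
    by simp
  also have "\<dots> = (\<Prod>t\<in>{1..T}. \<Prod>i\<in>UNIV. \<integral>\<^sup>+x. ennreal (normal_density 0 \<sigma> x * f t i x) \<partial>lborel)"
    by (rule nn_integral_gaussian_prod) (simp_all add: nn)
  also have "\<dots> = ennreal (\<sigma> * sqrt (2 / pi))"
  proof -
    have "has_bochner_integral lborel (\<lambda>x. normal_density 0 \<sigma> x * \<bar>x\<bar>) (\<sigma> * sqrt (2 / pi))"
      using normal_moment_abs_odd[of \<sigma> 0 0] \<open>0 < \<sigma>\<close> by simp
    then have moment: "(\<integral>\<^sup>+x. ennreal (normal_density 0 \<sigma> x * \<bar>x\<bar>) \<partial>lborel) = ennreal (\<sigma> * sqrt (2 / pi))"
      by (subst nn_integral_eq_integral) (auto simp: has_bochner_integral_iff)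
    have "(\<Prod>i\<in>UNIV. \<integral>\<^sup>+x. ennreal (normal_density 0 \<sigma> x * f t i x) \<partial>lborel) =
        (if t = s then ennreal (\<sigma> * sqrt (2 / pi)) else 1)" for t
    proof (cases "t = s")
      case True
      then have "(\<Prod>i\<in>UNIV. \<integral>\<^sup>+x. ennreal (normal_density 0 \<sigma> x * f t i x) \<partial>lborel) =
          (\<Prod>i\<in>UNIV. if i = j then ennreal (\<sigma> * sqrt (2 / pi)) else 1)"
        using \<open>0 < \<sigma>\<close> by (intro prod.cong) (auto simp: f_def moment nn_integral_normal_density)
      with True show ?thesis by simp
    qed (use \<open>0 < \<sigma>\<close> in \<open>simp add: f_def nn_integral_normal_density\<close>)
    then show ?thesis using s by simp
  qed
  finally show ?thesis .
qed

section \<open>The adapted distance\<close>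

lemma measurable_path_add:
  fixes \<mu> \<gamma> :: "(nat \<Rightarrow> real ^ 'd) measure"
  assumes "sets \<mu> = sets (path_space T)" "sets \<gamma> = sets (path_space T)"
  shows "(\<lambda>(x, y). \<lambda>t\<in>{1..T}. x t + y t) \<in> \<mu> \<Otimes>\<^sub>M \<gamma> \<rightarrow>\<^sub>M path_space T"
proof -
  have "(\<lambda>w. \<lambda>t\<in>{1..T}. fst w t + snd w t) \<in> path_space T \<Otimes>\<^sub>M path_space T \<rightarrow>\<^sub>M PiM {1..T} (\<lambda>_. borel :: (real ^ 'd) measure)"
    by (intro measurable_restrict borel_measurable_add measurable_compose[OF measurable_fst measurable_path_nth]
        measurable_compose[OF measurable_snd measurable_path_nth])
  then have "(\<lambda>(x, y). \<lambda>t\<in>{1..T}. x t + y t :: real ^ 'd) \<in> path_space T \<Otimes>\<^sub>M path_space T \<rightarrow>\<^sub>M path_space T"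
    unfolding split_beta' path_space_def .
  then show ?thesis
    unfolding measurable_cong_sets[OF sets_pair_measure_cong[OF assms] refl] .
qed

lemma prob_space_path_conv:
  fixes \<mu> \<gamma> :: "(nat \<Rightarrow> real ^ 'd) measure"
  assumes "prob_space \<mu>" "prob_space \<gamma>"
    and "sets \<mu> = sets (path_space T)" "sets \<gamma> = sets (path_space T)"
  shows "prob_space (path_conv T \<mu> \<gamma>)"
proof -
  interpret \<mu>: prob_space \<mu> by fact
  interpret \<gamma>: prob_space \<gamma> by fact
  interpret pair_prob_space \<mu> \<gamma> ..
  show ?thesis
    unfolding path_conv_def by (rule prob_space_distr[OF measurable_path_add[OF assms(3,4)]])
qed

lemma distr_flatten_path_conv:
  fixes \<mu> \<gamma> :: "(nat \<Rightarrow> real ^ 'd) measure"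
  assumes "prob_space \<mu>" "prob_space \<gamma>"
    and [measurable_cong]: "sets \<mu> = sets (path_space T)" "sets \<gamma> = sets (path_space T)"
  shows "distr (path_conv T \<mu> \<gamma>) (coord_space (T * CARD('d))) (flatten T) =
    coord_conv (T * CARD('d)) (distr \<mu> (coord_space (T * CARD('d))) (flatten T)) (distr \<gamma> (coord_space (T * CARD('d))) (flatten T))"
proof -
  let ?N = "T * CARD('d)"
  interpret \<gamma>: prob_space \<gamma> by fact
  interpret \<gamma>': prob_space "distr \<gamma> (coord_space ?N) (flatten T)" by (rule \<gamma>.prob_space_distr) measurable
  note add = measurable_path_add[OF assms(3,4)]
  have cadd: "(\<lambda>(x, z). \<lambda>i\<in>{..<?N}. x i + z i) \<in> coord_space ?N \<Otimes>\<^sub>M coord_space ?N \<rightarrow>\<^sub>M coord_space ?N"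
    by measurable
  have "distr (path_conv T \<mu> \<gamma>) (coord_space ?N) (flatten T) =
      distr (\<mu> \<Otimes>\<^sub>M \<gamma>) (coord_space ?N) (\<lambda>(x, z). \<lambda>i\<in>{..<?N}. flatten T x i + flatten T z i)"
    unfolding path_conv_def
  proof (subst distr_distr[OF flatten_measurable add], rule distr_cong)
    fix p :: "(nat \<Rightarrow> real ^ 'd) \<times> (nat \<Rightarrow> real ^ 'd)"
    show "(flatten T \<circ> (\<lambda>(x, y). \<lambda>t\<in>{1..T}. x t + y t)) p = (\<lambda>(x, z). \<lambda>i\<in>{..<?N}. flatten T x i + flatten T z i) p"
      by (cases p) (auto simp: flatten_def fun_eq_iff less_mult_imp_div_less Suc_le_eq)
  qed auto
  also have "\<dots> = distr (distr (\<mu> \<Otimes>\<^sub>M \<gamma>) (coord_space ?N \<Otimes>\<^sub>M coord_space ?N) (\<lambda>(x, z). (flatten T x, flatten T z)))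
      (coord_space ?N) (\<lambda>(x, z). \<lambda>i\<in>{..<?N}. x i + z i)"
    by (subst distr_distr[OF cadd]) (auto simp: comp_def intro!: distr_cong)
  also have "distr (\<mu> \<Otimes>\<^sub>M \<gamma>) (coord_space ?N \<Otimes>\<^sub>M coord_space ?N) (\<lambda>(x, z). (flatten T x, flatten T z)) =
      distr \<mu> (coord_space ?N) (flatten T) \<Otimes>\<^sub>M distr \<gamma> (coord_space ?N) (flatten T)"
    by (rule pair_measure_distr[symmetric]) (use \<gamma>'.sigma_finite_measure_axioms in auto)
  finally show ?thesis
    unfolding coord_conv_def .
qed

lemma distr_run_path:
  fixes \<mu> :: "(nat \<Rightarrow> real ^ 'd) measure"
  assumes "prob_space \<mu>" and [measurable_cong]: "sets \<mu> = sets (path_space T)"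
    and Q: "\<And>k. k < T * CARD('d) \<Longrightarrow> is_quantile k (distr \<mu> (coord_space (T * CARD('d))) (flatten T)) (Q k)"
  shows "distr noise (path_space T) (run_path T Q) = \<mu>"
proof -
  let ?N = "T * CARD('d)" and ?\<mu> = "distr \<mu> (coord_space (T * CARD('d))) (flatten T)"
  interpret \<mu>: prob_space \<mu> by fact
  have [measurable]: "run Q ?N \<in> noise \<rightarrow>\<^sub>M coord_space ?N"
    by (intro run_measurable is_quantile_measurable[OF Q])
  have "distr noise (path_space T) (run_path T Q :: _ \<Rightarrow> nat \<Rightarrow> real ^ 'd) =
      distr (distr noise (coord_space ?N) (run Q ?N)) (path_space T) (unflatten T)"
    by (subst distr_distr) (auto simp: comp_def run_path_def intro!: distr_cong)
  also have "distr noise (coord_space ?N) (run Q ?N) = marginal ?N ?\<mu>"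
    by (rule distr_run[OF \<mu>.prob_space_distr]) (auto intro: Q)
  also have "\<dots> = ?\<mu>" by (rule marginal_self) simp
  also have "distr ?\<mu> (path_space T) (unflatten T) = distr \<mu> (path_space T) (\<lambda>x. unflatten T (flatten T x) :: nat \<Rightarrow> real ^ 'd)"
    by (subst distr_distr) (auto simp: comp_def)
  also have "\<dots> = distr \<mu> \<mu> (\<lambda>x. x)"
    using sets_eq_imp_space_eq[OF assms(2)] by (intro distr_cong) (auto simp: unflatten_flatten assms(2))
  finally show ?thesis by simp
qed

text \<open>
  The Euclidean norm of a vector is at most the sum of its absolute coordinates, so the cost of the
  coupling is controlled coordinate by coordinate.
\<close>

lemma AW1_le_run:
  fixes \<mu> \<nu> :: "(nat \<Rightarrow> real ^ 'd) measure"
  assumes \<mu>: "prob_space \<mu>" "sets \<mu> = sets (path_space T)" and \<nu>: "prob_space \<nu>" "sets \<nu> = sets (path_space T)"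
    and Q: "\<And>k. k < T * CARD('d) \<Longrightarrow> is_quantile k (distr \<mu> (coord_space (T * CARD('d))) (flatten T)) (Q k)"
    and R: "\<And>k. k < T * CARD('d) \<Longrightarrow> is_quantile k (distr \<nu> (coord_space (T * CARD('d))) (flatten T)) (R k)"
  shows "AW1 T \<mu> \<nu> \<le> (\<Sum>t\<in>{1..T}. \<Sum>i\<in>UNIV.
    \<integral>\<^sup>+u. ennreal \<bar>run Q (T * CARD('d)) u ((t - 1) * CARD('d) + idx (i :: 'd)) - run R (T * CARD('d)) u ((t - 1) * CARD('d) + idx i)\<bar> \<partial>noise)"
proof -
  let ?N = "T * CARD('d)"
  let ?\<pi> = "distr noise (path_space T \<Otimes>\<^sub>M path_space T) (\<lambda>u. (run_path T Q u, run_path T R u)) :: ((nat \<Rightarrow> real ^ 'd) \<times> (nat \<Rightarrow> real ^ 'd)) measure"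
  let ?m = "\<lambda>t (i :: 'd). (t - 1) * CARD('d) + idx i"
  note mQ = is_quantile_measurable[OF Q] and mR = is_quantile_measurable[OF R]
  have lawQ: "distr noise (path_space T) (run_path T Q) = \<mu>" and lawR: "distr noise (path_space T) (run_path T R) = \<nu>"
    using distr_run_path[OF \<mu> Q] distr_run_path[OF \<nu> R] by auto
  have "?\<pi> \<in> Cpl_bc T \<mu> \<nu>"
    by (intro run_path_coupling_bicausal mQ mR lawQ[symmetric] lawR[symmetric])
  then have "AW1 T \<mu> \<nu> \<le> (\<integral>\<^sup>+(x, y). ennreal (path_norm T (\<lambda>t. x t - y t)) \<partial>?\<pi>)"
    unfolding AW1_def by (rule INF_lower)
  also have "\<dots> = (\<integral>\<^sup>+u. ennreal (path_norm T (\<lambda>t. run_path T Q u t - run_path T R u t :: real ^ 'd)) \<partial>noise)"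
  proof (subst nn_integral_distr)
    show "(\<lambda>u. (run_path T Q u, run_path T R u) :: (nat \<Rightarrow> real ^ 'd) \<times> (nat \<Rightarrow> real ^ 'd)) \<in> noise \<rightarrow>\<^sub>M path_space T \<Otimes>\<^sub>M path_space T"
      by (intro measurable_Pair)
        (rule run_path_measurable[OF mQ order_refl], assumption, rule run_path_measurable[OF mR order_refl], assumption)
    have "(\<lambda>p :: (nat \<Rightarrow> real ^ 'd) \<times> (nat \<Rightarrow> real ^ 'd). norm (fst p t - snd p t)) \<in> borel_measurable (path_space T \<Otimes>\<^sub>M path_space T)"
      if "t \<in> {1..T}" for t
    proof -
      note [measurable] = measurable_path_nth[OF that, where 'a='d]
      have "(\<lambda>p :: (nat \<Rightarrow> real ^ 'd) \<times> (nat \<Rightarrow> real ^ 'd). fst p t) \<in> borel_measurable (path_space T \<Otimes>\<^sub>M path_space T)"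
        "(\<lambda>p :: (nat \<Rightarrow> real ^ 'd) \<times> (nat \<Rightarrow> real ^ 'd). snd p t) \<in> borel_measurable (path_space T \<Otimes>\<^sub>M path_space T)"
        by measurable
      then show ?thesis by measurable
    qed
    then have "(\<lambda>(x, y). ennreal (path_norm T (\<lambda>t. x t - y t :: real ^ 'd))) \<in> borel_measurable (path_space T \<Otimes>\<^sub>M path_space T)"
      unfolding path_norm_def split_beta' by (intro measurable_compose[OF _ measurable_ennreal] borel_measurable_sum) auto
    then show "(\<lambda>(x, y). ennreal (path_norm T (\<lambda>t. x t - y t :: real ^ 'd))) \<in> borel_measurable ?\<pi>"
      by simp
  qed simp
  also have "\<dots> \<le> (\<integral>\<^sup>+u. (\<Sum>t\<in>{1..T}. \<Sum>i\<in>UNIV. ennreal \<bar>run Q ?N u (?m t i) - run R ?N u (?m t i)\<bar>) \<partial>noise)"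
  proof (intro nn_integral_mono)
    fix u
    have "path_norm T (\<lambda>t. run_path T Q u t - run_path T R u t :: real ^ 'd) \<le>
        (\<Sum>t\<in>{1..T}. \<Sum>i\<in>UNIV. \<bar>run Q ?N u (?m t i) - run R ?N u (?m t i)\<bar>)"
      unfolding path_norm_def
    proof (rule sum_mono)
      fix t assume t: "t \<in> {1..T}"
      have "norm (run_path T Q u t - run_path T R u t :: real ^ 'd) \<le> (\<Sum>i\<in>UNIV. \<bar>(run_path T Q u t - run_path T R u t :: real ^ 'd) $ i\<bar>)"
        by (rule norm_le_l1_cart)
      also have "\<dots> = (\<Sum>i\<in>UNIV. \<bar>run Q ?N u (?m t i) - run R ?N u (?m t i)\<bar>)"
        using t by (simp add: run_path_def unflatten_def)
      finally show "norm (run_path T Q u t - run_path T R u t :: real ^ 'd) \<le> (\<Sum>i\<in>UNIV. \<bar>run Q ?N u (?m t i) - run R ?N u (?m t i)\<bar>)" .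
    qed
    then show "ennreal (path_norm T (\<lambda>t. run_path T Q u t - run_path T R u t :: real ^ 'd)) \<le>
        (\<Sum>t\<in>{1..T}. \<Sum>i\<in>UNIV. ennreal \<bar>run Q ?N u (?m t i) - run R ?N u (?m t i)\<bar>)"
      by (simp add: sum_nonneg ennreal_leI)
  qed
  also have "\<dots> = (\<Sum>t\<in>{1..T}. \<Sum>i\<in>UNIV. \<integral>\<^sup>+u. ennreal \<bar>run Q ?N u (?m t i) - run R ?N u (?m t i)\<bar> \<partial>noise)"
  proof -
    have rm: "run Q ?N \<in> noise \<rightarrow>\<^sub>M coord_space ?N" "run R ?N \<in> noise \<rightarrow>\<^sub>M coord_space ?N"
      by (intro run_measurable mQ mR, assumption)+
    have m: "(\<lambda>u. ennreal \<bar>run Q ?N u (?m t i) - run R ?N u (?m t i)\<bar>) \<in> borel_measurable noise" if "t \<in> {1..T}" for t and i :: 'd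
    proof -
      have "(\<lambda>x. x (?m t i)) \<in> borel_measurable (coord_space ?N)"
        using index_less[OF that, of i] by (intro measurable_component_singleton) simp
      from measurable_compose[OF rm(1) this] measurable_compose[OF rm(2) this]
      show ?thesis by measurable
    qed
    show ?thesis
      by (subst nn_integral_sum, intro borel_measurable_sum m, assumption)
         (intro sum.cong refl nn_integral_sum m)
  qed
  finally show ?thesis .
qed

theorem theorem5p5:
  fixes T :: nat and \<mu> :: "(nat \<Rightarrow> real ^ 'd) measure"
  assumes "T \<ge> 1" and "\<mu> \<in> P1 T"
  shows "((\<lambda>\<sigma>. AW1 T \<mu> (path_conv T \<mu> (gaussian T \<sigma>))) \<longlongrightarrow> 0) (at_right 0)"
proof -
  let ?N = "T * CARD('d)"
  let ?fl = "\<lambda>\<mu> :: (nat \<Rightarrow> real ^ 'd) measure. distr \<mu> (coord_space ?N) (flatten T)"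
  let ?\<nu> = "\<lambda>\<sigma>. path_conv T \<mu> (gaussian T \<sigma>)"
  have \<mu>: "prob_space \<mu>" "sets \<mu> = sets (path_space T)" and mom: "(\<integral>\<^sup>+x. ennreal (path_norm T x) \<partial>\<mu>) < \<infinity>"
    using assms(2) by (auto simp: P1_def space_prob_algebra)
  note [measurable_cong] = \<mu>(2)
  interpret \<mu>: prob_space \<mu> by fact
  have fl\<mu>: "prob_space (?fl \<mu>)" by (rule \<mu>.prob_space_distr) measurable
  have fl\<gamma>: "prob_space (?fl (gaussian T \<sigma>))" if "0 < \<sigma>" for \<sigma>
    by (rule prob_space.prob_space_distr[OF prob_space_gaussian[OF that]]) measurable
  have fl\<nu>: "?fl (?\<nu> \<sigma>) = coord_conv ?N (?fl \<mu>) (?fl (gaussian T \<sigma>))" if "0 < \<sigma>" for \<sigma>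
    by (rule distr_flatten_path_conv[OF \<mu>(1) prob_space_gaussian[OF that] \<mu>(2) sets_gaussian])
  have "\<exists>Q. \<forall>k<?N. is_quantile k (?fl \<mu>) (Q k)"
    using exists_is_quantile[OF fl\<mu>, of ?N] by (intro choice) auto
  then obtain Q where Q: "\<And>k. k < ?N \<Longrightarrow> is_quantile k (?fl \<mu>) (Q k)" by blast
  \<comment> \<open>For \<open>\<sigma> = 0\<close> the density vanishes, so quantile functions are only chosen for \<open>\<sigma> > 0\<close>, which suffices for the limit.\<close>
  have "\<exists>R. 0 < \<sigma> \<longrightarrow> (\<forall>k<?N. is_quantile k (?fl (?\<nu> \<sigma>)) (R k))" for \<sigma>
  proof (cases "0 < \<sigma>")
    case True
    have "prob_space (?fl (?\<nu> \<sigma>))"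
      unfolding fl\<nu>[OF True] by (rule prob_space_coord_conv) (auto intro: fl\<mu> fl\<gamma>[OF True])
    then have "\<exists>R. \<forall>k<?N. is_quantile k (?fl (?\<nu> \<sigma>)) (R k)"
      using exists_is_quantile[of "?fl (?\<nu> \<sigma>)" ?N] by (intro choice) auto
    then show ?thesis by blast
  qed simp
  then obtain R where R: "\<And>\<sigma> k. 0 < \<sigma> \<Longrightarrow> k < ?N \<Longrightarrow> is_quantile k (?fl (?\<nu> \<sigma>)) (R \<sigma> k)"
    by metis
  have flatten_nth: "flatten T x n = x (Suc (n div CARD('d))) $ inv idx (n mod CARD('d))" if "n < ?N" for n and x :: "nat \<Rightarrow> real ^ 'd"
    using that by (simp add: flatten_def)
  have fl_moment: "(\<integral>\<^sup>+x. ennreal \<bar>x n\<bar> \<partial>?fl M) = (\<integral>\<^sup>+x. ennreal \<bar>x (Suc (n div CARD('d))) $ inv idx (n mod CARD('d))\<bar> \<partial>M)"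
    if "n < ?N" "sets M = sets (path_space T)" for n and M :: "(nat \<Rightarrow> real ^ 'd) measure"
  proof -
    have "flatten T \<in> M \<rightarrow>\<^sub>M coord_space ?N" by (simp add: measurable_cong_sets[OF that(2) refl])
    then show ?thesis using that(1) by (subst nn_integral_distr) (auto simp: flatten_nth)
  qed
  have in_T: "Suc (n div CARD('d)) \<in> {1..T}" if "n < ?N" for n
    using that by (auto simp: less_mult_imp_div_less Suc_le_eq)
  have run0: "((\<lambda>\<sigma>. \<integral>\<^sup>+u. ennreal \<bar>run Q ?N u n - run (R \<sigma>) ?N u n\<bar> \<partial>noise) \<longlongrightarrow> 0) (at_right 0)" if "n < ?N" for n
  proof (rule run_tendsto[OF fl\<mu> _ _ Q, where \<gamma>="\<lambda>\<sigma>. ?fl (gaussian T \<sigma>)"])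
    fix n assume n: "n < ?N"
    have "(\<integral>\<^sup>+x. ennreal \<bar>x n\<bar> \<partial>?fl \<mu>) = (\<integral>\<^sup>+x. ennreal \<bar>x (Suc (n div CARD('d))) $ inv idx (n mod CARD('d))\<bar> \<partial>\<mu>)"
      by (rule fl_moment[OF n \<mu>(2)])
    also have "\<dots> \<le> (\<integral>\<^sup>+x. ennreal (path_norm T x) \<partial>\<mu>)"
    proof (intro nn_integral_mono ennreal_leI)
      fix x :: "nat \<Rightarrow> real ^ 'd"
      have "\<bar>x (Suc (n div CARD('d))) $ inv idx (n mod CARD('d))\<bar> \<le> norm (x (Suc (n div CARD('d))))"
        by (rule component_le_norm_cart)
      also have "\<dots> \<le> path_norm T x"
        unfolding path_norm_def by (rule member_le_sum[OF in_T[OF n]]) auto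
      finally show "\<bar>x (Suc (n div CARD('d))) $ inv idx (n mod CARD('d))\<bar> \<le> path_norm T x" .
    qed
    also note mom
    finally show "(\<integral>\<^sup>+x. ennreal \<bar>x n\<bar> \<partial>?fl \<mu>) < \<infinity>" .
    have "((\<lambda>\<sigma>. ennreal (\<sigma> * sqrt (2 / pi))) \<longlongrightarrow> ennreal (0 * sqrt (2 / pi))) (at_right 0)"
      by (intro tendsto_ennrealI tendsto_intros)
    moreover have "eventually (\<lambda>\<sigma>. ennreal (\<sigma> * sqrt (2 / pi)) = (\<integral>\<^sup>+z. ennreal \<bar>z n\<bar> \<partial>?fl (gaussian T \<sigma>))) (at_right 0)"
      using eventually_at_right_less
      by eventually_elim (simp only: fl_moment[OF n sets_gaussian] gaussian_abs_moment[OF _ in_T[OF n]])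
    ultimately show "((\<lambda>\<sigma>. \<integral>\<^sup>+z. ennreal \<bar>z n\<bar> \<partial>?fl (gaussian T \<sigma>)) \<longlongrightarrow> 0) (at_right 0)"
      by (simp add: tendsto_cong)
  next
    show "eventually (\<lambda>\<sigma>. prob_space (?fl (gaussian T \<sigma>)) \<and> sets (?fl (gaussian T \<sigma>)) = sets (coord_space ?N) \<and>
        (\<forall>k<?N. is_quantile k (coord_conv ?N (?fl \<mu>) (?fl (gaussian T \<sigma>))) (R \<sigma> k))) (at_right 0)"
      using eventually_at_right_less by eventually_elim (auto simp: fl\<gamma> fl\<nu>[symmetric] R)
  qed (use that in auto)
  let ?S = "\<lambda>\<sigma>. \<Sum>t\<in>{1..T}. \<Sum>i\<in>UNIV. \<integral>\<^sup>+u. ennreal \<bar>run Q ?N u ((t - 1) * CARD('d) + idx (i :: 'd)) -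
    run (R \<sigma>) ?N u ((t - 1) * CARD('d) + idx i)\<bar> \<partial>noise"
  have "(?S \<longlongrightarrow> (\<Sum>t\<in>{1..T}. \<Sum>i\<in>(UNIV :: 'd set). 0)) (at_right 0)"
    by (intro tendsto_sum run0 index_less)
  then have S0: "(?S \<longlongrightarrow> 0) (at_right 0)" by simp
  have bound: "AW1 T \<mu> (?\<nu> \<sigma>) \<le> ?S \<sigma>" if "0 < \<sigma>" for \<sigma>
  proof -
    have "prob_space (?\<nu> \<sigma>)"
      by (rule prob_space_path_conv[OF \<mu>(1) prob_space_gaussian[OF that] \<mu>(2) sets_gaussian])
    then show ?thesis
      by (intro AW1_le_run \<mu> Q R that) (auto simp: path_conv_def)
  qed
  show ?thesis
  proof (rule tendsto_sandwich[OF _ _ tendsto_const S0])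
    show "eventually (\<lambda>\<sigma>. AW1 T \<mu> (?\<nu> \<sigma>) \<le> ?S \<sigma>) (at_right 0)"
      using eventually_at_right_less by eventually_elim (rule bound)
  qed simp
qed

end
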